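(* Let $\mu$ be fixed with $2\mu\notin\mathbb Z$. For any pair of values $(a_0,\sigma_0)$, $0\le\sigma_0<1$ (with $a_0\ne0$ complex), there exists a unique branch of the solution of $\mathrm{PVI}_\mu$ with the asymptotic behaviour $$y(x)=a_0x^{1-\sigma_0}\,(1+x^{\varepsilon}f(x))\qquad\text{as }x\to0,$$ for some $\varepsilon>0$ and some smooth function $f(x)$ such that $\lim_{x\to0}f(x)=\text{const}$.
   Context: $\mathrm{PVI}_\mu$ is the equation $$y''=\tfrac12\Big(\tfrac1y+\tfrac1{y-1}+\tfrac1{y-x}\Big)y'^2-\Big(\tfrac1x+\tfrac1{x-1}+\tfrac1{y-x}\Big)y'+\tfrac12\,\frac{y(y-1)(y-x)}{x^2(x-1)^2}\Big[(2\mu-1)^2+\frac{x(x-1)}{(y-x)^2}\Big].$$ The complex plane is cut along a ray $\arg x=\varphi$ so that $x^{1-\sigma_0}$ is well defined; a branch near $0$ is a solution on $\{0<|x|\le r,\ \arg x\ne\varphi\}$ for some small $r>0$.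
   Formalization: Where y equals 0, 1 or x, the equation is required only after multiplying out its denominators; hence for (a_0, σ_0) = (1, 0), where no solution of the displayed equation has this behaviour, the unique branch is the degenerate y(x) = x. *)

theory Defs
  imports "HOL-Complex_Analysis.Complex_Analysis"
begin

definition PVI_rhs :: "complex \<Rightarrow> complex \<Rightarrow> complex \<Rightarrow> complex \<Rightarrow> complex" where
  "PVI_rhs \<mu> x y p =
     1/2 * (1/y + 1/(y - 1) + 1/(y - x)) * p^2
     - (1/x + 1/(x - 1) + 1/(y - x)) * p
     + 1/2 * (y * (y - 1) * (y - x) / (x^2 * (x - 1)^2))
           * ((2*\<mu> - 1)^2 + x * (x - 1) / (y - x)^2)"

text \<open>The same equation, multiplied by \<open>2 x\<^sup>2 (x - 1)\<^sup>2 y (y - 1) (y - x)\<close>.\<close>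

definition PVI_cleared ::
  "complex \<Rightarrow> complex \<Rightarrow> complex \<Rightarrow> complex \<Rightarrow> complex \<Rightarrow> bool" where
  "PVI_cleared \<mu> x y p q \<longleftrightarrow>
     2 * x^2 * (x - 1)^2 * y * (y - 1) * (y - x) * q =
       x^2 * (x - 1)^2 * ((y - 1) * (y - x) + y * (y - x) + y * (y - 1)) * p^2
       - 2 * x * (x - 1) * y * (y - 1) * ((x - 1) * (y - x) + x * (y - x) + x * (x - 1)) * p
       + y^2 * (y - 1)^2 * ((2*\<mu> - 1)^2 * (y - x)^2 + x * (x - 1))"

text \<open>
  A holomorphic solution may take one of the values \<open>0\<close>, \<open>1\<close>, \<open>x\<close>, where the right-hand side is
  not defined although the solution is regular; division by zero in HOL would give the equation
  a meaningless content there.  At such points the cleared equation is used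
  (it says \<open>y' = 0\<close>, \<open>y' = 0\<close>, \<open>y' = 1\<close>, respectively).  The only additional solutions
  this admits are the constants \<open>0\<close>, \<open>1\<close> and the degenerate solution \<open>y(x) = x\<close>.  The last one is
  the branch with \<open>a\<^sub>0 = 1\<close>, \<open>\<sigma>\<^sub>0 = 0\<close>; for all other \<open>(a\<^sub>0, \<sigma>\<^sub>0)\<close> with \<open>a\<^sub>0 \<noteq> 0\<close> the
  asymptotic behaviour keeps \<open>y\<close> away from the three values near \<open>0\<close>.
\<close>

definition PVI_at ::
  "complex \<Rightarrow> complex \<Rightarrow> complex \<Rightarrow> complex \<Rightarrow> complex \<Rightarrow> bool" where
  "PVI_at \<mu> x y p q \<longleftrightarrow>
     (if y \<in> {0, 1, x} then PVI_cleared \<mu> x y p q else q = PVI_rhs \<mu> x y p)"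

lemma PVI_at_iff_cleared:
  assumes "x \<noteq> 0" "x \<noteq> 1"
  shows "PVI_at \<mu> x y p q \<longleftrightarrow> PVI_cleared \<mu> x y p q"
proof (cases "y \<in> {0, 1, x}")
  case True
  then show ?thesis by (simp add: PVI_at_def)
next
  case False
  define A where "A = inverse y"
  define B where "B = inverse (y - 1)"
  define C where "C = inverse (y - x)"
  define D where "D = inverse x"
  define E where "E = inverse (x - 1)"
  have i: "A * y = 1" "B * (y - 1) = 1" "C * (y - x) = 1" "D * x = 1" "E * (x - 1) = 1"
    using False assms by (auto simp: A_def B_def C_def D_def E_def)
  define K where "K = 2 * x^2 * (x - 1)^2 * y * (y - 1) * (y - x)"
  have "K \<noteq> 0" using False assms by (auto simp: K_def)
  have r: "PVI_rhs \<mu> x y p = 1/2 * (A + B + C) * p^2 - (D + E + C) * p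
     + 1/2 * (y * (y - 1) * (y - x) * (D^2 * E^2)) * ((2*\<mu> - 1)^2 + x * (x - 1) * C^2)"
    by (simp only: PVI_rhs_def A_def B_def C_def D_def E_def divide_inverse
        inverse_mult_distrib power_inverse mult_1_left)
  have g1: "2 * X * Y * y * z * w * (1/2 * (a + b + c) * p^2) =
      X * Y * ((a*y) * z * w + (b*z) * y * w + (c*w) * y * z) * p^2"
    for X Y y z w a b c p :: complex
    by (simp add: algebra_simps)
  have g2: "2 * x^2 * e^2 * y * z * w * ((a + b + c) * p) =
      2 * x * e * y * z * ((a*x) * e * w + (b*e) * x * w + (c*w) * x * e) * p"
    for x e y z w a b c p :: complex
    by (simp add: algebra_simps power2_eq_square)
  have g3: "2 * X * Y * y * z * w * (1/2 * (y * z * w * (a * b)) * (m + x * e * c)) =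
      y^2 * z^2 * (a*X) * (b*Y) * (m * w^2 + x * e * (c * w^2))"
    for X Y x e y z w a b c m :: complex
    by (simp add: power2_eq_square algebra_simps)
  have sq: "D^2 * x^2 = 1" "E^2 * (x - 1)^2 = 1" "C^2 * (y - x)^2 = 1"
    by (simp_all only: i power_one flip: power_mult_distrib)
  have "q = PVI_rhs \<mu> x y p \<longleftrightarrow> K * q = K * PVI_rhs \<mu> x y p"
    using \<open>K \<noteq> 0\<close> by simp
  also have "K * PVI_rhs \<mu> x y p = 
       x^2 * (x - 1)^2 * ((y - 1) * (y - x) + y * (y - x) + y * (y - 1)) * p^2
       - 2 * x * (x - 1) * y * (y - 1) * ((x - 1) * (y - x) + x * (y - x) + x * (x - 1)) * p
       + y^2 * (y - 1)^2 * ((2*\<mu> - 1)^2 * (y - x)^2 + x * (x - 1))"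
    unfolding r distrib_left[of K] right_diff_distrib[of K]
    unfolding K_def g1 g2 g3 i sq by (simp only: mult_1 mult_1_right)
  finally show ?thesis using False by (simp only: PVI_at_def PVI_cleared_def K_def if_False)
qed

lemma PVI_cleared_degenerate: "PVI_cleared \<mu> x x 1 0"
  by (simp add: PVI_cleared_def power2_eq_square algebra_simps)

text \<open>The logarithm on the plane cut along \<open>arg x = \<phi>\<close>, normalised by \<open>\<phi> < arg x < \<phi> + 2\<pi>\<close>.
  As \<open>\<phi>\<close> ranges over all reals, every branch on every such cut plane is obtained.\<close>

definition cut_log :: "real \<Rightarrow> complex \<Rightarrow> complex" where
  "cut_log \<phi> x = Ln (x * cis (- (\<phi> + pi))) + \<i> * of_real (\<phi> + pi)"

definition cut_powr :: "real \<Rightarrow> complex \<Rightarrow> real \<Rightarrow> complex" where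
  "cut_powr \<phi> x s = exp (of_real s * cut_log \<phi> x)"

lemma exp_cut_log: "x \<noteq> 0 \<Longrightarrow> exp (cut_log \<phi> x) = x"
proof -
  assume "x \<noteq> 0"
  then have "exp (cut_log \<phi> x) = x * (cis (- (\<phi> + pi)) * cis (\<phi> + pi))"
    by (simp add: cut_log_def exp_add cis_conv_exp[of "\<phi> + pi"] mult.assoc del: minus_add_distrib)
  then show ?thesis by (simp add: cis_mult)
qed

lemma Im_cut_log:
  assumes "x \<noteq> 0" "\<not> is_Arg x \<phi>"
  shows "\<phi> < Im (cut_log \<phi> x)" "Im (cut_log \<phi> x) < \<phi> + 2 * pi"
proof -
  let ?z = "x * cis (- (\<phi> + pi))"
  have z: "?z \<noteq> 0" using assms by (simp)
  have "Im (Ln ?z) \<noteq> pi"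
  proof
    assume "Im (Ln ?z) = pi"
    then have "Im (cut_log \<phi> x) = \<phi> + 2 * pi" by (simp add: cut_log_def)
    moreover have "Re (cut_log \<phi> x) = ln (cmod x)"
      using z assms by (simp add: cut_log_def norm_mult)
    ultimately have "cut_log \<phi> x = of_real (ln (cmod x)) + \<i> * of_real (\<phi> + 2 * pi)"
      by (simp add: complex_eq_iff)
    then have "x = exp (of_real (ln (cmod x)) + \<i> * of_real (\<phi> + 2 * pi))"
      using exp_cut_log[OF assms(1), of \<phi>] by simp
    also have "\<dots> = of_real (cmod x) * exp (\<i> * of_real \<phi>)"
      using assms(1) by (simp add: exp_add distrib_left exp_of_real mult.commute)
    finally show False using assms(2) by (simp add: is_Arg_def)
  qed
  then show "\<phi> < Im (cut_log \<phi> x)" "Im (cut_log \<phi> x) < \<phi> + 2 * pi"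
    using mpi_less_Im_Ln[OF z] Im_Ln_le_pi[OF z] by (auto simp: cut_log_def)
qed

definition cut_disc :: "real \<Rightarrow> real \<Rightarrow> complex set" where
  "cut_disc \<phi> r = {x. 0 < cmod x \<and> cmod x \<le> r \<and> \<not> is_Arg x \<phi>}"

text \<open>\<open>r < 1\<close> keeps the fixed singularity \<open>x = 1\<close> outside.  \<open>analytic_on\<close> makes \<open>y\<close>
  holomorphic in a neighbourhood of the points with \<open>|x| = r\<close>, so that \<open>deriv\<close> is meaningful there.\<close>

definition PVI_branch :: "complex \<Rightarrow> real \<Rightarrow> real \<Rightarrow> (complex \<Rightarrow> complex) \<Rightarrow> bool" where
  "PVI_branch \<mu> \<phi> r y \<longleftrightarrow>
     0 < r \<and> r < 1 \<and> y analytic_on cut_disc \<phi> r \<and>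
     (\<forall>x\<in>cut_disc \<phi> r. PVI_at \<mu> x (y x) (deriv y x) (deriv (deriv y) x))"

text \<open>Infinite real differentiability: \<open>D i j\<close> is the partial derivative of order \<open>i\<close> in
  \<open>Re x\<close> and \<open>j\<close> in \<open>Im x\<close>.\<close>

definition smooth_on :: "complex set \<Rightarrow> (complex \<Rightarrow> complex) \<Rightarrow> bool" where
  "smooth_on S f \<longleftrightarrow>
     (\<exists>D :: nat \<Rightarrow> nat \<Rightarrow> complex \<Rightarrow> complex. D 0 0 = f \<and>
        (\<forall>i j. \<forall>x\<in>S.
           (D i j has_derivative
              (\<lambda>h. of_real (Re h) * D (Suc i) j x + of_real (Im h) * D i (Suc j) x))
           (at x within S)))"

definition PVI_asymptotics ::
  "real \<Rightarrow> complex \<Rightarrow> real \<Rightarrow> real \<Rightarrow> (complex \<Rightarrow> complex) \<Rightarrow> bool" where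
  "PVI_asymptotics \<phi> a\<^sub>0 \<sigma>\<^sub>0 r y \<longleftrightarrow>
     (\<exists>\<epsilon> f c. \<epsilon> > 0 \<and> smooth_on (cut_disc \<phi> r) f \<and>
        (f \<longlongrightarrow> c) (at 0 within cut_disc \<phi> r) \<and>
        (\<forall>x\<in>cut_disc \<phi> r.
           y x = a\<^sub>0 * cut_powr \<phi> x (1 - \<sigma>\<^sub>0) * (1 + cut_powr \<phi> x \<epsilon> * f x)))"

end

(* Put x = e^s and y = x cosh^2 w. Since y = x u with u'^2 = sigma^2 u (u - 1) to leading order,
   the equation becomes w'' = F(s, w, w') with F = O(e^((1 - sigma) s)) as Re s -> -infinity, uniformly
   along w = w0 - sigma s / 2 + W with bounded W. The behaviour y ~ a x^(1 - sigma) fixes w0, so the branch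
   is the solution W that decays at -infinity, found by Picard iteration on a half-plane Re s < N.
   Conversely a branch determines W by an explicit square root and logarithm, Cauchy's estimate gives
   W' -> 0 in the middle of the strip, and the same contraction gives uniqueness there; the
   identity theorem does the rest. Only sigma = 0, a = 1, where cosh^2 is not locally invertible at
   w0 = 0, needs the energy 4 w'^2 as an additional unknown. *)
theory Submission
  imports Defs
begin

text \<open>At leading order the equation reads 2 u (u - 1) u'' = (2 u - 1) u'^2, which says that
  u'^2 / (u (u - 1)) is constant; cosh^2 parametrises these orbits by a linear function of s, so
  everything left in the equation for w carries a factor x. Its size is settled by counting
  exponents: x counts 1, while u and its root m count -sigma, so x u decays because sigma < 1, and 1
  - x and 1 - x u stay away from 0. The class \<open>tame\<close> organises this count. The code
  works with exp (2 w) instead of w: the choice of w0 becomes the choice of one number z, and the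
  root m enters only through m^2 = u^2 - u. Existence substitutes W into entire functions and so
  covers every a; only uniqueness has to invert. There a branch is given on a strip of width 2 pi,
  not on a half-plane, and its asymptotics say nothing about y'. Hence two branches are compared on
  the single middle line, around which unit discs fit into the strip.\<close>

section \<open>The equation in the logarithmic variable\<close>

text \<open>Here \<open>v\<close> and \<open>v'\<close> stand for the first and second derivative of
  \<open>u\<close> in s, so y' = u + v and y'' = (v + v') / x. The cleared equation then has the
  common factor \<open>x^3\<close>. What remains is 2 u (u - 1) v' = (2 u - 1) v^2, up to the factor
  (x - 1)^2 (x u - 1), plus terms that all carry \<open>x\<close>.\<close>

lemma PVI_cleared_log:
  fixes x u v v' \<mu> :: complex
  assumes "x \<noteq> 0"
  shows "PVI_cleared \<mu> x (x * u) (u + v) ((v + v') / x) \<longleftrightarrow>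
    2 * u * (u - 1) * ((x - 1)^2 * (x * u - 1)) * v' =
      (2 * u - 1) * ((x - 1)^2 * (x * u - 1)) * v^2
      + u * (u - 1) * x * ((x - 1)^2 * (2 * u * v + v^2) - 2 * (x - 1) * (x * u - 1) * v
          + u * (u - 1) * ((2 * \<mu> - 1)^2 * (x * u - 1)^2 - (x - 1)))"
    (is "_ \<longleftrightarrow> ?L = ?R")
proof -
  define q where "q = (v + v') / x"
  have v': "v' = x * q - v" using assms by (simp add: q_def)
  have "2 * x^2 * (x - 1)^2 * (x*u) * (x*u - 1) * (x*u - x) * q -
       (x^2 * (x - 1)^2 * ((x*u - 1) * (x*u - x) + x*u * (x*u - x) + x*u * (x*u - 1)) * (u+v)^2
       - 2 * x * (x - 1) * (x*u) * (x*u - 1) * ((x - 1) * (x*u - x) + x * (x*u - x) + x * (x - 1)) * (u+v)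
       + (x*u)^2 * (x*u - 1)^2 * ((2*\<mu> - 1)^2 * (x*u - x)^2 + x * (x - 1)))
     = x^3 * (?L - ?R)"
    unfolding v' by algebra
  then show ?thesis
    using assms by (simp add: PVI_cleared_def flip: q_def)
      (metis (no_types, lifting) assms eq_iff_diff_eq_0 mult_eq_0_iff power_eq_0_iff)
qed

text \<open>With \<open>x = e\<^sup>s\<close>, \<open>u = cosh\<^sup>2 w\<close>, \<open>m = cosh w sinh w\<close> and \<open>\<omega> = w'\<close>, where a prime is \<open>d/ds\<close>, one has
  \<open>u' = 2 m \<omega>\<close>, \<open>m' = (2 u - 1) \<omega>\<close>, and the equation for \<open>y = x u\<close> reads \<open>w'' = PVI_force \<mu> x u m \<omega>\<close>.\<close>

definition PVI_force :: "complex \<Rightarrow> complex \<Rightarrow> complex \<Rightarrow> complex \<Rightarrow> complex \<Rightarrow> complex" where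
  "PVI_force \<mu> x u m \<omega> = x * (m / 4 * (1 / (1 - x)) * (- (1 / (1 - x * u)))
     - (u * \<omega> + m * \<omega>^2) * (1 / (1 - x * u)) + \<omega> * (1 / (1 - x))
     - (2 * \<mu> - 1)^2 / 4 * m * (1 - x * u) * (1 / (1 - x))^2)"

text \<open>The arguments encode u' = 2 m \<omega> and u'' = 2 m \<omega>' + 2 (2 u - 1) \<omega>^2.
  With u (u - 1) = m^2 the \<omega>^2 terms of leading order cancel, and the difference of the two
  sides is 4 m^3 times the equation for \<omega>'. Hence the alternative m = 0: such points satisfy
  the cleared equation automatically, so existence may pass through them, whereas deducing \<omega>'
  requires m \<noteq> 0.\<close>

lemma PVI_cleared_force:
  fixes x u m \<omega> \<omega>' \<mu> :: complex
  assumes "x \<noteq> 0" "x \<noteq> 1" "x * u \<noteq> 1" and m: "m^2 = u^2 - u"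
  shows "PVI_cleared \<mu> x (x * u) (u + 2 * m * \<omega>)
        ((2 * m * \<omega> + (2 * m * \<omega>' + 2 * (2 * u - 1) * \<omega>^2)) / x) \<longleftrightarrow>
      m = 0 \<or> \<omega>' = PVI_force \<mu> x u m \<omega>" (is "?C \<longleftrightarrow> _")
proof -
  define X where "X = 1 / (1 - x)"
  define Y where "Y = 1 / (1 - x * u)"
  have X: "X * (x - 1) = -1" and Y: "Y * (x * u - 1) = -1"
    using assms by (auto simp: X_def Y_def divide_simps)
  define Q where "Q = (x - 1)^2 * (x * u - 1)"
  have Q: "Q \<noteq> 0" using assms by (simp add: Q_def)
  define P where "P = x * (- (x - 1) * m / 4 + (x - 1)^2 * (u * \<omega> + m * \<omega>^2)
     - (x - 1) * (x * u - 1) * \<omega> + (2 * \<mu> - 1)^2 / 4 * m * (x * u - 1)^2)"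
  have F: "Q * PVI_force \<mu> x u m \<omega> = P"
    unfolding PVI_force_def Q_def P_def X_def[symmetric] Y_def[symmetric] using X Y by algebra
  have "?C \<longleftrightarrow> 2 * u * (u - 1) * Q * (2 * m * \<omega>' + 2 * (2 * u - 1) * \<omega>^2) =
      (2 * u - 1) * Q * (2 * m * \<omega>)^2
      + u * (u - 1) * x * ((x - 1)^2 * (2 * u * (2 * m * \<omega>) + (2 * m * \<omega>)^2)
        - 2 * (x - 1) * (x * u - 1) * (2 * m * \<omega>)
          + u * (u - 1) * ((2 * \<mu> - 1)^2 * (x * u - 1)^2 - (x - 1)))"
    unfolding PVI_cleared_log[OF assms(1)] Q_def by simp
  also have "\<dots> \<longleftrightarrow> 4 * m^3 * (Q * \<omega>' - P) = 0"
  proof -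
    have m': "u * (u - 1) = m * m" using m by (simp add: power2_eq_square algebra_simps)
    have "2 * u * (u - 1) * Q * (2 * m * \<omega>' + 2 * (2 * u - 1) * \<omega>^2) -
      ((2 * u - 1) * Q * (2 * m * \<omega>)^2
      + u * (u - 1) * x * ((x - 1)^2 * (2 * u * (2 * m * \<omega>) + (2 * m * \<omega>)^2)
        - 2 * (x - 1) * (x * u - 1) * (2 * m * \<omega>)
          + u * (u - 1) * ((2 * \<mu> - 1)^2 * (x * u - 1)^2 - (x - 1)))) = 4 * m^3 * (Q * \<omega>' - P)"
      unfolding P_def using m' by algebra
    then show ?thesis by (metis eq_iff_diff_eq_0)
  qed
  finally have *: "?C \<longleftrightarrow> 4 * m^3 * (Q * \<omega>' - P) = 0" .
  show ?thesis unfolding * F[symmetric] using Q by simp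
qed

section \<open>Picard iteration on a left half-plane\<close>

text \<open>C / \<delta> * exp (\<delta> t) is a primitive of the bound on the derivative. The
  estimate is independent of \<open>a\<close>, so \<open>a\<close> can be sent to -infinity; each
  integration costs a factor 1 / \<delta>.\<close>

lemma decay_diff:
  fixes g g' :: "real \<Rightarrow> complex"
  assumes "\<delta> > 0"
    and g': "\<And>t. t < N \<Longrightarrow> (g has_vector_derivative g' t) (at t)"
    and b: "\<And>t. t < N \<Longrightarrow> norm (g' t) \<le> C * exp (\<delta> * t)"
    and t: "t < N" and "a < t"
  shows "norm (g t - g a) \<le> C / \<delta> * exp (\<delta> * t)"
proof -
  have C: "C \<ge> 0" using order_trans[OF norm_ge_zero b[OF t]] by (simp add: zero_le_mult_iff)
  have "norm (g t - g a) \<le> C / \<delta> * exp (\<delta> * t) - C / \<delta> * exp (\<delta> * a)"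
  proof (rule differentiable_bound_general[OF \<open>a < t\<close>])
    show "continuous_on {a..t} g"
      using t by (intro continuous_at_imp_continuous_on ballI
          has_vector_derivative_continuous[OF g']) auto
    show "continuous_on {a..t} (\<lambda>t. C / \<delta> * exp (\<delta> * t))" by (intro continuous_intros)
    show "(g has_vector_derivative g' x) (at x)" if "a < x" "x < t" for x using g' that t by auto
    show "((\<lambda>t. C / \<delta> * exp (\<delta> * t)) has_vector_derivative C * exp (\<delta> * x)) (at x)" for x
      using \<open>\<delta> > 0\<close> by (auto intro!: derivative_eq_intros
        simp flip: has_real_derivative_iff_has_vector_derivative)
    show "norm (g' x) \<le> C * exp (\<delta> * x)" if "a < x" "x < t" for x using b that t by auto
  qed
  also have "\<dots> \<le> C / \<delta> * exp (\<delta> * t)" using C assms(1) by auto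
  finally show ?thesis .
qed

lemma decay_bound:
  fixes g g' :: "real \<Rightarrow> complex"
  assumes "\<delta> > 0"
    and "\<And>t. t < N \<Longrightarrow> (g has_vector_derivative g' t) (at t)"
    and "\<And>t. t < N \<Longrightarrow> norm (g' t) \<le> C * exp (\<delta> * t)"
    and lim: "(g \<longlongrightarrow> 0) at_bot" and t: "t < N"
  shows "norm (g t) \<le> C / \<delta> * exp (\<delta> * t)"
proof -
  have bd: "norm (g t - g a) \<le> C / \<delta> * exp (\<delta> * t)" if "a < t" for a
    using decay_diff[OF assms(1-3) t that] by blast
  have "((\<lambda>a. norm (g t - g a)) \<longlongrightarrow> norm (g t - 0)) at_bot"
    by (intro tendsto_intros lim)
  then have "norm (g t - 0) \<le> C / \<delta> * exp (\<delta> * t)"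
    by (rule tendsto_upperbound[OF _ eventually_mono[OF eventually_le_at_bot[of "t - 1"]]])
      (use bd in force)+
  then show ?thesis by simp
qed

section \<open>Primitives on a left half-plane that vanish at -infinity\<close>

definition lhp :: "real \<Rightarrow> complex set" where "lhp N = {s. Re s < N}"

lemma in_lhp [simp]: "s \<in> lhp N \<longleftrightarrow> Re s < N" by (simp add: lhp_def)
lemma open_lhp [intro]: "open (lhp N)" unfolding lhp_def by (rule open_halfspace_Re_lt)
lemma convex_lhp [intro]: "convex (lhp N)" unfolding lhp_def by (rule convex_halfspace_Re_lt)

text \<open>Normalisation at -infinity that makes a primitive unique. Only pointwise decay on each
  horizontal line is asked; the uniform rate is regained from the derivative by
  \<open>left_null_bound\<close>.\<close>

definition left_null :: "(complex \<Rightarrow> complex) \<Rightarrow> bool" where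
  "left_null P \<longleftrightarrow> (\<forall>b. ((\<lambda>t. P (Complex t b)) \<longlongrightarrow> 0) at_bot)"

lemma line_derivative:
  assumes "(P has_field_derivative d) (at (Complex t b))"
  shows "((\<lambda>t. P (Complex t b)) has_vector_derivative d) (at t)"
proof -
  have *: "((\<lambda>t. of_real t + \<i> * of_real b) has_vector_derivative 1) (at t)"
    by (auto intro!: derivative_eq_intros)
  have "(P \<circ> (\<lambda>t. of_real t + \<i> * of_real b) has_vector_derivative 1 * d) (at t)"
    by (rule field_vector_diff_chain_at[OF *]) (use assms in \<open>simp add: Complex_eq\<close>)
  then show ?thesis by (simp add: Complex_eq o_def)
qed

lemma decay_bound_line:
  assumes "\<delta> > 0"
    and "\<And>t. t < N \<Longrightarrow> (P has_field_derivative F t) (at (Complex t b))"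
    and "\<And>t. t < N \<Longrightarrow> norm (F t) \<le> C * exp (\<delta> * t)"
    and "((\<lambda>t. P (Complex t b)) \<longlongrightarrow> 0) at_bot" "t < N"
  shows "norm (P (Complex t b)) \<le> C / \<delta> * exp (\<delta> * t)"
  by (rule decay_bound[OF assms(1) line_derivative]) (use assms in auto)

lemma exp_small:
  assumes "\<delta> > 0" "\<epsilon> > 0"
  obtains N :: real where "N \<le> M" "c * exp (\<delta> * N) \<le> \<epsilon>"
proof -
  have "((\<lambda>N. c * exp (\<delta> * N)) \<longlongrightarrow> 0) at_bot" using assms by real_asymp
  then have "\<forall>\<^sub>F N in at_bot. c * exp (\<delta> * N) < \<epsilon>" using assms(2) order_tendstoD(2) by blast
  then have "\<forall>\<^sub>F N in at_bot. c * exp (\<delta> * N) < \<epsilon> \<and> N \<le> M"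
    using eventually_le_at_bot[of M] by eventually_elim auto
  then obtain N where "c * exp (\<delta> * N) < \<epsilon> \<and> N \<le> M"
    using eventually_happens'[OF trivial_limit_at_bot_linorder] by blast
  then show ?thesis using that[of N] by simp
qed

text \<open>The half-plane is convex, so a primitive exists, and the bound on \<open>F\<close> makes
  it Cauchy along the real axis as Re s tends to -infinity. One constant \<open>L\<close> normalises
  all horizontal lines, because a vertical increment is at most C exp (\<delta> t) |b| and vanishes
  in the limit.\<close>

lemma left_primitive:
  assumes "\<delta> > 0" and F: "F holomorphic_on lhp N"
    and b: "\<And>s. Re s < N \<Longrightarrow> norm (F s) \<le> C * exp (\<delta> * Re s)"
  shows "\<exists>P. (\<forall>s\<in>lhp N. (P has_field_derivative F s) (at s)) \<and> left_null P"
proof -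
  obtain P0 where P0: "\<And>s. s \<in> lhp N \<Longrightarrow> (P0 has_field_derivative F s) (at s)"
    using holomorphic_convex_primitive'[OF convex_lhp open_lhp F] at_within_open[OF _ open_lhp]
    by metis
  have h: "norm (P0 (Complex t b) - P0 (Complex a b)) \<le> C / \<delta> * exp (\<delta> * t)"
    if "t < N" "a < t" for a t b
    by (rule decay_diff[OF \<open>\<delta> > 0\<close> line_derivative[OF P0] _ that])
      (use b[of "Complex _ b"] in simp_all)
  have v: "norm (P0 (Complex t b) - P0 (Complex t 0)) \<le> C * exp (\<delta> * t) * \<bar>b\<bar>"
    if "t < N" for t b
  proof -
    have "norm (P0 (Complex t b) - P0 (Complex t 0))
      \<le> C * exp (\<delta> * t) * norm (Complex t b - Complex t 0)"
    proof (rule field_differentiable_bound)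
      show "convex {s. Re s = t}" using convex_hyperplane[of "1::complex" t] by simp
      show "(P0 has_field_derivative F s) (at s within {s. Re s = t})" if "s \<in> {s. Re s = t}" for s
        using that \<open>t < N\<close> by (simp add: has_field_derivative_at_within[OF P0])
    qed (use b that in auto)
    also have "norm (Complex t b - Complex t 0) = \<bar>b\<bar>" by (simp add: cmod_def)
    finally show ?thesis .
  qed
  define X where "X n = P0 (Complex (N - 1 - real n) 0)" for n
  have "Cauchy X"
  proof (rule CauchyI')
    fix e :: real assume "e > 0"
    have "((\<lambda>n. C / \<delta> * exp (\<delta> * (N - 1 - real n))) \<longlongrightarrow> 0) at_top" using \<open>\<delta> > 0\<close> by real_asymp
    then have "\<forall>\<^sub>F n in at_top. C / \<delta> * exp (\<delta> * (N - 1 - real n)) < e"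
      using \<open>e > 0\<close> order_tendstoD(2) by blast
    then obtain m0 where m0: "\<And>m. m \<ge> m0 \<Longrightarrow> C / \<delta> * exp (\<delta> * (N - 1 - real m)) < e"
      by (auto simp: eventually_at_top_linorder)
    have "dist (X m) (X n) < e" if "m \<ge> m0" "n > m" for m n
      using h[of "N - 1 - real m" "N - 1 - real n" 0] m0[OF that(1)] that
      by (simp add: X_def dist_norm)
    then show "\<exists>M. \<forall>m\<ge>M. \<forall>n>m. dist (X m) (X n) < e" by blast
  qed
  then obtain L where L: "X \<longlonglongrightarrow> L" by (meson Cauchy_convergent_iff convergent_def)
  have bd: "norm (P0 (Complex t b) - L) \<le> C / \<delta> * exp (\<delta> * t)" if "t < N" for t b
  proof -
    have "(\<lambda>n. norm (P0 (Complex t b) - X n)) \<longlonglongrightarrow> norm (P0 (Complex t b) - L)"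
      by (intro tendsto_intros L)
    moreover have "(\<lambda>n. C / \<delta> * exp (\<delta> * t) + C * exp (\<delta> * (N - 1 - real n)) * \<bar>b\<bar>)
      \<longlonglongrightarrow> C / \<delta> * exp (\<delta> * t)" using \<open>\<delta> > 0\<close> by real_asymp
    moreover have "\<forall>\<^sub>F n in sequentially. norm (P0 (Complex t b) - X n) \<le>
      C / \<delta> * exp (\<delta> * t) + C * exp (\<delta> * (N - 1 - real n)) * \<bar>b\<bar>"
    proof -
      have "\<forall>\<^sub>F n in sequentially. N - 1 - real n < t" by real_asymp
      then show ?thesis
      proof eventually_elim
        case (elim n)
        have "P0 (Complex t b) - X n = (P0 (Complex t b) - P0 (Complex (N - 1 - real n) b))
          + (P0 (Complex (N - 1 - real n) b) - X n)" by simp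
        then show ?case
          using h[OF that elim, of b] v[of "N - 1 - real n" b] norm_triangle_ineq
          unfolding X_def by (smt (verit) of_nat_0_le_iff)
      qed
    qed
    ultimately show ?thesis by (intro tendsto_le[OF sequentially_bot])
  qed
  have "left_null (\<lambda>s. P0 s - L)"
    unfolding left_null_def
  proof
    fix b
    show "((\<lambda>t. P0 (Complex t b) - L) \<longlongrightarrow> 0) at_bot"
    proof (rule Lim_null_comparison)
      show "((\<lambda>t. C / \<delta> * exp (\<delta> * t)) \<longlongrightarrow> 0) at_bot" using \<open>\<delta> > 0\<close> by real_asymp
      show "\<forall>\<^sub>F t in at_bot. norm (P0 (Complex t b) - L) \<le> C / \<delta> * exp (\<delta> * t)"
        using eventually_gt_at_bot[of N] eventually_le_at_bot[of "N - 1"]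
        by eventually_elim (use bd in auto)
    qed
  qed
  moreover have "\<forall>s\<in>lhp N. ((\<lambda>s. P0 s - L) has_field_derivative F s) (at s)"
    using P0 by (auto intro!: derivative_eq_intros)
  ultimately show ?thesis by (intro exI[of _ "\<lambda>s. P0 s - L"]) simp
qed

lemma left_null_diff: "left_null P \<Longrightarrow> left_null Q \<Longrightarrow> left_null (\<lambda>s. P s - Q s)"
  unfolding left_null_def using tendsto_diff by fastforce

lemma left_null_bound:
  assumes "\<delta> > 0"
    and "\<And>s. s \<in> lhp N \<Longrightarrow> (P has_field_derivative F s) (at s)" "left_null P"
    and "\<And>s. s \<in> lhp N \<Longrightarrow> norm (F s) \<le> C * exp (\<delta> * Re s)" "s \<in> lhp N"
  shows "norm (P s) \<le> C / \<delta> * exp (\<delta> * Re s)"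
  using decay_bound_line[where P = P and b = "Im s" and t = "Re s" and N = N
      and F = "\<lambda>t. F (Complex t (Im s))" and \<delta> = \<delta> and C = C] assms
  by (simp add: left_null_def) (metis complex.collapse complex.sel(1))

text \<open>The exponent \<open>d\<close> may be negative, so that factors growing to the left can
  be multiplied by decaying ones. Size and Lipschitz bound are uniform on the unit polydisc in (W,
  V), as Picard iteration needs. Holomorphy is required after substituting holomorphic functions, on
  every smaller half-plane; this avoids functions of several complex variables and is stable under
  algebraic operations.\<close>

definition tame_on ::
  "real \<Rightarrow> real \<Rightarrow> real \<Rightarrow> (complex \<Rightarrow> complex \<Rightarrow> complex \<Rightarrow> complex) \<Rightarrow> bool" where
  "tame_on N K d g \<longleftrightarrow>
     (\<forall>s W V W' V'. Re s < N \<longrightarrow> norm W \<le> 1 \<longrightarrow> norm V \<le> 1 \<longrightarrow> norm W' \<le> 1 \<longrightarrow> norm V' \<le> 1 \<longrightarrow>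
        norm (g s W V) \<le> K * exp (d * Re s) \<and>
        norm (g s W V - g s W' V') \<le> K * exp (d * Re s) * (norm (W - W') + norm (V - V'))) \<and>
     (\<forall>M W V. M \<le> N \<longrightarrow> W holomorphic_on lhp M \<longrightarrow> V holomorphic_on lhp M \<longrightarrow>
        (\<forall>s\<in>lhp M. norm (W s) \<le> 1 \<and> norm (V s) \<le> 1) \<longrightarrow>
        (\<lambda>s. g s (W s) (V s)) holomorphic_on lhp M)"

definition tame :: "real \<Rightarrow> (complex \<Rightarrow> complex \<Rightarrow> complex \<Rightarrow> complex) \<Rightarrow> bool" where
  "tame d g \<longleftrightarrow> (\<exists>N K. tame_on N K d g)"

lemma tame_onD:
  assumes "tame_on N K d g"
  shows "\<And>s W V. Re s < N \<Longrightarrow> norm W \<le> 1 \<Longrightarrow> norm V \<le> 1 \<Longrightarrow> norm (g s W V) \<le> K * exp (d * Re s)"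
    and "\<And>s W V W' V'. Re s < N \<Longrightarrow> norm W \<le> 1 \<Longrightarrow> norm V \<le> 1 \<Longrightarrow> norm W' \<le> 1 \<Longrightarrow>
      norm V' \<le> 1 \<Longrightarrow> norm (g s W V - g s W' V') \<le> K * exp (d * Re s) * (norm (W - W') + norm (V - V'))"
    and "\<And>M W V. M \<le> N \<Longrightarrow> W holomorphic_on lhp M \<Longrightarrow> V holomorphic_on lhp M \<Longrightarrow>
      (\<And>s. s \<in> lhp M \<Longrightarrow> norm (W s) \<le> 1 \<and> norm (V s) \<le> 1) \<Longrightarrow>
      (\<lambda>s. g s (W s) (V s)) holomorphic_on lhp M"
  using assms unfolding tame_on_def by simp_all

lemma tame_on_nonneg: "tame_on N K d g \<Longrightarrow> K \<ge> 0"
  using order_trans[OF norm_ge_zero tame_onD(1)[of N K d g "of_real (N - 1)" 0 0]]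
  by (simp add: zero_le_mult_iff)

text \<open>The solution is a fixed point of the map that sends (W, V) to the double and the single
  primitive of \<open>G s (W s) (V s)\<close>, normalised at -infinity. The two integrations
  contribute K / \<delta> and K / \<delta>^2, and moving the half-plane to the left makes their sum
  times exp (\<delta> N) at most 1/2.\<close>

lemma tame_picard:
  assumes "tame \<delta> G" "\<delta> > 0"
  obtains N K W V where "N \<le> M"
    and "\<And>s. s \<in> lhp N \<Longrightarrow> (W has_field_derivative V s) (at s)"
    and "\<And>s. s \<in> lhp N \<Longrightarrow> (V has_field_derivative G s (W s) (V s)) (at s)"
    and "\<And>s. s \<in> lhp N \<Longrightarrow> norm (W s) \<le> K * exp (\<delta> * Re s)"
    and "\<And>s. s \<in> lhp N \<Longrightarrow> norm (W s) \<le> 1" and "\<And>s. s \<in> lhp N \<Longrightarrow> norm (V s) \<le> 1"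
proof -
  obtain N0 K where T: "tame_on N0 K \<delta> G" using assms(1) unfolding tame_def by blast
  note bd = tame_onD(1)[OF T] and lip = tame_onD(2)[OF T] and hol = tame_onD(3)[OF T]
  have K0: "K \<ge> 0" using T by (rule tame_on_nonneg)
  obtain N where N: "N \<le> min M N0" "(K / \<delta> + K / \<delta> / \<delta>) * exp (\<delta> * N) \<le> 1/2"
    using exp_small[OF \<open>\<delta> > 0\<close>, of "1/2"] by (metis half_gt_zero_iff zero_less_one)
  have small: "(K / \<delta> + K / \<delta> / \<delta>) * exp (\<delta> * Re s) \<le> 1/2" if "s \<in> lhp N" for s
    using that \<open>\<delta> > 0\<close> K0
    by (intro order_trans[OF mult_left_mono N(2)]) auto
  \<comment> \<open>\<open>prim\<close> is an arbitrary choice, with no linearity in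
    \<open>F\<close> at hand. Differences of its values are therefore estimated through the
    derivative, since \<open>left_null\<close> passes to differences.\<close>
  define prim where
    "prim F = (SOME P. (\<forall>s\<in>lhp N. (P has_field_derivative F s) (at s)) \<and> left_null P)"
    for F :: "complex \<Rightarrow> complex"
  have prim: "(\<forall>s\<in>lhp N. (prim F has_field_derivative F s) (at s)) \<and> left_null (prim F)"
    if "F holomorphic_on lhp N" "\<And>s. Re s < N \<Longrightarrow> norm (F s) \<le> C * exp (\<delta> * Re s)" for F C
    unfolding prim_def by (rule someI_ex[OF left_primitive[OF \<open>\<delta> > 0\<close> that]])
  define admissible where "admissible w \<longleftrightarrow> fst w holomorphic_on lhp N \<and> snd w holomorphic_on lhp N \<and>
     (\<forall>s\<in>lhp N. norm (fst w s) \<le> 1 \<and> norm (snd w s) \<le> 1)" for w :: "(complex \<Rightarrow> complex) \<times> (complex \<Rightarrow> complex)"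
  define \<Phi> where "\<Phi> w = (let V = prim (\<lambda>s. G s (fst w s) (snd w s)) in (prim V, V))" for w
  have \<Phi>: "(\<forall>s\<in>lhp N. (fst (\<Phi> w) has_field_derivative snd (\<Phi> w) s) (at s)
        \<and> (snd (\<Phi> w) has_field_derivative G s (fst w s) (snd w s)) (at s)
        \<and> norm (snd (\<Phi> w) s) \<le> K / \<delta> * exp (\<delta> * Re s)
        \<and> norm (fst (\<Phi> w) s) \<le> K / \<delta> / \<delta> * exp (\<delta> * Re s))
        \<and> left_null (fst (\<Phi> w)) \<and> left_null (snd (\<Phi> w)) \<and> admissible (\<Phi> w)"
    if w: "admissible w" for w
  proof -
    define F where "F = (\<lambda>s. G s (fst w s) (snd w s))"
    have F: "F holomorphic_on lhp N" using w hol[of N "fst w" "snd w"] N(1) by (auto simp: admissible_def F_def)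
    have Fb: "norm (F s) \<le> K * exp (\<delta> * Re s)" if "Re s < N" for s
      unfolding F_def using that w N(1) by (intro bd) (auto simp: admissible_def)
    note P1 = prim[OF F Fb]
    have P1b: "norm (prim F s) \<le> K / \<delta> * exp (\<delta> * Re s)" if "Re s < N" for s
      by (rule left_null_bound[OF \<open>\<delta> > 0\<close>, where N = N and F = F]) (use P1 Fb that in auto)
    have P1h: "prim F holomorphic_on lhp N"
      unfolding holomorphic_on_open[OF open_lhp] using P1 by blast
    note P2 = prim[OF P1h P1b]
    have P2b: "norm (prim (prim F) s) \<le> K / \<delta> / \<delta> * exp (\<delta> * Re s)" if "Re s < N" for s
      by (rule left_null_bound[OF \<open>\<delta> > 0\<close>, where N = N and F = "prim F"]) (use P2 P1b that in auto)
    have P2h: "prim (prim F) holomorphic_on lhp N"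
      unfolding holomorphic_on_open[OF open_lhp] using P2 by blast
    have "K / \<delta> * exp (\<delta> * Re s) \<le> 1 \<and> K / \<delta> / \<delta> * exp (\<delta> * Re s) \<le> 1" if "Re s < N" for s
    proof -
      have "0 \<le> K / \<delta> * exp (\<delta> * Re s)" "0 \<le> K / \<delta> / \<delta> * exp (\<delta> * Re s)"
        using K0 \<open>\<delta> > 0\<close> by auto
      moreover have "K / \<delta> * exp (\<delta> * Re s) + K / \<delta> / \<delta> * exp (\<delta> * Re s) \<le> 1 / 2"
        using small[of s] that by (simp only: in_lhp distrib_right)
      ultimately show ?thesis by linarith
    qed
    then have "admissible (prim (prim F), prim F)"
      unfolding admissible_def using P1h P2h P1b P2b by fastforce
    moreover have "G s (fst w s) (snd w s) = F s" for s by (simp add: F_def)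
    ultimately show ?thesis
      unfolding \<Phi>_def Let_def F_def[symmetric] fst_conv snd_conv using P1 P2 P1b P2b by simp
  qed
  have contr: "norm (fst (\<Phi> w) s - fst (\<Phi> w') s) + norm (snd (\<Phi> w) s - snd (\<Phi> w') s) \<le> D / 2"
    if w: "admissible w" "admissible w'" and s: "s \<in> lhp N"
      and D: "\<And>s. s \<in> lhp N \<Longrightarrow> norm (fst w s - fst w' s) + norm (snd w s - snd w' s) \<le> D" for w w' s D
  proof -
    have D0: "D \<ge> 0" using D[OF s] by (smt (verit) norm_ge_zero)
    have 1: "norm (snd (\<Phi> w) s - snd (\<Phi> w') s) \<le> K * D / \<delta> * exp (\<delta> * Re s)" if "s \<in> lhp N" for s
    proof (rule left_null_bound[OF \<open>\<delta> > 0\<close>])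
      show "((\<lambda>s. snd (\<Phi> w) s - snd (\<Phi> w') s) has_field_derivative
        (G s (fst w s) (snd w s) - G s (fst w' s) (snd w' s))) (at s)" if "s \<in> lhp N" for s
        using \<Phi>[OF w(1)] \<Phi>[OF w(2)] that by (auto intro!: derivative_intros)
      show "left_null (\<lambda>s. snd (\<Phi> w) s - snd (\<Phi> w') s)"
        using \<Phi>[OF w(1)] \<Phi>[OF w(2)] left_null_diff by blast
      show "norm (G s (fst w s) (snd w s) - G s (fst w' s) (snd w' s)) \<le> K * D * exp (\<delta> * Re s)"
        if "s \<in> lhp N" for s
      proof -
        have "norm (G s (fst w s) (snd w s) - G s (fst w' s) (snd w' s))
          \<le> K * exp (\<delta> * Re s) * (norm (fst w s - fst w' s) + norm (snd w s - snd w' s))"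
          using w that N(1) by (intro lip) (auto simp: admissible_def)
        also have "\<dots> \<le> K * exp (\<delta> * Re s) * D"
          using D[OF that] K0 by (intro mult_left_mono) auto
        finally show ?thesis by (simp add: mult_ac)
      qed
    qed (use that in auto)
    have 2: "norm (fst (\<Phi> w) s - fst (\<Phi> w') s) \<le> K * D / \<delta> / \<delta> * exp (\<delta> * Re s)"
    proof (rule left_null_bound[OF \<open>\<delta> > 0\<close>])
      show "((\<lambda>s. fst (\<Phi> w) s - fst (\<Phi> w') s) has_field_derivative
        (snd (\<Phi> w) s - snd (\<Phi> w') s)) (at s)" if "s \<in> lhp N" for s
        using \<Phi>[OF w(1)] \<Phi>[OF w(2)] that by (auto intro!: derivative_intros)
      show "left_null (\<lambda>s. fst (\<Phi> w) s - fst (\<Phi> w') s)"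
        using \<Phi>[OF w(1)] \<Phi>[OF w(2)] left_null_diff by blast
    qed (use 1 s in auto)
    have "norm (fst (\<Phi> w) s - fst (\<Phi> w') s) + norm (snd (\<Phi> w) s - snd (\<Phi> w') s)
      \<le> D * ((K / \<delta> + K / \<delta> / \<delta>) * exp (\<delta> * Re s))"
      using 1[OF s] 2 by (simp add: algebra_simps)
    also have "\<dots> \<le> D * (1/2)" using D0 small[OF s] by (intro mult_left_mono)
    finally show ?thesis by simp
  qed
  define f where "f n = (\<Phi> ^^ n) (\<lambda>s. 0, \<lambda>s. 0)" for n
  have f0: "f 0 = (\<lambda>s. 0, \<lambda>s. 0)" and fS: "f (Suc n) = \<Phi> (f n)" for n by (auto simp: f_def)
  have adm: "admissible (f n)" for n
    by (induction n) (use \<Phi> in \<open>auto simp: f0 fS admissible_def\<close>)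
  \<comment> \<open>The 2 bounds the first difference: \<open>f 0\<close> is zero and both
    components of \<open>f 1\<close> have modulus at most 1. Contraction halves it each
    time.\<close>
  have step: "norm (fst (f (Suc n)) s - fst (f n) s) + norm (snd (f (Suc n)) s - snd (f n) s) \<le> 2 * (1/2)^n"
    if "s \<in> lhp N" for n s
    using that
  proof (induction n arbitrary: s)
    case 0
    then show ?case using adm[of "Suc 0"] by (force simp: f0 admissible_def)
  next
    case (Suc n)
    show ?case using contr[OF adm adm Suc.prems Suc.IH] by (simp add: fS)
  qed
  \<comment> \<open>Each component is a telescoping series without constant term, as
    \<open>f 0\<close> is zero, and the M-test makes the convergence uniform.\<close>
  have ulim: "\<exists>l. uniform_limit (lhp N) (\<lambda>n. p (f n)) l sequentially"
    if p: "p = fst \<or> p = snd" for p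
  proof -
    have "uniform_limit (lhp N) (\<lambda>n s. \<Sum>i<n. p (f (Suc i)) s - p (f i) s)
      (\<lambda>s. suminf (\<lambda>i. p (f (Suc i)) s - p (f i) s)) sequentially"
    proof (rule Weierstrass_m_test)
      show "norm (p (f (Suc n)) s - p (f n) s) \<le> 2 * (1/2)^n" if "s \<in> lhp N" for n s
        using step[OF that, of n] p
          norm_ge_zero[of "fst (f (Suc n)) s - fst (f n) s"]
          norm_ge_zero[of "snd (f (Suc n)) s - snd (f n) s"] by (elim disjE) (simp_all del: norm_ge_zero)
      show "summable (\<lambda>n. 2 * (1/2)^n :: real)" by (intro summable_mult summable_geometric) simp
    qed
    moreover have "(\<Sum>i<n. p (f (Suc i)) s - p (f i) s) = p (f n) s" for n s
      using sum_lessThan_telescope[of "\<lambda>i. p (f i) s" n] p by (auto simp: f0)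
    ultimately show ?thesis by auto
  qed
  obtain W where W: "uniform_limit (lhp N) (\<lambda>n. fst (f n)) W sequentially" using ulim by blast
  obtain V where V: "uniform_limit (lhp N) (\<lambda>n. snd (f n)) V sequentially" using ulim by blast
  have hol_lim: "l holomorphic_on lhp N"
    if "uniform_limit (lhp N) g l sequentially" "\<And>n. g n holomorphic_on lhp N" for g l
  proof (rule holomorphic_uniform_sequence[OF open_lhp that(2)])
    fix s assume "s \<in> lhp N"
    then obtain d where "d > 0" "cball s d \<subseteq> lhp N" using open_contains_cball open_lhp by blast
    then show "\<exists>d>0. cball s d \<subseteq> lhp N \<and> uniform_limit (cball s d) g l sequentially"
      using uniform_limit_on_subset[OF that(1)] by blast
  qed
  have lim: "(\<lambda>n. fst (f n) s) \<longlonglongrightarrow> W s" "(\<lambda>n. snd (f n) s) \<longlonglongrightarrow> V s" if "s \<in> lhp N" for s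
    using tendsto_uniform_limitI[OF W that] tendsto_uniform_limitI[OF V that] by auto
  have admW: "admissible (W, V)"
    unfolding admissible_def fst_conv snd_conv
  proof (intro conjI ballI)
    show "W holomorphic_on lhp N" using adm by (intro hol_lim[OF W]) (simp add: admissible_def)
    show "V holomorphic_on lhp N" using adm by (intro hol_lim[OF V]) (simp add: admissible_def)
    show "norm (W s) \<le> 1" if "s \<in> lhp N" for s
      using adm that by (intro Lim_norm_ubound[OF _ lim(1)[OF that]]) (auto simp: admissible_def)
    show "norm (V s) \<le> 1" if "s \<in> lhp N" for s
      using adm that by (intro Lim_norm_ubound[OF _ lim(2)[OF that]]) (auto simp: admissible_def)
  qed
  \<comment> \<open>Uniform convergence puts all late iterates within e/2 of the limit; by
    contraction \<Phi> (W, V) is within e/4 of the iterate after the m-th, which is itself within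
    e/2 of (W, V).\<close>
  have fixpt: "fst (\<Phi> (W, V)) s = W s \<and> snd (\<Phi> (W, V)) s = V s" if s: "s \<in> lhp N" for s
  proof -
    have near: "norm (fst (\<Phi> (W, V)) s - W s) + norm (snd (\<Phi> (W, V)) s - V s) \<le> e" if "e > 0" for e
    proof -
      have "\<forall>\<^sub>F n in sequentially. \<forall>s\<in>lhp N. dist (fst (f n) s) (W s) < e / 4"
        "\<forall>\<^sub>F n in sequentially. \<forall>s\<in>lhp N. dist (snd (f n) s) (V s) < e / 4"
        using uniform_limitD[OF W, of "e/4"] uniform_limitD[OF V, of "e/4"] \<open>e > 0\<close> by auto
      then have "\<forall>\<^sub>F n in sequentially. \<forall>s\<in>lhp N.
        norm (W s - fst (f n) s) + norm (V s - snd (f n) s) \<le> e / 2"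
        by eventually_elim (force simp: dist_norm norm_minus_commute)
      then obtain m where m: "\<And>n s. n \<ge> m \<Longrightarrow> s \<in> lhp N \<Longrightarrow>
         norm (W s - fst (f n) s) + norm (V s - snd (f n) s) \<le> e / 2"
        unfolding eventually_at_top_linorder by blast
      have "norm (fst (\<Phi> (W, V)) s - fst (f (Suc m)) s) + norm (snd (\<Phi> (W, V)) s - snd (f (Suc m)) s) \<le> e / 2 / 2"
        unfolding fS by (rule contr[OF admW adm s]) (use m in auto)
      moreover have "norm (W s - fst (f (Suc m)) s) + norm (V s - snd (f (Suc m)) s) \<le> e / 2"
        using m s by simp
      ultimately show ?thesis
        using norm_triangle_ineq4[of "fst (\<Phi> (W, V)) s - fst (f (Suc m)) s" "W s - fst (f (Suc m)) s"]
         norm_triangle_ineq4[of "snd (\<Phi> (W, V)) s - snd (f (Suc m)) s" "V s - snd (f (Suc m)) s"] \<open>e > 0\<close>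
        by simp
    qed
    have "norm (fst (\<Phi> (W, V)) s - W s) + norm (snd (\<Phi> (W, V)) s - V s) \<le> 0"
      by (rule field_le_epsilon) (use near in simp)
    then show ?thesis by (smt (verit) norm_ge_zero norm_eq_zero right_minus_eq)
  qed
  \<comment> \<open>The fixed point equation holds only on \<open>lhp N\<close>; as this set is
    open, derivatives carry over.\<close>
  have P: "(W has_field_derivative V s) (at s)" "(V has_field_derivative G s (W s) (V s)) (at s)"
    "norm (W s) \<le> K / \<delta> / \<delta> * exp (\<delta> * Re s)" if s: "s \<in> lhp N" for s
  proof -
    show "(W has_field_derivative V s) (at s)"
      by (rule has_field_derivative_transform_within_open[where S = "lhp N" and f = "fst (\<Phi> (W, V))"])
        (use \<Phi>[OF admW] fixpt s in auto)
    show "(V has_field_derivative G s (W s) (V s)) (at s)"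
      by (rule has_field_derivative_transform_within_open[where S = "lhp N" and f = "snd (\<Phi> (W, V))"])
        (use \<Phi>[OF admW] fixpt s in auto)
    show "norm (W s) \<le> K / \<delta> / \<delta> * exp (\<delta> * Re s)"
      using \<Phi>[OF admW] fixpt[OF s] s by force
  qed
  show ?thesis
    by (rule that[of N W V "K / \<delta> / \<delta>"]) (use P N(1) admW in \<open>auto simp: admissible_def\<close>)
qed

section \<open>Closure of the tame functions under algebraic operations\<close>

lemma tame_on_mono:
  assumes "tame_on N K d g" "N' \<le> N" "K \<le> K'"
  shows "tame_on N' K' d g"
  unfolding tame_on_def
proof (intro conjI allI impI)
  fix s W V W' V' :: complex assume *: "Re s < N'" "norm W \<le> 1" "norm V \<le> 1" "norm W' \<le> 1" "norm V' \<le> (1::real)"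
  have "norm (g s W V) \<le> K * exp (d * Re s)" using tame_onD(1)[OF assms(1)] * assms(2) by simp
  also have "\<dots> \<le> K' * exp (d * Re s)" using assms(3) by (intro mult_right_mono) auto
  finally show "norm (g s W V) \<le> K' * exp (d * Re s)" .
  have "norm (g s W V - g s W' V') \<le> K * exp (d * Re s) * (norm (W - W') + norm (V - V'))"
    using tame_onD(2)[OF assms(1)] * assms(2) by simp
  also have "\<dots> \<le> K' * exp (d * Re s) * (norm (W - W') + norm (V - V'))"
    using assms(3) by (intro mult_right_mono) auto
  finally show "norm (g s W V - g s W' V') \<le> K' * exp (d * Re s) * (norm (W - W') + norm (V - V'))" .
next
  fix M :: real and W V assume *: "M \<le> N'" "W holomorphic_on lhp M" "V holomorphic_on lhp M"
    "\<forall>s\<in>lhp M. norm (W s) \<le> 1 \<and> norm (V s) \<le> 1"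
  then show "(\<lambda>s. g s (W s) (V s)) holomorphic_on lhp M"
    using tame_onD(3)[OF assms(1), of M W V] assms(2) by simp
qed

lemma tameE2:
  assumes "tame d f" "tame d' g"
  obtains N K where "N \<le> 0" "K \<ge> 0" "tame_on N K d f" "tame_on N K d' g"
proof -
  obtain N1 K1 N2 K2 where "tame_on N1 K1 d f" "tame_on N2 K2 d' g"
    using assms unfolding tame_def by blast
  then have "tame_on (min 0 (min N1 N2)) (max 0 (max K1 K2)) d f"
    "tame_on (min 0 (min N1 N2)) (max 0 (max K1 K2)) d' g"
    by (auto elim!: tame_on_mono)
  then show ?thesis by (intro that[of "min 0 (min N1 N2)" "max 0 (max K1 K2)"]) auto
qed

lemma tameE:
  assumes "tame d f"
  obtains N K where "N \<le> 0" "K \<ge> 0" "tame_on N K d f"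
  using tameE2[OF assms assms] by blast

lemma tameI:
  assumes "\<And>s W V. Re s < N \<Longrightarrow> norm W \<le> 1 \<Longrightarrow> norm V \<le> 1 \<Longrightarrow> norm (g s W V) \<le> K * exp (d * Re s)"
    and "\<And>s W V W' V'. Re s < N \<Longrightarrow> norm W \<le> 1 \<Longrightarrow> norm V \<le> 1 \<Longrightarrow> norm W' \<le> 1 \<Longrightarrow> norm V' \<le> 1 \<Longrightarrow>
      norm (g s W V - g s W' V') \<le> L * exp (d * Re s) * (norm (W - W') + norm (V - V'))"
    and "\<And>M W V. M \<le> N \<Longrightarrow> W holomorphic_on lhp M \<Longrightarrow> V holomorphic_on lhp M \<Longrightarrow>
      (\<And>s. s \<in> lhp M \<Longrightarrow> norm (W s) \<le> 1 \<and> norm (V s) \<le> 1) \<Longrightarrow>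
      (\<lambda>s. g s (W s) (V s)) holomorphic_on lhp M"
  shows "tame d g"
proof -
  have "tame_on N (max K L) d g"
    unfolding tame_on_def
  proof (intro conjI allI impI)
    fix s W V W' V' :: complex assume *: "Re s < N" "norm W \<le> 1" "norm V \<le> 1" "norm W' \<le> 1" "norm V' \<le> (1::real)"
    have "norm (g s W V) \<le> K * exp (d * Re s)" using assms(1) * by simp
    also have "\<dots> \<le> max K L * exp (d * Re s)" by (intro mult_right_mono) auto
    finally show "norm (g s W V) \<le> max K L * exp (d * Re s)" .
    have "norm (g s W V - g s W' V') \<le> L * exp (d * Re s) * (norm (W - W') + norm (V - V'))"
      using assms(2) * by simp
    also have "\<dots> \<le> max K L * exp (d * Re s) * (norm (W - W') + norm (V - V'))"
      by (intro mult_right_mono) auto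
    finally show "norm (g s W V - g s W' V') \<le> max K L * exp (d * Re s) * (norm (W - W') + norm (V - V'))" .
  qed (use assms(3) in auto)
  then show ?thesis by (auto simp: tame_def)
qed

text \<open>Lowering the exponent enlarges exp (d Re s) where Re s < 0, which is why
  \<open>tameE\<close> supplies a half-plane with N \<le> 0.\<close>

lemma tame_weaken:
  assumes "tame d g" "d' \<le> d"
  shows "tame d' g"
proof -
  obtain N K where N: "N \<le> 0" "K \<ge> 0" and T: "tame_on N K d g" using assms(1) by (rule tameE)
  have e: "exp (d * Re s) \<le> exp (d' * Re s)" if "Re s < N" for s
    using that N assms(2) by (auto intro: mult_right_mono_neg)
  show ?thesis
  proof (rule tameI[where N = N and K = K and L = K])
    fix s W V :: complex assume *: "Re s < N" "norm W \<le> 1" "norm V \<le> (1::real)"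
    show "norm (g s W V) \<le> K * exp (d' * Re s)"
      using tame_onD(1)[OF T *] e[OF *(1)] N(2) by (meson mult_left_mono order_trans)
  next
    fix s W V W' V' :: complex assume *: "Re s < N" "norm W \<le> 1" "norm V \<le> 1" "norm W' \<le> 1" "norm V' \<le> (1::real)"
    show "norm (g s W V - g s W' V') \<le> K * exp (d' * Re s) * (norm (W - W') + norm (V - V'))"
      by (rule order_trans[OF tame_onD(2)[OF T *]], intro mult_right_mono mult_left_mono e * N) auto
  qed (use tame_onD(3)[OF T] in auto)
qed

lemma tame_const: "tame 0 (\<lambda>s W V. c)"
  by (rule tameI[where N = 0 and K = "norm c" and L = 0]) auto

lemma tame_snd: "tame 0 (\<lambda>s W V. V)"
  by (rule tameI[where N = 0 and K = 1 and L = 1]) auto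

lemma tame_exp: "tame k (\<lambda>s W V. exp (of_real k * s))"
  by (rule tameI[where N = 0 and K = 1 and L = 0]) (auto intro!: holomorphic_intros)

lemma tame_exp_fst: "tame 0 (\<lambda>s W V. exp (c * W))"
proof (rule tameI[where N = 0 and K = "exp (norm c)" and L = "norm c * exp (norm c)"])
  have b: "norm (exp (c * W)) \<le> exp (norm c)" if "norm W \<le> 1" for W
  proof -
    have "Re (c * W) \<le> norm c * norm W" using complex_Re_le_cmod[of "c * W"] by (simp add: norm_mult)
    also have "\<dots> \<le> norm c" using that by (simp add: mult_left_le)
    finally show ?thesis by simp
  qed
  then show "norm (exp (c * W)) \<le> exp (norm c) * exp (0 * Re s)" if "norm W \<le> 1" for s W :: complex
    using that by simp
  fix s W V W' V' :: complex assume *: "Re s < 0" "norm W \<le> 1" "norm V \<le> 1" "norm W' \<le> 1" "norm V' \<le> (1::real)"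
  have "norm (exp (c * W) - exp (c * W')) \<le> norm c * exp (norm c) * norm (W - W')"
  proof (rule field_differentiable_bound[where S = "cball 0 1" and f' = "\<lambda>z. c * exp (c * z)"])
    show "((\<lambda>z. exp (c * z)) has_field_derivative c * exp (c * z)) (at z within cball 0 1)" for z
      by (auto intro!: derivative_eq_intros)
    show "norm (c * exp (c * z)) \<le> norm c * exp (norm c)" if "z \<in> cball 0 1" for z
      unfolding norm_mult using b that by (intro mult_left_mono) auto
  qed (use * in auto)
  also have "\<dots> \<le> norm c * exp (norm c) * (norm (W - W') + norm (V - V'))"
    by (intro mult_left_mono) auto
  finally show "norm (exp (c * W) - exp (c * W'))
     \<le> norm c * exp (norm c) * exp (0 * Re s) * (norm (W - W') + norm (V - V'))" by simp
qed (auto intro!: holomorphic_intros)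

lemma tame_add:
  assumes "tame d f" "tame d g"
  shows "tame d (\<lambda>s W V. f s W V + g s W V)"
proof -
  obtain N K where N: "N \<le> 0" "K \<ge> 0" and T: "tame_on N K d f" "tame_on N K d g"
    using assms by (rule tameE2)
  show ?thesis
  proof (rule tameI[where N = N and K = "2 * K" and L = "2 * K"])
    fix s W V :: complex assume *: "Re s < N" "norm W \<le> 1" "norm V \<le> (1::real)"
    show "norm (f s W V + g s W V) \<le> 2 * K * exp (d * Re s)"
      using tame_onD(1)[OF T(1) *] tame_onD(1)[OF T(2) *] norm_triangle_ineq[of "f s W V" "g s W V"] by simp
  next
    fix s W V W' V' :: complex assume *: "Re s < N" "norm W \<le> 1" "norm V \<le> 1" "norm W' \<le> 1" "norm V' \<le> (1::real)"
    show "norm (f s W V + g s W V - (f s W' V' + g s W' V'))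
      \<le> 2 * K * exp (d * Re s) * (norm (W - W') + norm (V - V'))"
      using tame_onD(2)[OF T(1) *] tame_onD(2)[OF T(2) *]
        norm_triangle_ineq[of "f s W V - f s W' V'" "g s W V - g s W' V'"]
      by (simp add: add_diff_add)
  qed (use tame_onD(3)[OF T(1)] tame_onD(3)[OF T(2)] in \<open>auto intro!: holomorphic_intros\<close>)
qed

lemma tame_mult:
  assumes "tame d f" "tame d' g"
  shows "tame (d + d') (\<lambda>s W V. f s W V * g s W V)"
proof -
  obtain N K where N: "N \<le> 0" "K \<ge> 0" and T: "tame_on N K d f" "tame_on N K d' g"
    using assms by (rule tameE2)
  have e: "exp ((d + d') * t) = exp (d * t) * exp (d' * t)" for t by (simp add: algebra_simps exp_add)
  show ?thesis
  proof (rule tameI[where N = N and K = "K * K" and L = "2 * (K * K)"])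
    fix s W V :: complex assume *: "Re s < N" "norm W \<le> 1" "norm V \<le> (1::real)"
    have "norm (f s W V * g s W V) \<le> (K * exp (d * Re s)) * (K * exp (d' * Re s))"
      unfolding norm_mult using tame_onD(1)[OF T(1) *] tame_onD(1)[OF T(2) *] N by (intro mult_mono) auto
    then show "norm (f s W V * g s W V) \<le> K * K * exp ((d + d') * Re s)" unfolding e by (simp add: mult_ac)
  next
    fix s W V W' V' :: complex assume *: "Re s < N" "norm W \<le> 1" "norm V \<le> 1" "norm W' \<le> 1" "norm V' \<le> (1::real)"
    let ?D = "norm (W - W') + norm (V - V')"
    have "norm (f s W V * g s W V - f s W' V' * g s W' V')
      = norm (f s W V * (g s W V - g s W' V') + (f s W V - f s W' V') * g s W' V')"
      by (simp add: algebra_simps)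
    also have "\<dots> \<le> norm (f s W V) * norm (g s W V - g s W' V') + norm (f s W V - f s W' V') * norm (g s W' V')"
      by (metis norm_mult norm_triangle_ineq)
    also have "\<dots> \<le> (K * exp (d * Re s)) * (K * exp (d' * Re s) * ?D) + (K * exp (d * Re s) * ?D) * (K * exp (d' * Re s))"
      using tame_onD(1)[OF T(1) *(1-3)] tame_onD(1)[OF T(2) *(1,4,5)] tame_onD(2)[OF T(1) *] tame_onD(2)[OF T(2) *] N
      by (intro add_mono mult_mono) auto
    finally show "norm (f s W V * g s W V - f s W' V' * g s W' V')
      \<le> 2 * (K * K) * exp ((d + d') * Re s) * ?D" unfolding e by (simp add: mult_ac)
  qed (use tame_onD(3)[OF T(1)] tame_onD(3)[OF T(2)] in \<open>auto intro!: holomorphic_intros\<close>)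
qed

lemma tame_cmult: "tame d f \<Longrightarrow> tame d (\<lambda>s W V. c * f s W V)"
  using tame_mult[OF tame_const[of c], of d f] by simp

lemma tame_diff: "tame d f \<Longrightarrow> tame d g \<Longrightarrow> tame d (\<lambda>s W V. f s W V - g s W V)"
  using tame_add[of d f "\<lambda>s W V. (-1) * g s W V"] tame_cmult[of d g "-1"] by simp

text \<open>A positive exponent allows K exp (d N) \<le> 1/2, so the denominator has modulus at
  least 1/2. Both constants are then 2: the size is at most 1 / (1/2), and a difference is at most
  (1/2) / (1/4) times the distance.\<close>

lemma tame_geometric:
  assumes "tame d g" "d > 0"
  shows "tame 0 (\<lambda>s W V. 1 / (1 - g s W V))"
proof -
  obtain N0 K where N0: "N0 \<le> 0" "K \<ge> 0" and T0: "tame_on N0 K d g" using assms(1) by (rule tameE)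
  obtain N where N: "N \<le> N0" "K * exp (d * N) \<le> 1 / 2"
    using exp_small[OF \<open>d > 0\<close>, of "1/2"] by (metis half_gt_zero_iff zero_less_one)
  have T: "tame_on N K d g" using tame_on_mono[OF T0] N by simp
  have K: "K * exp (d * Re s) \<le> 1/2" if "Re s < N" for s
    using that \<open>d > 0\<close> N0 by (intro order_trans[OF mult_left_mono N(2)]) auto
  have b: "norm (1 - g s W V) \<ge> 1/2" if "Re s < N" "norm W \<le> 1" "norm V \<le> 1" for s W V
    using norm_triangle_ineq2[of 1 "g s W V"] tame_onD(1)[OF T that] K[OF that(1)] by simp
  show ?thesis
  proof (rule tameI[where N = N and K = 2 and L = 2])
    fix s W V :: complex assume *: "Re s < N" "norm W \<le> 1" "norm V \<le> (1::real)"
    show "norm (1 / (1 - g s W V)) \<le> 2 * exp (0 * Re s)"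
      using b[OF *] by (simp add: norm_divide divide_simps)
  next
    fix s W V W' V' :: complex assume *: "Re s < N" "norm W \<le> 1" "norm V \<le> 1" "norm W' \<le> 1" "norm V' \<le> (1::real)"
    let ?D = "norm (W - W') + norm (V - V')"
    note b1 = b[OF *(1-3)] and b2 = b[OF *(1,4,5)]
    have ne: "1 - g s W V \<noteq> 0" "1 - g s W' V' \<noteq> 0" using b1 b2 by fastforce+
    have "1 / (1 - g s W V) - 1 / (1 - g s W' V')
      = (g s W V - g s W' V') / ((1 - g s W V) * (1 - g s W' V'))"
      using ne by (simp add: divide_simps)
    then have "norm (1 / (1 - g s W V) - 1 / (1 - g s W' V'))
      = norm (g s W V - g s W' V') / (norm (1 - g s W V) * norm (1 - g s W' V'))"
      by (simp add: norm_divide norm_mult)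
    also have "\<dots> \<le> (1/2 * ?D) / (1/2 * (1/2))"
    proof (rule frac_le)
      have "K * exp (d * Re s) * ?D \<le> 1/2 * ?D" using K[OF *(1)] by (intro mult_right_mono) auto
      then show "norm (g s W V - g s W' V') \<le> 1/2 * ?D" using tame_onD(2)[OF T *] by linarith
      show "1/2 * (1/2) \<le> norm (1 - g s W V) * norm (1 - g s W' V')" using b1 b2 by (intro mult_mono) auto
    qed auto
    finally show "norm (1 / (1 - g s W V) - 1 / (1 - g s W' V')) \<le> 2 * exp (0 * Re s) * ?D" by simp
  next
    fix M :: real and W V assume *: "M \<le> N" "W holomorphic_on lhp M" "V holomorphic_on lhp M"
      "\<And>s. s \<in> lhp M \<Longrightarrow> norm (W s) \<le> 1 \<and> norm (V s) \<le> 1"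
    have "1 - g s (W s) (V s) \<noteq> 0" if "s \<in> lhp M" for s
      using b[of s "W s" "V s"] * that by fastforce
    then show "(\<lambda>s. 1 / (1 - g s (W s) (V s))) holomorphic_on lhp M"
      using tame_onD(3)[OF T *] by (intro holomorphic_intros) auto
  qed
qed

section \<open>Existence of the branch\<close>

text \<open>Here \<open>w = w\<^sub>0 - \<sigma> s / 2 + W\<close> with \<open>z = exp (2 w\<^sub>0)\<close>; then \<open>ansatz_exp\<close> is \<open>exp (2 w)\<close>,
  \<open>ansatz\<close> is \<open>cosh\<^sup>2 w\<close> and \<open>ansatz_root\<close> is \<open>cosh w sinh w\<close>.\<close>

definition ansatz_exp :: "complex \<Rightarrow> real \<Rightarrow> complex \<Rightarrow> complex \<Rightarrow> complex" where
  "ansatz_exp z \<sigma> s W = z * exp (of_real (-\<sigma>) * s) * exp (2 * W)"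

definition ansatz :: "complex \<Rightarrow> real \<Rightarrow> complex \<Rightarrow> complex \<Rightarrow> complex" where
  "ansatz z \<sigma> s W = (ansatz_exp z \<sigma> s W + 2 + ansatz_exp (1/z) (-\<sigma>) s (-W)) / 4"

definition ansatz_root :: "complex \<Rightarrow> real \<Rightarrow> complex \<Rightarrow> complex \<Rightarrow> complex" where
  "ansatz_root z \<sigma> s W = (ansatz_exp z \<sigma> s W - ansatz_exp (1/z) (-\<sigma>) s (-W)) / 4"

text \<open>\<open>V\<close> stands for W', so the last argument is w' = W' - \<sigma> / 2.\<close>

definition ansatz_force :: "complex \<Rightarrow> complex \<Rightarrow> real \<Rightarrow> complex \<Rightarrow> complex \<Rightarrow> complex \<Rightarrow> complex" where
  "ansatz_force \<mu> z \<sigma> s W V =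
     PVI_force \<mu> (exp s) (ansatz z \<sigma> s W) (ansatz_root z \<sigma> s W) (V - of_real (\<sigma>/2))"

lemma ansatz_exp_inverse: "z \<noteq> 0 \<Longrightarrow> ansatz_exp z \<sigma> s W * ansatz_exp (1/z) (-\<sigma>) s (-W) = 1"
  by (simp add: ansatz_exp_def exp_minus field_simps)

lemma ansatz_root_square: "z \<noteq> 0 \<Longrightarrow> (ansatz_root z \<sigma> s W)^2 = (ansatz z \<sigma> s W)^2 - ansatz z \<sigma> s W"
  using ansatz_exp_inverse[of z \<sigma> s W] unfolding ansatz_root_def ansatz_def
  by (simp add: field_simps power2_eq_square)

text \<open>The scalar \<open>c\<close> serves the values 1 and -1, that is exp (2 w) and exp (-2
  w).\<close>

lemma tame_ansatz_exp: "tame (-\<sigma>) (\<lambda>s W V. ansatz_exp z \<sigma> s (c * W))"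
  using tame_mult[OF tame_cmult[OF tame_exp[of "-\<sigma>"], of z] tame_exp_fst[of "2 * c"]]
  by (simp add: ansatz_exp_def mult.assoc)

text \<open>For \<sigma> \<ge> 0 the term exp (2 w), of exponent -\<sigma>, dominates to the left;
  the constant and exp (-2 w) are weakened to that exponent.\<close>

lemma tame_ansatz:
  assumes "0 \<le> \<sigma>"
  shows "tame (-\<sigma>) (\<lambda>s W V. ansatz z \<sigma> s W)" "tame (-\<sigma>) (\<lambda>s W V. ansatz_root z \<sigma> s W)"
proof -
  have 1: "tame (-\<sigma>) (\<lambda>s W V. ansatz_exp z \<sigma> s W)" using tame_ansatz_exp[of \<sigma> z 1] by simp
  have 2: "tame (-\<sigma>) (\<lambda>s W V. ansatz_exp (1/z) (-\<sigma>) s (-W))"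
    using tame_weaken[OF tame_ansatz_exp[of "-\<sigma>" "1/z" "-1"], of "-\<sigma>"] assms by simp
  have 3: "tame (-\<sigma>) (\<lambda>s W V. 2)" using assms by (intro tame_weaken[OF tame_const]) simp
  show "tame (-\<sigma>) (\<lambda>s W V. ansatz z \<sigma> s W)" "tame (-\<sigma>) (\<lambda>s W V. ansatz_root z \<sigma> s W)"
    using tame_cmult[OF tame_add[OF tame_add[OF 1 3] 2], of "1/4"] tame_cmult[OF tame_diff[OF 1 2], of "1/4"]
    by (simp_all add: ansatz_def ansatz_root_def)
qed

text \<open>Each of the four terms in the bracket of \<open>PVI_force\<close> can be given the
  exponent -\<sigma>, and the factor \<open>x\<close> in front adds 1. The hypothesis \<sigma> < 1
  enters through x u, whose exponent 1 - \<sigma> is positive: this makes both 1 - x u and its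
  reciprocal bounded.\<close>

lemma tame_ansatz_force:
  assumes "0 \<le> \<sigma>" "\<sigma> < 1"
  shows "tame (1 - \<sigma>) (ansatz_force \<mu> z \<sigma>)"
proof -
  have x: "tame 1 (\<lambda>s W V. exp s)" using tame_exp[of 1] by simp
  note u = tame_ansatz(1)[OF assms(1), of z] and m = tame_ansatz(2)[OF assms(1), of z]
  have xu: "tame (1 - \<sigma>) (\<lambda>s W V. exp s * ansatz z \<sigma> s W)" using tame_mult[OF x u] by simp
  have X: "tame 0 (\<lambda>s W V. 1 / (1 - exp s))" using tame_geometric[OF x] by simp
  have Y: "tame 0 (\<lambda>s W V. 1 / (1 - exp s * ansatz z \<sigma> s W))" using tame_geometric[OF xu] assms by simp
  have w: "tame 0 (\<lambda>s W V. V - of_real (\<sigma>/2))" by (rule tame_diff[OF tame_snd tame_const])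
  have xu1: "tame 0 (\<lambda>s W V. 1 - exp s * ansatz z \<sigma> s W)"
    using tame_diff[OF tame_const tame_weaken[OF xu]] assms by simp
  have a: "tame (-\<sigma>) (\<lambda>s W V. ansatz_root z \<sigma> s W / 4 * (1 / (1 - exp s)) * (- (1 / (1 - exp s * ansatz z \<sigma> s W))))"
    using tame_mult[OF tame_mult[OF tame_cmult[OF m, of "1/4"] X] tame_cmult[OF Y, of "-1"]] by simp
  have b: "tame (-\<sigma>) (\<lambda>s W V. (ansatz z \<sigma> s W * (V - of_real (\<sigma>/2)) + ansatz_root z \<sigma> s W * (V - of_real (\<sigma>/2))^2)
     * (1 / (1 - exp s * ansatz z \<sigma> s W)))"
    using tame_mult[OF tame_add[OF tame_mult[OF u w, simplified] tame_mult[OF m tame_mult[OF w w], simplified]] Y]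
    by (simp add: power2_eq_square)
  have c: "tame (-\<sigma>) (\<lambda>s W V. (V - of_real (\<sigma>/2)) * (1 / (1 - exp s)))"
    using tame_weaken[OF tame_mult[OF w X]] assms by simp
  have d: "tame (-\<sigma>) (\<lambda>s W V. (2 * \<mu> - 1)^2 / 4 * ansatz_root z \<sigma> s W * (1 - exp s * ansatz z \<sigma> s W) * (1 / (1 - exp s))^2)"
    using tame_mult[OF tame_mult[OF tame_cmult[OF m, of "(2 * \<mu> - 1)^2 / 4"] xu1] tame_mult[OF X X]] by (simp add: power2_eq_square)
  show ?thesis
    using tame_mult[OF x tame_diff[OF tame_add[OF tame_diff[OF a b] c] d]]
    unfolding ansatz_force_def[abs_def] PVI_force_def by simp
qed

lemma ansatz_exp_deriv:
  assumes "(W has_field_derivative V) (at s)"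
  shows "((\<lambda>s. ansatz_exp z \<sigma> s (W s)) has_field_derivative
      ansatz_exp z \<sigma> s (W s) * (2 * V - of_real \<sigma>)) (at s)"
  unfolding ansatz_exp_def
  by (rule assms derivative_eq_intros refl)+ (simp add: algebra_simps)

lemma ansatz_deriv:
  assumes "(W has_field_derivative V) (at s)"
  shows "((\<lambda>s. ansatz z \<sigma> s (W s)) has_field_derivative
      2 * ansatz_root z \<sigma> s (W s) * (V - of_real (\<sigma>/2))) (at s)"
    and "((\<lambda>s. ansatz_root z \<sigma> s (W s)) has_field_derivative
      (2 * ansatz z \<sigma> s (W s) - 1) * (V - of_real (\<sigma>/2))) (at s)"
proof -
  note A = ansatz_exp_deriv[OF assms, of z \<sigma>]
  note B = ansatz_exp_deriv[OF DERIV_minus[OF assms], of "1/z" "-\<sigma>"]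
  show "((\<lambda>s. ansatz z \<sigma> s (W s)) has_field_derivative
      2 * ansatz_root z \<sigma> s (W s) * (V - of_real (\<sigma>/2))) (at s)"
    unfolding ansatz_def ansatz_root_def
    by (rule DERIV_cong[OF DERIV_cdivide[OF DERIV_add[OF DERIV_add[OF A DERIV_const] B]]])
      (simp add: algebra_simps add_divide_distrib diff_divide_distrib)
  show "((\<lambda>s. ansatz_root z \<sigma> s (W s)) has_field_derivative
      (2 * ansatz z \<sigma> s (W s) - 1) * (V - of_real (\<sigma>/2))) (at s)"
    unfolding ansatz_def ansatz_root_def
    by (rule DERIV_cong[OF DERIV_cdivide[OF DERIV_diff[OF A B]]])
      (simp add: algebra_simps add_divide_distrib diff_divide_distrib)
qed

lemma ansatz_derivs:
  fixes \<sigma> :: real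
  assumes "open S" "s \<in> S"
    and "\<And>s. s \<in> S \<Longrightarrow> (W has_field_derivative V s) (at s)"
    and "(V has_field_derivative V') (at s)"
  defines "\<omega> \<equiv> \<lambda>s. V s - of_real (\<sigma>/2)"
  shows "((\<lambda>s. 2 * ansatz_root z \<sigma> s (W s) * \<omega> s) has_field_derivative
      2 * ansatz_root z \<sigma> s (W s) * V' + 2 * (2 * ansatz z \<sigma> s (W s) - 1) * (\<omega> s)^2) (at s)"
  unfolding \<omega>_def
  by (rule derivative_eq_intros ansatz_deriv(2)[OF assms(3)] assms(2,4) refl
      | simp add: power2_eq_square algebra_simps)+

text \<open>This is the choice of z = exp (2 w0) from \<open>a\<close>. For \<sigma> > 0 the
  dominant part of cosh^2 w is exp (2 w) / 4, so z = 4 a. For \<sigma> = 0 all three terms have the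
  same size, and cosh^2 w0 = a is solved exactly.\<close>

lemma ansatz_asymptotic:
  assumes "a \<noteq> 0" "0 \<le> \<sigma>" "\<sigma> < 1"
  obtains z \<epsilon> C where "z \<noteq> 0" "0 < \<epsilon>" "\<epsilon> \<le> 1 - \<sigma>" "C \<ge> 0"
    "\<And>s. Re s < 0 \<Longrightarrow> norm (ansatz z \<sigma> s 0 - a * exp (of_real (-\<sigma>) * s)) \<le> C * exp ((\<epsilon> - \<sigma>) * Re s)"
    "\<And>s. \<sigma> = 0 \<Longrightarrow> ansatz z \<sigma> s 0 = a"
proof (cases "\<sigma> = 0")
  case True
  \<comment> \<open>Since q^2 = a^2 - a, the numbers 2 a - 1 + 2 q and 2 a - 1 - 2 q are inverse to
    each other; they are exp (2 w0) and exp (-2 w0).\<close>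
  define q where "q = csqrt (a^2 - a)"
  define z z' where "z = 2 * a - 1 + 2 * q" and "z' = 2 * a - 1 - 2 * q"
  have "q^2 = a^2 - a" by (simp add: q_def)
  then have "z * z' = 1" unfolding z_def z'_def by algebra
  then have z: "z \<noteq> 0" "1 / z = z'"
    by (auto, metis mult_zero_left nonzero_mult_div_cancel_left zero_neq_one)
  have "z + z' = 4 * a - 2" by (simp add: z_def z'_def)
  then have "ansatz z \<sigma> s 0 = a" for s
    by (simp add: True ansatz_def ansatz_exp_def z(2) algebra_simps flip: add.assoc)
  then show ?thesis using z by (intro that[of z 1 0]) (auto simp: True)
next
  case False
  define C where "C = 1/2 + norm (1 / (16 * a))"
  show ?thesis
  \<comment> \<open>The error is 1/2 plus a decaying term, hence merely bounded, which forces
    \<epsilon> \<le> \<sigma>. The other bound, \<epsilon> \<le> 1 - \<sigma>, later lets the decay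
    of \<open>W\<close> be absorbed.\<close>
  proof (rule that[of "4 * a" "min \<sigma> (1 - \<sigma>)" C])
    fix s assume s: "Re s < 0"
    have "ansatz (4 * a) \<sigma> s 0 - a * exp (of_real (-\<sigma>) * s) = 1/2 + 1 / (16 * a) * exp (of_real \<sigma> * s)"
      by (simp add: ansatz_def ansatz_exp_def field_simps)
    also have "norm \<dots> \<le> 1/2 + norm (1 / (16 * a)) * norm (exp (of_real \<sigma> * s))"
      by (rule order_trans[OF norm_triangle_ineq]) (simp add: norm_mult norm_divide)
    also have "\<dots> \<le> C * 1"
      unfolding C_def using s assms(2) by (auto intro!: mult_left_le simp: mult_nonneg_nonpos)
    also have "\<dots> \<le> C * exp ((min \<sigma> (1 - \<sigma>) - \<sigma>) * Re s)"
      using s by (intro mult_left_mono) (auto simp: C_def intro!: mult_nonpos_nonpos)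
    finally show "norm (ansatz (4 * a) \<sigma> s 0 - a * exp (of_real (-\<sigma>) * s))
      \<le> C * exp ((min \<sigma> (1 - \<sigma>) - \<sigma>) * Re s)" .
  qed (use assms False in \<open>auto simp: C_def\<close>)
qed

section \<open>The cut plane and its logarithmic image, a strip of width 2 pi\<close>

definition cut_plane :: "real \<Rightarrow> complex set" where
  "cut_plane \<phi> = {x. x \<noteq> 0 \<and> \<not> is_Arg x \<phi>}"

text \<open>Rotation by -(\<phi> + pi) carries the cut ray to the negative real axis, the branch cut
  of \<open>Ln\<close>.\<close>

lemma cut_plane_iff: "x \<in> cut_plane \<phi> \<longleftrightarrow> x * cis (- (\<phi> + pi)) \<notin> \<real>\<^sub>\<le>\<^sub>0"
proof (cases "x = 0")
  case False
  have c: "cis (- (\<phi> + pi)) * cis (\<phi> + pi) = 1" "cis (\<phi> + pi) = - cis \<phi>"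
    by (simp only: cis_mult, simp) (metis cis_mult cis_pi mult_minus1_right)
  have "is_Arg x \<phi> \<longleftrightarrow> x = of_real (norm x) * cis \<phi>" by (simp add: is_Arg_def cis_conv_exp)
  also have "\<dots> \<longleftrightarrow> x * cis (- (\<phi> + pi)) = - of_real (norm x)"
    using c by (smt (verit, ccfv_threshold) mult.assoc mult.commute mult.right_neutral mult_minus_left minus_mult_minus)
  also have "\<dots> \<longleftrightarrow> x * cis (- (\<phi> + pi)) \<in> \<real>\<^sub>\<le>\<^sub>0"
  proof
    assume "x * cis (- (\<phi> + pi)) \<in> \<real>\<^sub>\<le>\<^sub>0"
    then obtain r where r: "r \<le> 0" "x * cis (- (\<phi> + pi)) = of_real r"
      by (metis nonpos_Reals_cases)
    then have "norm x = - r" by (metis abs_of_nonpos norm_cis norm_mult norm_of_real mult.right_neutral)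
    then show "x * cis (- (\<phi> + pi)) = - of_real (norm x)" using r by simp
  qed (simp del: minus_add_distrib)
  finally show ?thesis using False by (simp add: cut_plane_def)
qed (simp add: cut_plane_def)

lemma open_cut_plane: "open (cut_plane \<phi>)"
proof -
  have "cut_plane \<phi> = (\<lambda>x. x * cis (- (\<phi> + pi))) -` (- \<real>\<^sub>\<le>\<^sub>0)" by (auto simp: cut_plane_iff)
  then show ?thesis
    by (simp only:, intro open_vimage) (auto intro!: continuous_intros)
qed

lemma cut_log_derivative:
  assumes "x \<in> cut_plane \<phi>"
  shows "(cut_log \<phi> has_field_derivative 1 / x) (at x)"
  unfolding cut_log_def[abs_def]
  by (rule derivative_eq_intros refl assms[unfolded cut_plane_iff]
      | use assms in \<open>simp add: cut_plane_def field_simps del: minus_add_distrib\<close>)+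

lemma Re_cut_log: "x \<noteq> 0 \<Longrightarrow> Re (cut_log \<phi> x) = ln (norm x)"
  by (simp add: cut_log_def norm_mult del: minus_add_distrib)

definition strip :: "real \<Rightarrow> real \<Rightarrow> complex set" where
  "strip \<phi> N = {s. Re s < N \<and> \<phi> < Im s \<and> Im s < \<phi> + 2 * pi}"

lemma strip_eq_box: "strip \<phi> N = lhp N \<inter> ({s. Im s > \<phi>} \<inter> {s. Im s < \<phi> + 2 * pi})"
  by (auto simp: strip_def)

lemma open_strip: "open (strip \<phi> N)"
  unfolding strip_eq_box by (intro open_Int open_lhp open_halfspace_Im_gt open_halfspace_Im_lt)

lemma convex_strip: "convex (strip \<phi> N)"
  unfolding strip_eq_box by (intro convex_Int convex_lhp convex_halfspace_Im_gt convex_halfspace_Im_lt)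

lemma exp_strip:
  assumes "s \<in> strip \<phi> N"
  shows "exp s \<in> cut_plane \<phi>" "cut_log \<phi> (exp s) = s" "norm (exp s) < exp N"
proof -
  have e: "exp s * cis (- (\<phi> + pi)) = exp (s - \<i> * of_real (\<phi> + pi))"
    by (simp add: exp_diff cis_conv_exp exp_minus field_simps del: minus_add_distrib)
  have L: "Ln (exp s * cis (- (\<phi> + pi))) = s - \<i> * of_real (\<phi> + pi)"
    unfolding e using assms by (intro Ln_exp) (auto simp: strip_def)
  have "Im (Ln (exp s * cis (- (\<phi> + pi)))) < pi" unfolding L using assms by (simp add: strip_def)
  then show "exp s \<in> cut_plane \<phi>"
    unfolding cut_plane_iff
    using Im_Ln_eq_pi[of "exp s * cis (- (\<phi> + pi))"]
    by (metis complex_nonpos_Reals_iff e exp_not_eq_zero less_irrefl complex_eq_iff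
        order_le_less zero_complex.sel)
  show "cut_log \<phi> (exp s) = s" unfolding cut_log_def L by simp
  show "norm (exp s) < exp N" using assms by (simp add: strip_def)
qed

lemma cut_log_strip: "x \<in> cut_plane \<phi> \<Longrightarrow> norm x < exp N \<Longrightarrow> cut_log \<phi> x \<in> strip \<phi> N"
  using Im_cut_log[of x \<phi>] ln_less_cancel_iff[of "norm x" "exp N"]
  by (simp add: strip_def cut_plane_def Re_cut_log)

lemma cut_disc_eq: "cut_disc \<phi> r = cut_plane \<phi> \<inter> {x. norm x \<le> r}"
  by (auto simp: cut_disc_def cut_plane_def)

text \<open>For a holomorphic function, differentiation in Im x is \<i> times differentiation in Re
  x; hence the witness, \<i>^j times the complex derivative of order i + j. Analyticity provides
  these derivatives also at points of \<open>S\<close> that are not interior.\<close>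

lemma analytic_imp_smooth_on:
  assumes "f analytic_on S"
  shows "smooth_on S f"
  unfolding smooth_on_def
proof (intro exI[of _ "\<lambda>i j x. \<i> ^ j * (deriv ^^ (i + j)) f x"] conjI allI ballI)
  fix i j x assume x: "x \<in> S"
  have "(deriv ^^ (i + j)) f analytic_on S" using assms by (rule analytic_higher_deriv)
  then have "((deriv ^^ (i + j)) f has_field_derivative (deriv ^^ Suc (i + j)) f x) (at x within S)"
    using x analytic_derivI[OF analytic_on_subset[of _ S "{x}"]] by simp
  then have "((\<lambda>x. \<i> ^ j * (deriv ^^ (i + j)) f x) has_derivative
     (\<lambda>h. \<i> ^ j * ((deriv ^^ Suc (i + j)) f x * h))) (at x within S)"
    by (intro has_derivative_mult_right) (simp add: has_field_derivative_def)
  moreover have "\<i> ^ j * ((deriv ^^ Suc (i + j)) f x * h) =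
     of_real (Re h) * (\<i> ^ j * (deriv ^^ (Suc i + j)) f x) + of_real (Im h) * (\<i> ^ Suc j * (deriv ^^ (i + Suc j)) f x)" for h
    by (subst (1) complex_eq[of h]) (simp add: algebra_simps)
  ultimately show "((\<lambda>x. \<i> ^ j * (deriv ^^ (i + j)) f x) has_derivative
      (\<lambda>h. of_real (Re h) * (\<i> ^ j * (deriv ^^ (Suc i + j)) f x) + of_real (Im h) * (\<i> ^ Suc j * (deriv ^^ (i + Suc j)) f x)))
    (at x within S)" by simp
qed simp

text \<open>Chain rule with ds/dx = 1 / x; the resulting derivatives of y = x u are the arguments
  that \<open>PVI_cleared_log\<close> expects.\<close>

lemma has_derivs_from_log:
  assumes "open S" "cut_log \<phi> x \<in> S" and x: "x \<in> cut_plane \<phi>"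
    and u: "\<And>s. s \<in> S \<Longrightarrow> (u has_field_derivative v s) (at s)"
    and v: "\<And>s. s \<in> S \<Longrightarrow> (v has_field_derivative v' s) (at s)"
  defines "y \<equiv> \<lambda>x. x * u (cut_log \<phi> x)" and "s \<equiv> cut_log \<phi> x"
  shows "y analytic_on {x}" "deriv y x = u s + v s" "deriv (deriv y) x = (v s + v' s) / x"
proof -
  define D where "D = {x \<in> cut_plane \<phi>. cut_log \<phi> x \<in> S}"
  have cont: "continuous_on (cut_plane \<phi>) (cut_log \<phi>)"
    by (intro continuous_at_imp_continuous_on ballI DERIV_isCont[OF cut_log_derivative])
  then have "open D"
    using continuous_open_preimage[OF cont open_cut_plane \<open>open S\<close>]
    by (simp add: D_def vimage_def Int_def)
  have xD: "x \<in> D" using assms(2) x by (simp add: D_def)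
  have y': "(y has_field_derivative u (cut_log \<phi> x) + v (cut_log \<phi> x)) (at x)" if "x \<in> D" for x
  proof -
    have *: "x \<in> cut_plane \<phi>" "cut_log \<phi> x \<in> S" "x \<noteq> 0" using that by (auto simp: D_def cut_plane_def)
    show ?thesis
      unfolding y_def
      by (rule derivative_eq_intros DERIV_chain2[OF u cut_log_derivative] * refl | use * in \<open>simp add: field_simps\<close>)+
  qed
  have yh: "y holomorphic_on D" using y' unfolding holomorphic_on_open[OF \<open>open D\<close>] by blast
  then show "y analytic_on {x}"
    using xD \<open>open D\<close> analytic_on_open analytic_on_subset by (metis empty_subsetI insert_subset)
  have d: "deriv y x = u (cut_log \<phi> x) + v (cut_log \<phi> x)" if "x \<in> D" for x
    using y'[OF that] by (rule DERIV_imp_deriv)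
  show "deriv y x = u s + v s" using d[OF xD] by (simp add: s_def)
  have *: "x \<in> cut_plane \<phi>" "cut_log \<phi> x \<in> S" "x \<noteq> 0" using xD by (auto simp: D_def cut_plane_def)
  have "((\<lambda>x. u (cut_log \<phi> x) + v (cut_log \<phi> x)) has_field_derivative (v s + v' s) / x) (at x)"
    unfolding s_def
    by (rule derivative_eq_intros DERIV_chain2[OF u cut_log_derivative] DERIV_chain2[OF v cut_log_derivative] * refl
        | use * in \<open>simp add: field_simps\<close>)+
  then have "(deriv y has_field_derivative (v s + v' s) / x) (at x)"
    by (rule has_field_derivative_transform_within_open[OF _ \<open>open D\<close> xD]) (simp add: d)
  then show "deriv (deriv y) x = (v s + v' s) / x" by (rule DERIV_imp_deriv)
qed

text \<open>The last property keeps y = x u away from the value 1: x u has exponent 1 - \<sigma> >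
  0, so |x u| \<le> 1/2 far enough to the left.\<close>

lemma ansatz_bounds:
  assumes "0 \<le> \<sigma>" "\<sigma> < 1"
  obtains N K where "N \<le> 0" "K \<ge> 0"
    "\<And>s W. Re s < N \<Longrightarrow> norm W \<le> 1 \<Longrightarrow> norm (ansatz z \<sigma> s W) \<le> K * exp (- \<sigma> * Re s)"
    "\<And>s W. Re s < N \<Longrightarrow> norm W \<le> 1 \<Longrightarrow>
       norm (ansatz z \<sigma> s W - ansatz z \<sigma> s 0) \<le> K * exp (- \<sigma> * Re s) * norm W"
    "\<And>s W. Re s < N \<Longrightarrow> norm W \<le> 1 \<Longrightarrow> exp s * ansatz z \<sigma> s W \<noteq> 1"
proof -
  obtain N0 K where N0: "N0 \<le> 0" "K \<ge> 0" and T: "tame_on N0 K (-\<sigma>) (\<lambda>s W V. ansatz z \<sigma> s W)"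
    using tame_ansatz(1)[OF assms(1)] by (rule tameE)
  obtain N where N: "N \<le> N0" "K * exp ((1 - \<sigma>) * N) \<le> 1 / 2"
    using exp_small[of "1 - \<sigma>" "1/2"] assms(2) by (metis half_gt_zero_iff zero_less_one diff_gt_0_iff_gt)
  have b: "norm (ansatz z \<sigma> s W) \<le> K * exp (- \<sigma> * Re s)" if "Re s < N" "norm W \<le> 1" for s W
    using tame_onD(1)[OF T, of s W 0] that N by simp
  show ?thesis
  proof (rule that[of N K])
    fix s W :: complex assume s: "Re s < N" "norm W \<le> 1"
    show "norm (ansatz z \<sigma> s W - ansatz z \<sigma> s 0) \<le> K * exp (- \<sigma> * Re s) * norm W"
      using tame_onD(2)[OF T, of s W 0 0 0] s N by simp
    have "norm (exp s * ansatz z \<sigma> s W) \<le> exp (Re s) * (K * exp (- \<sigma> * Re s))"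
      using b[OF s] by (simp add: norm_mult)
    also have "\<dots> = K * exp ((1 - \<sigma>) * Re s)" by (simp add: algebra_simps flip: exp_add)
    also have "\<dots> \<le> 1/2"
      using s N0 assms(2) by (intro order_trans[OF mult_left_mono N(2)]) auto
    finally show "exp s * ansatz z \<sigma> s W \<noteq> 1" by auto
  qed (use N0 N b in auto)
qed

section \<open>Passing from the half-plane to a branch on the cut disc\<close>

lemma analytic_cut_powr: "S \<subseteq> cut_plane \<phi> \<Longrightarrow> (\<lambda>x. cut_powr \<phi> x p) analytic_on S"
proof -
  assume S: "S \<subseteq> cut_plane \<phi>"
  have "cut_log \<phi> holomorphic_on cut_plane \<phi>"
    unfolding holomorphic_on_open[OF open_cut_plane] using cut_log_derivative by blast
  then have "cut_log \<phi> analytic_on S"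
    using S open_cut_plane analytic_on_open analytic_on_subset by blast
  then show ?thesis unfolding cut_powr_def by (intro analytic_intros)
qed

text \<open>The function \<open>u\<close> lives on a full half-plane, hence on all sheets of the
  logarithm, so one \<open>u\<close> serves every \<phi>. The strict inequality r < exp N leaves
  room around the points with |x| = r, and N \<le> 0 keeps x = 1 outside.\<close>

lemma branch_from_log:
  assumes "N \<le> 0" "r < exp N" "0 < r"
    and u: "\<And>s. s \<in> lhp N \<Longrightarrow> (u has_field_derivative v s) (at s)"
    and v: "\<And>s. s \<in> lhp N \<Longrightarrow> (v has_field_derivative v' s) (at s)"
    and eq: "\<And>s. s \<in> lhp N \<Longrightarrow>
      PVI_cleared \<mu> (exp s) (exp s * u s) (u s + v s) ((v s + v' s) / exp s)"
  shows "PVI_branch \<mu> \<phi> r (\<lambda>x. x * u (cut_log \<phi> x))"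
  unfolding PVI_branch_def
proof (intro conjI ballI)
  have *: "x \<in> cut_plane \<phi>" "cut_log \<phi> x \<in> lhp N" "exp (cut_log \<phi> x) = x" "x \<noteq> 0" "x \<noteq> 1"
    if "x \<in> cut_disc \<phi> r" for x
  proof -
    have "norm x < exp N" using that assms by (auto simp: cut_disc_eq)
    moreover have "exp N \<le> 1" using assms by simp
    ultimately show "x \<noteq> 1" by auto
    show "x \<in> cut_plane \<phi>" using that by (simp add: cut_disc_eq)
    then show "cut_log \<phi> x \<in> lhp N" using cut_log_strip \<open>norm x < exp N\<close> by (auto simp: strip_def)
    show "x \<noteq> 0" using \<open>x \<in> cut_plane \<phi>\<close> by (simp add: cut_plane_def)
    then show "exp (cut_log \<phi> x) = x" by (rule exp_cut_log)
  qed
  note d = has_derivs_from_log[where S = "lhp N" and u = u and v = v and v' = v', OF open_lhp _ _ u v]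
  show "r < 1" using assms(1,2) by (meson exp_le_one_iff less_le_trans)
  show "(\<lambda>x. x * u (cut_log \<phi> x)) analytic_on cut_disc \<phi> r"
    by (subst analytic_on_analytic_at) (use d(1) * in auto)
  fix x assume x: "x \<in> cut_disc \<phi> r"
  show "PVI_at \<mu> x (x * u (cut_log \<phi> x)) (deriv (\<lambda>x. x * u (cut_log \<phi> x)) x)
      (deriv (deriv (\<lambda>x. x * u (cut_log \<phi> x))) x)"
    unfolding PVI_at_iff_cleared[OF *(4,5)[OF x]]
    using eq[OF *(2)[OF x]] d(2,3)[OF *(2)[OF x] *(1)[OF x]] *(3)[OF x] by simp
qed (rule assms)

text \<open>Only half of \<epsilon> is put into the power of x. With the full \<epsilon> the bound
  would only show \<open>f\<close> to be bounded; with \<epsilon> / 2 it gives |f| =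
  O(|x|^(\<epsilon> / 2)), so \<open>f\<close> has the limit 0.\<close>

lemma asymptotics_from_log:
  assumes "a \<noteq> 0" "\<epsilon> > 0" "r < exp N"
    and ana: "(\<lambda>x. x * u (cut_log \<phi> x)) analytic_on cut_disc \<phi> r"
    and bd: "\<And>s. s \<in> lhp N \<Longrightarrow> norm (u s - a * exp (of_real (-\<sigma>) * s)) \<le> C * exp ((\<epsilon> - \<sigma>) * Re s)"
  shows "PVI_asymptotics \<phi> a \<sigma> r (\<lambda>x. x * u (cut_log \<phi> x))"
proof -
  define f where "f x = (x * u (cut_log \<phi> x) / (a * cut_powr \<phi> x (1 - \<sigma>)) - 1) / cut_powr \<phi> x (\<epsilon> / 2)" for x
  have "f analytic_on cut_disc \<phi> r"
    unfolding f_def using assms(1)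
    by (intro analytic_intros ana analytic_cut_powr) (auto simp: cut_disc_eq cut_powr_def)
  then have "smooth_on (cut_disc \<phi> r) f" by (rule analytic_imp_smooth_on)
  moreover have fb: "norm (f x) \<le> C / norm a * norm x powr (\<epsilon> / 2)" if x: "x \<in> cut_disc \<phi> r" for x
  proof -
    define s where "s = cut_log \<phi> x"
    have x0: "x \<noteq> 0" "norm x < exp N" "x \<in> cut_plane \<phi>" using x assms(3) by (auto simp: cut_disc_eq cut_plane_def)
    have s: "s \<in> lhp N" using cut_log_strip[OF x0(3,2)] by (simp add: s_def strip_def)
    have xs: "x = exp s" using exp_cut_log[OF x0(1), of \<phi>] by (simp add: s_def)
    have "f x = (u s - a * exp (of_real (-\<sigma>) * s)) / (a * exp (of_real (-\<sigma>) * s) * exp (of_real (\<epsilon>/2) * s))"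
    proof -
      have "x / cut_powr \<phi> x (1 - \<sigma>) = 1 / exp (of_real (-\<sigma>) * s)"
      proof -
        have "cut_powr \<phi> x (1 - \<sigma>) = exp (of_real (1 - \<sigma>) * s)" by (simp add: cut_powr_def s_def)
        then show ?thesis
          unfolding xs by (simp add: divide_simps algebra_simps flip: exp_add)
      qed
      then have "x * u s / (a * cut_powr \<phi> x (1 - \<sigma>)) = u s / (a * exp (of_real (-\<sigma>) * s))"
        by (metis mult.commute times_divide_times_eq mult.right_neutral divide_divide_eq_left times_divide_eq_left)
      then have "f x = (u s / (a * exp (of_real (-\<sigma>) * s)) - 1) / exp (of_real (\<epsilon>/2) * s)"
        by (simp add: f_def cut_powr_def[of _ _ "\<epsilon>/2"] flip: s_def)
      also have "\<dots> = (u s - a * e) / (a * e) / exp (of_real (\<epsilon>/2) * s)"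
        if "e = exp (of_real (-\<sigma>) * s)" for e
        using assms(1) that by (subst diff_divide_distrib) simp
      finally show ?thesis by simp
    qed
    then have "norm (f x) = norm (u s - a * exp (of_real (-\<sigma>) * s)) / (norm a * exp ((\<epsilon>/2 - \<sigma>) * Re s))"
      by (simp add: norm_divide norm_mult algebra_simps flip: exp_add)
    also have "\<dots> \<le> C * exp ((\<epsilon> - \<sigma>) * Re s) / (norm a * exp ((\<epsilon>/2 - \<sigma>) * Re s))"
      by (intro divide_right_mono bd s) auto
    also have "\<dots> = C / norm a * exp (\<epsilon> / 2 * Re s)"
    proof -
      have "exp ((\<epsilon> - \<sigma>) * Re s) = exp (\<epsilon> / 2 * Re s) * exp ((\<epsilon>/2 - \<sigma>) * Re s)"
        by (simp add: algebra_simps flip: exp_add)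
      then show ?thesis by simp
    qed
    also have "exp (\<epsilon> / 2 * Re s) = norm x powr (\<epsilon> / 2)"
      using x0(1) by (simp add: powr_def s_def Re_cut_log)
    finally show ?thesis .
  qed
  moreover have "(f \<longlongrightarrow> 0) (at 0 within cut_disc \<phi> r)"
  proof (rule Lim_null_comparison)
    show "\<forall>\<^sub>F x in at 0 within cut_disc \<phi> r. norm (f x) \<le> C / norm a * norm x powr (\<epsilon> / 2)"
      unfolding eventually_at_filter using fb by (auto intro: always_eventually)
    have "((\<lambda>x::complex. norm x powr (\<epsilon> / 2)) \<longlongrightarrow> 0) (at 0 within cut_disc \<phi> r)"
      using assms(2) by (intro tendsto_zero_powrI[where b = "\<epsilon> / 2"] tendsto_const tendsto_norm_zero tendsto_ident_at) auto
    then show "((\<lambda>x. C / norm a * norm x powr (\<epsilon> / 2)) \<longlongrightarrow> 0) (at 0 within cut_disc \<phi> r)"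
      by (rule tendsto_mult_right_zero)
  qed
  moreover have "x * u (cut_log \<phi> x) = a * cut_powr \<phi> x (1 - \<sigma>) * (1 + cut_powr \<phi> x (\<epsilon> / 2) * f x)" for x
    using assms(1) by (simp add: f_def cut_powr_def)
  ultimately show ?thesis
    unfolding PVI_asymptotics_def using assms(2) by (intro exI[of _ "\<epsilon> / 2"] exI[of _ f] exI[of _ 0]) auto
qed

lemma PVI_branch_exists:
  assumes "a \<noteq> 0" "0 \<le> \<sigma>" "\<sigma> < 1"
  shows "\<exists>r y. PVI_branch \<mu> \<phi> r y \<and> PVI_asymptotics \<phi> a \<sigma> r y"
proof -
  obtain z \<epsilon> C where z: "z \<noteq> 0" and e: "0 < \<epsilon>" "\<epsilon> \<le> 1 - \<sigma>" and C: "C \<ge> 0"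
    "\<And>s. Re s < 0 \<Longrightarrow> norm (ansatz z \<sigma> s 0 - a * exp (of_real (-\<sigma>) * s)) \<le> C * exp ((\<epsilon> - \<sigma>) * Re s)"
    using ansatz_asymptotic[OF assms] by metis
  obtain M K where M: "M \<le> 0" "K \<ge> 0" and
    d: "\<And>s W. Re s < M \<Longrightarrow> norm W \<le> 1 \<Longrightarrow>
       norm (ansatz z \<sigma> s W - ansatz z \<sigma> s 0) \<le> K * exp (- \<sigma> * Re s) * norm W" and
    ns: "\<And>s W. Re s < M \<Longrightarrow> norm W \<le> 1 \<Longrightarrow> exp s * ansatz z \<sigma> s W \<noteq> 1"
    using ansatz_bounds[OF assms(2,3)] by metis
  have "1 - \<sigma> > 0" using assms by simp
  then obtain N L W V where N: "N \<le> M"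
    and W: "\<And>s. s \<in> lhp N \<Longrightarrow> (W has_field_derivative V s) (at s)"
    and V: "\<And>s. s \<in> lhp N \<Longrightarrow> (V has_field_derivative ansatz_force \<mu> z \<sigma> s (W s) (V s)) (at s)"
    and Wb: "\<And>s. s \<in> lhp N \<Longrightarrow> norm (W s) \<le> L * exp ((1 - \<sigma>) * Re s)"
    and W1: "\<And>s. s \<in> lhp N \<Longrightarrow> norm (W s) \<le> 1"
    using tame_picard[OF tame_ansatz_force[OF assms(2,3)]] by metis
  define u where "u s = ansatz z \<sigma> s (W s)" for s
  define r where "r = exp (N - 1)"
  have r: "0 < r" "r < exp N" by (simp_all add: r_def)
  have br: "PVI_branch \<mu> \<phi> r (\<lambda>x. x * u (cut_log \<phi> x))"
  proof (rule branch_from_log[OF _ r(2,1)])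
    show "N \<le> 0" using N M by simp
    fix s assume s: "s \<in> lhp N"
    show "(u has_field_derivative 2 * ansatz_root z \<sigma> s (W s) * (V s - of_real (\<sigma>/2))) (at s)"
      unfolding u_def by (rule ansatz_deriv(1)[OF W[OF s]])
    show "((\<lambda>s. 2 * ansatz_root z \<sigma> s (W s) * (V s - of_real (\<sigma>/2))) has_field_derivative
      2 * ansatz_root z \<sigma> s (W s) * ansatz_force \<mu> z \<sigma> s (W s) (V s)
      + 2 * (2 * u s - 1) * (V s - of_real (\<sigma>/2))^2) (at s)"
      unfolding u_def by (rule ansatz_derivs[OF open_lhp s W V[OF s]])
    have "exp s \<noteq> 1"
      using s N M by (metis exp_eq_1 in_lhp not_less order.trans order_less_imp_le le_less)
    then show "PVI_cleared \<mu> (exp s) (exp s * u s) (u s + 2 * ansatz_root z \<sigma> s (W s) * (V s - of_real (\<sigma>/2)))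
      ((2 * ansatz_root z \<sigma> s (W s) * (V s - of_real (\<sigma>/2)) +
        (2 * ansatz_root z \<sigma> s (W s) * ansatz_force \<mu> z \<sigma> s (W s) (V s)
          + 2 * (2 * u s - 1) * (V s - of_real (\<sigma>/2))^2)) / exp s)"
      using s N ns[of s "W s"] W1 ansatz_root_square[OF z]
      by (subst PVI_cleared_force) (auto simp: u_def ansatz_force_def)
  qed
  have "PVI_asymptotics \<phi> a \<sigma> r (\<lambda>x. x * u (cut_log \<phi> x))"
  proof (rule asymptotics_from_log[OF assms(1) e(1) r(2)])
    show "(\<lambda>x. x * u (cut_log \<phi> x)) analytic_on cut_disc \<phi> r" using br by (simp add: PVI_branch_def)
    fix s assume s: "s \<in> lhp N"
    have L: "L \<ge> 0" using order_trans[OF norm_ge_zero Wb[OF s]] by (simp add: zero_le_mult_iff)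
    \<comment> \<open>There are two errors: the effect of \<open>W\<close>, at most K exp (-\<sigma>
      Re s) |W|, and the distance of the unperturbed ansatz from a exp (-\<sigma> s). As \<epsilon>
      \<le> 1 - \<sigma>, both decay at the rate \<epsilon> relative to exp (-\<sigma> Re
      s).\<close>
    have "norm (u s - a * exp (of_real (-\<sigma>) * s))
      \<le> norm (u s - ansatz z \<sigma> s 0) + norm (ansatz z \<sigma> s 0 - a * exp (of_real (-\<sigma>) * s))"
      by (rule norm_diff_triangle_ineq[of _ "ansatz z \<sigma> s 0" "ansatz z \<sigma> s 0", simplified])
    also have "\<dots> \<le> K * exp (- \<sigma> * Re s) * (L * exp (\<epsilon> * Re s)) + C * exp ((\<epsilon> - \<sigma>) * Re s)"
    proof (rule add_mono)
      have "norm (W s) \<le> L * exp ((1 - \<sigma>) * Re s)" by (rule Wb[OF s])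
      also have "\<dots> \<le> L * exp (\<epsilon> * Re s)"
        using s N M e L by (auto intro!: mult_left_mono mult_right_mono_neg)
      finally have "norm (W s) \<le> L * exp (\<epsilon> * Re s)" .
      then show "norm (u s - ansatz z \<sigma> s 0) \<le> K * exp (- \<sigma> * Re s) * (L * exp (\<epsilon> * Re s))"
        unfolding u_def using d[of s "W s"] W1[OF s] s N M(2)
        by (intro order_trans[OF d mult_left_mono]) auto
    qed (use C(2) s N M in auto)
    also have "\<dots> = (K * L + C) * exp ((\<epsilon> - \<sigma>) * Re s)"
      by (simp add: algebra_simps flip: exp_add)
    finally show "norm (u s - a * exp (of_real (-\<sigma>) * s)) \<le> (K * L + C) * exp ((\<epsilon> - \<sigma>) * Re s)" .
  qed
  with br show ?thesis by blast
qed

section \<open>Uniqueness of the branch\<close>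

text \<open>Converse of \<open>branch_from_log\<close>, but only on a strip, because the branch is
  given on one sheet of the logarithm.\<close>

lemma branch_to_log:
  assumes br: "PVI_branch \<mu> \<phi> r y"
  defines "u \<equiv> \<lambda>s. y (exp s) / exp s"
  shows "u holomorphic_on strip \<phi> (ln r)"
    and "\<And>s. s \<in> strip \<phi> (ln r) \<Longrightarrow>
      PVI_cleared \<mu> (exp s) (exp s * u s) (u s + deriv u s) ((deriv u s + deriv (deriv u) s) / exp s)"
proof -
  have r: "0 < r" "r < 1" using br by (auto simp: PVI_branch_def)
  have x: "exp s \<in> cut_disc \<phi> r" if "s \<in> strip \<phi> (ln r)" for s
    using exp_strip[OF that] r by (auto simp: cut_disc_eq)
  have ana: "y analytic_on {exp s}" if "s \<in> strip \<phi> (ln r)" for s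
    using br x[OF that] analytic_on_subset[of y "cut_disc \<phi> r" "{exp s}"] by (simp add: PVI_branch_def)
  have u': "(u has_field_derivative deriv y (exp s) - u s) (at s)" if "s \<in> strip \<phi> (ln r)" for s
    unfolding u_def
    by (rule DERIV_cong[OF DERIV_divide[OF DERIV_chain2[where f = y and g = exp,
          OF analytic_derivI[OF ana[OF that]] DERIV_exp] DERIV_exp exp_not_eq_zero]])
      (simp add: field_simps)
  show "u holomorphic_on strip \<phi> (ln r)"
    unfolding holomorphic_on_open[OF open_strip] using u' by blast
  have d: "deriv u s = deriv y (exp s) - u s" if "s \<in> strip \<phi> (ln r)" for s
    using u'[OF that] by (rule DERIV_imp_deriv)
  fix s assume s: "s \<in> strip \<phi> (ln r)"
  have "((\<lambda>s. deriv y (exp s) - u s) has_field_derivative deriv (deriv y) (exp s) * exp s - deriv u s) (at s)"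
    by (rule DERIV_cong[OF DERIV_diff[OF DERIV_chain2[where f = "deriv y" and g = exp,
          OF analytic_derivI[OF analytic_deriv[OF ana[OF s]]] DERIV_exp] u'[OF s]]]) (simp add: d[OF s])
  then have "(deriv u has_field_derivative deriv (deriv y) (exp s) * exp s - deriv u s) (at s)"
    by (rule has_field_derivative_transform_within_open[OF _ open_strip s]) (simp add: d)
  then have dd: "deriv (deriv u) s = deriv (deriv y) (exp s) * exp s - deriv u s" by (rule DERIV_imp_deriv)
  have "norm (exp s) \<noteq> norm (1::complex)" using x[OF s] r unfolding cut_disc_def norm_one
    by (metis (mono_tags) mem_Collect_eq not_less)
  then have "exp s \<noteq> 1" by metis
  then have "PVI_cleared \<mu> (exp s) (y (exp s)) (deriv y (exp s)) (deriv (deriv y) (exp s))"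
    using br x[OF s] PVI_at_iff_cleared[OF exp_not_eq_zero] unfolding PVI_branch_def by blast
  moreover have "exp s * u s = y (exp s)" by (simp add: u_def)
  moreover have "u s + deriv u s = deriv y (exp s)" using d[OF s] by simp
  moreover have "(deriv u s + deriv (deriv u) s) / exp s = deriv (deriv y) (exp s)" using dd by simp
  ultimately show "PVI_cleared \<mu> (exp s) (exp s * u s) (u s + deriv u s) ((deriv u s + deriv (deriv u) s) / exp s)"
    by simp
qed

text \<open>Convergence of \<open>f\<close> gives |f| \<le> |c| + 1 near 0, hence the constant |a|
  (|c| + 1). Dividing y by x turns the power 1 - \<sigma> + \<epsilon> of the error term into
  \<epsilon> - \<sigma>.\<close>

lemma asymptotics_to_log:
  assumes "PVI_asymptotics \<phi> a \<sigma> r y" "0 < r"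
  obtains N \<epsilon> C where "N \<le> ln r" "\<epsilon> > 0" "C \<ge> 0"
    "\<And>s. s \<in> strip \<phi> N \<Longrightarrow>
      norm (y (exp s) / exp s - a * exp (of_real (-\<sigma>) * s)) \<le> C * exp ((\<epsilon> - \<sigma>) * Re s)"
proof -
  obtain \<epsilon> f c where e: "\<epsilon> > 0" and f: "(f \<longlongrightarrow> c) (at 0 within cut_disc \<phi> r)" and
    y: "\<And>x. x \<in> cut_disc \<phi> r \<Longrightarrow> y x = a * cut_powr \<phi> x (1 - \<sigma>) * (1 + cut_powr \<phi> x \<epsilon> * f x)"
    using assms(1) unfolding PVI_asymptotics_def by blast
  obtain d where d: "d > 0" "\<And>x. x \<in> cut_disc \<phi> r \<Longrightarrow> x \<noteq> 0 \<Longrightarrow> norm x < d \<Longrightarrow> dist (f x) c < 1"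
    using tendstoD[OF f zero_less_one] unfolding eventually_at by (auto simp: dist_norm)
  have "norm (y (exp s) / exp s - a * exp (of_real (-\<sigma>) * s)) \<le> norm a * (norm c + 1) * exp ((\<epsilon> - \<sigma>) * Re s)"
    if s: "s \<in> strip \<phi> (min (ln r) (ln d))" for s
  proof -
    have x: "exp s \<in> cut_disc \<phi> r" "norm (exp s) < d"
      using exp_strip(1)[OF s] s assms(2) d(1) exp_less_cancel_iff[of "Re s" "ln r"] exp_less_cancel_iff[of "Re s" "ln d"]
      by (auto simp: strip_def cut_disc_eq simp del: exp_less_cancel_iff)
    then have "norm (f (exp s)) \<le> norm c + 1"
      using d(2)[OF x(1) _ x(2)] norm_triangle_ineq2[of "f (exp s)" c] by (simp add: dist_norm)
    moreover have "y (exp s) / exp s - a * exp (of_real (-\<sigma>) * s) = a * exp (of_real (\<epsilon> - \<sigma>) * s) * f (exp s)"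
      by (simp add: y[OF x(1)] cut_powr_def exp_strip(2)[OF s] field_simps flip: exp_add)
    ultimately show ?thesis
      by (simp add: norm_mult mult_left_mono mult.assoc mult.left_commute)
  qed
  then show ?thesis by (intro that[of "min (ln r) (ln d)" \<epsilon> "norm a * (norm c + 1)"]) (use e in auto)
qed

text \<open>The half-line has accumulation points in the connected strip, so the identity theorem
  gives equality for |x| < r. Points with |x| = r correspond to no point of the open strip; they are
  approached radially, and both branches are continuous there.\<close>

lemma branch_eqI:
  assumes "PVI_branch \<mu> \<phi> r1 y1" "PVI_branch \<mu> \<phi> r2 y2"
    and eq: "\<And>t. t < N \<Longrightarrow> y1 (exp (Complex t (\<phi> + pi))) = y2 (exp (Complex t (\<phi> + pi)))"
    and x: "x \<in> cut_disc \<phi> (min r1 r2)"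
  shows "y1 x = y2 x"
proof -
  define r where "r = min r1 r2"
  have r: "r > 0" "r \<le> r1" "r \<le> r2" using assms(1,2) by (auto simp: r_def PVI_branch_def)
  have sub: "strip \<phi> (ln r) \<subseteq> strip \<phi> (ln r1)" "strip \<phi> (ln r) \<subseteq> strip \<phi> (ln r2)"
    using r by (force simp: strip_def intro: less_le_trans)+
  define h where "h s = y1 (exp s) / exp s - y2 (exp s) / exp s" for s
  have h: "h holomorphic_on strip \<phi> (ln r)"
    unfolding h_def using holomorphic_on_subset[OF branch_to_log(1)[OF assms(1)] sub(1)]
      holomorphic_on_subset[OF branch_to_log(1)[OF assms(2)] sub(2)] by (rule holomorphic_on_diff)
  define M where "M = min N (ln r)"
  define U where "U = (\<lambda>t. Complex t (\<phi> + pi)) ` {..<M}"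
  have h0: "h s = 0" if "s \<in> strip \<phi> (ln r)" for s
  proof (rule analytic_continuation[OF h open_strip convex_connected[OF convex_strip]])
    show "U \<subseteq> strip \<phi> (ln r)" by (auto simp: U_def M_def strip_def)
    show "Complex (M - 1) (\<phi> + pi) \<in> strip \<phi> (ln r)" by (auto simp: M_def strip_def)
    show "Complex (M - 1) (\<phi> + pi) islimpt U"
      unfolding islimpt_approachable
    proof (intro allI impI)
      fix e :: real assume "e > 0"
      then show "\<exists>z\<in>U. z \<noteq> Complex (M - 1) (\<phi> + pi) \<and> dist z (Complex (M - 1) (\<phi> + pi)) < e"
        by (intro bexI[of _ "Complex (M - 1 - e/2) (\<phi> + pi)"]) (auto simp: U_def dist_norm cmod_def)
    qed
    show "h z = 0" if "z \<in> U" for z using that eq by (auto simp: U_def M_def h_def)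
  qed fact
  define s where "s = cut_log \<phi> x"
  have x': "x \<noteq> 0" "\<not> is_Arg x \<phi>" "norm x \<le> r" using x by (auto simp: cut_disc_def r_def)
  have sx: "exp s = x" unfolding s_def by (rule exp_cut_log[OF x'(1)])
  define X where "X n = exp (s - of_real (1 / real (Suc n)))" for n
  have "(\<lambda>n. s - of_real (1 / real (Suc n))) \<longlonglongrightarrow> s - of_real 0"
    by (intro tendsto_diff tendsto_const tendsto_of_real) (rule LIMSEQ_Suc, rule lim_const_over_n)
  then have X: "X \<longlonglongrightarrow> x" unfolding X_def using tendsto_exp sx by fastforce
  have Xeq: "y1 (X n) = y2 (X n)" for n
  proof -
    have "Re s \<le> ln r" using x' r by (simp add: s_def Re_cut_log)
    then have "s - of_real (1 / real (Suc n)) \<in> strip \<phi> (ln r)"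
      using Im_cut_log[OF x'(1,2)] by (auto simp: strip_def s_def intro: less_le_trans[of _ "Re (cut_log \<phi> x)"])
    from h0[OF this] show ?thesis by (simp add: h_def X_def)
  qed
  have cont: "isCont y x" if "PVI_branch \<mu> \<phi> \<rho> y" "x \<in> cut_disc \<phi> \<rho>" for y \<rho>
    using that analytic_on_imp_differentiable_at[of y "cut_disc \<phi> \<rho>" x] field_differentiable_imp_continuous_at
    unfolding PVI_branch_def by blast
  have "x \<in> cut_disc \<phi> r1" "x \<in> cut_disc \<phi> r2" using x by (auto simp: cut_disc_def)
  note cont = cont[OF assms(1) this(1)] cont[OF assms(2) this(2)]
  have "(\<lambda>n. y1 (X n)) \<longlonglongrightarrow> y1 x" "(\<lambda>n. y1 (X n)) \<longlonglongrightarrow> y2 x"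
    using isCont_tendsto_compose[OF cont(1) X] isCont_tendsto_compose[OF cont(2) X] by (simp_all add: Xeq)
  then show ?thesis by (rule LIMSEQ_unique)
qed

section \<open>Decay and uniqueness on the middle line of the strip\<close>

lemma strip_line: "Complex t (\<phi> + pi) \<in> strip \<phi> N \<longleftrightarrow> t < N"
  by (simp add: strip_def)

text \<open>The middle line has distance pi > 1 from both edges, so closed unit discs around its
  points with t < N - 1 stay in the strip. The factor exp \<delta> appears because the bound on
  \<open>h\<close> is evaluated at Re s = t + 1.\<close>

lemma strip_Cauchy:
  assumes h: "h holomorphic_on strip \<phi> N" and "\<delta> > 0"
    and b: "\<And>s. s \<in> strip \<phi> N \<Longrightarrow> norm (h s) \<le> C * exp (\<delta> * Re s)" and t: "t < N - 1"
  shows "norm ((deriv ^^ n) h (Complex t (\<phi> + pi))) \<le> fact n * C * exp \<delta> * exp (\<delta> * t)"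
proof -
  let ?s = "Complex t (\<phi> + pi)"
  have C: "C \<ge> 0"
    using order_trans[OF norm_ge_zero b[of ?s]] t by (simp add: strip_line zero_le_mult_iff)
  have sub: "cball ?s 1 \<subseteq> strip \<phi> N"
  proof
    fix s assume "s \<in> cball ?s 1"
    then have "norm (s - ?s) \<le> 1" by (simp add: dist_norm norm_minus_commute)
    then have "\<bar>Re (s - ?s)\<bar> \<le> 1" "\<bar>Im (s - ?s)\<bar> \<le> 1"
      using abs_Re_le_cmod abs_Im_le_cmod order_trans by blast+
    then show "s \<in> strip \<phi> N" using t pi_gt3 by (auto simp: strip_def)
  qed
  have "norm ((deriv ^^ n) h ?s) \<le> fact n * (C * exp (\<delta> * (t + 1))) / 1 ^ n"
  proof (rule Cauchy_inequality)
    show "h holomorphic_on ball ?s 1" using h sub by (meson ball_subset_cball holomorphic_on_subset)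
    show "continuous_on (cball ?s 1) h" using h sub holomorphic_on_imp_continuous_on holomorphic_on_subset by blast
    fix s assume s: "norm (?s - s) = 1"
    have "Re s \<le> t + 1" using abs_Re_le_cmod[of "?s - s"] s by simp
    have "norm (h s) \<le> C * exp (\<delta> * Re s)" using s sub by (intro b) (auto simp: dist_norm)
    also have "\<dots> \<le> C * exp (\<delta> * (t + 1))" using \<open>Re s \<le> t + 1\<close> C \<open>\<delta> > 0\<close> by (intro mult_left_mono) auto
    finally show "norm (h s) \<le> C * exp (\<delta> * (t + 1))" .
  qed simp
  then show ?thesis by (simp add: algebra_simps exp_add)
qed

lemma halving_zero:
  fixes c :: real
  assumes "\<And>n. P (D / 2 ^ n)" "\<And>D. P D \<Longrightarrow> c \<le> D"
  shows "c \<le> 0"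
proof -
  have "(\<lambda>n. D / 2 ^ n) \<longlonglongrightarrow> 0" by real_asymp
  then show ?thesis by (rule LIMSEQ_le_const) (use assms in auto)
qed

lemma tendsto_exp_bound:
  assumes "\<delta> > 0" "\<And>t. t < N \<Longrightarrow> norm (g t) \<le> C * exp (\<delta> * t)"
  shows "(g \<longlongrightarrow> 0) at_bot"
proof (rule Lim_null_comparison)
  show "((\<lambda>t. C * exp (\<delta> * t)) \<longlongrightarrow> 0) at_bot" using assms(1) by real_asymp
  show "\<forall>\<^sub>F t in at_bot. norm (g t) \<le> C * exp (\<delta> * t)"
    using eventually_le_at_bot[of "N - 1"] by eventually_elim (use assms(2) in auto)
qed

text \<open>The difference of the solutions is a double integral from -infinity as in
  \<open>tame_picard\<close>, so any common bound \<open>D\<close> for it improves to D / 2. A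
  single line is enough for this, and it suits branches on a strip, where decay of the derivative
  comes from Cauchy's estimate away from the edges.\<close>

lemma tame_line_unique:
  assumes T: "tame \<delta> G" "\<delta> > 0"
    and W1: "\<And>t. t < N0 \<Longrightarrow> (W1 has_field_derivative V1 (Complex t b)) (at (Complex t b))"
    and V1: "\<And>t. t < N0 \<Longrightarrow> (V1 has_field_derivative G (Complex t b) (W1 (Complex t b)) (V1 (Complex t b))) (at (Complex t b))"
    and W2: "\<And>t. t < N0 \<Longrightarrow> (W2 has_field_derivative V2 (Complex t b)) (at (Complex t b))"
    and V2: "\<And>t. t < N0 \<Longrightarrow> (V2 has_field_derivative G (Complex t b) (W2 (Complex t b)) (V2 (Complex t b))) (at (Complex t b))"
    and lim: "((\<lambda>t. W1 (Complex t b)) \<longlongrightarrow> 0) at_bot" "((\<lambda>t. V1 (Complex t b)) \<longlongrightarrow> 0) at_bot"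
      "((\<lambda>t. W2 (Complex t b)) \<longlongrightarrow> 0) at_bot" "((\<lambda>t. V2 (Complex t b)) \<longlongrightarrow> 0) at_bot"
  shows "\<exists>N. \<forall>t<N. W1 (Complex t b) = W2 (Complex t b)"
proof -
  have ev: "\<forall>\<^sub>F t in at_bot. norm (h (Complex t b)) \<le> 1" if "((\<lambda>t. h (Complex t b)) \<longlongrightarrow> 0) at_bot"
    for h :: "complex \<Rightarrow> complex"
    using tendstoD[OF that zero_less_one] by eventually_elim (simp add: dist_norm)
  have "\<forall>\<^sub>F t in at_bot. norm (W1 (Complex t b)) \<le> 1 \<and> norm (V1 (Complex t b)) \<le> 1 \<and>
     norm (W2 (Complex t b)) \<le> 1 \<and> norm (V2 (Complex t b)) \<le> 1"
    using ev[OF lim(1)] ev[OF lim(2)] ev[OF lim(3)] ev[OF lim(4)] by eventually_elim simp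
  then obtain N1 where N1: "\<And>t. t \<le> N1 \<Longrightarrow> norm (W1 (Complex t b)) \<le> 1 \<and> norm (V1 (Complex t b)) \<le> 1 \<and>
     norm (W2 (Complex t b)) \<le> 1 \<and> norm (V2 (Complex t b)) \<le> 1"
    unfolding eventually_at_bot_linorder by blast
  obtain N2 K where K: "K \<ge> 0" and T': "tame_on N2 K \<delta> G" using T(1) by (rule tameE)
  obtain N where N: "N \<le> min N0 (min N1 N2)" "(K / \<delta> + K / \<delta> / \<delta>) * exp (\<delta> * N) \<le> 1 / 2"
    using exp_small[OF \<open>\<delta> > 0\<close>, of "1/2"] by (metis half_gt_zero_iff zero_less_one)
  define d where "d t = norm (W1 (Complex t b) - W2 (Complex t b)) + norm (V1 (Complex t b) - V2 (Complex t b))" for t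
  have step: "d t \<le> D / 2" if D: "\<And>t. t < N \<Longrightarrow> d t \<le> D" and t: "t < N" for t D
  proof -
    have "d t \<ge> 0" by (simp add: d_def)
    then have D0: "D \<ge> 0" using D[OF t] by simp
    have V: "norm (V1 (Complex t b) - V2 (Complex t b)) \<le> K * D / \<delta> * exp (\<delta> * t)" if "t < N" for t
    proof (rule decay_bound_line[OF \<open>\<delta> > 0\<close> _ _ _ that])
      show "((\<lambda>s. V1 s - V2 s) has_field_derivative G (Complex t b) (W1 (Complex t b)) (V1 (Complex t b))
        - G (Complex t b) (W2 (Complex t b)) (V2 (Complex t b))) (at (Complex t b))" if "t < N" for t
        using that N by (intro DERIV_diff V1 V2) auto
      show "((\<lambda>t. V1 (Complex t b) - V2 (Complex t b)) \<longlongrightarrow> 0) at_bot" using tendsto_diff[OF lim(2,4)] by simp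
      fix t assume t: "t < N"
      have "norm (G (Complex t b) (W1 (Complex t b)) (V1 (Complex t b)) - G (Complex t b) (W2 (Complex t b)) (V2 (Complex t b)))
        \<le> K * exp (\<delta> * t) * d t"
        using tame_onD(2)[OF T', of "Complex t b"] N1[of t] t N(1) unfolding d_def by simp
      also have "\<dots> \<le> K * exp (\<delta> * t) * D" using D[OF t] K by (intro mult_left_mono) auto
      finally show "norm (G (Complex t b) (W1 (Complex t b)) (V1 (Complex t b)) - G (Complex t b) (W2 (Complex t b)) (V2 (Complex t b)))
        \<le> K * D * exp (\<delta> * t)" by (simp add: mult_ac)
    qed
    have W: "norm (W1 (Complex t b) - W2 (Complex t b)) \<le> K * D / \<delta> / \<delta> * exp (\<delta> * t)"
    proof (rule decay_bound_line[OF \<open>\<delta> > 0\<close> _ V _ t])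
      show "((\<lambda>s. W1 s - W2 s) has_field_derivative V1 (Complex t b) - V2 (Complex t b)) (at (Complex t b))" if "t < N" for t
        using that N by (intro DERIV_diff W1 W2) auto
      show "((\<lambda>t. W1 (Complex t b) - W2 (Complex t b)) \<longlongrightarrow> 0) at_bot" using tendsto_diff[OF lim(1,3)] by simp
    qed
    have "d t \<le> D * ((K / \<delta> + K / \<delta> / \<delta>) * exp (\<delta> * t))"
      unfolding d_def using V[OF t] W by (simp add: algebra_simps)
    also have "\<dots> \<le> D * ((K / \<delta> + K / \<delta> / \<delta>) * exp (\<delta> * N))"
      using D0 K t \<open>\<delta> > 0\<close> by (intro mult_left_mono) auto
    also have "\<dots> \<le> D * (1 / 2)" using N D0 by (intro mult_left_mono)
    finally show ?thesis by simp
  qed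
  have start: "d t \<le> 4" if "t < N" for t
    using N1[of t] that N norm_triangle_ineq4[of "W1 (Complex t b)" "W2 (Complex t b)"]
      norm_triangle_ineq4[of "V1 (Complex t b)" "V2 (Complex t b)"] by (simp add: d_def)
  have iter: "\<forall>t<N. d t \<le> 4 / 2 ^ n" for n
  proof (induction n)
    case (Suc n)
    then show ?case using step[of "4 / 2 ^ n"] by (simp add: mult.commute)
  qed (use start in simp)
  have "d t \<le> 0" if "t < N" for t
    by (rule halving_zero[where P = "\<lambda>D. \<forall>t<N. d t \<le> D" and D = 4, OF iter]) (use that in auto)
  then have "W1 (Complex t b) = W2 (Complex t b)" if "t < N" for t
    using that norm_ge_zero[of "W1 (Complex t b) - W2 (Complex t b)"]
      norm_ge_zero[of "V1 (Complex t b) - V2 (Complex t b)"] unfolding d_def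
    by (smt (verit, best) eq_iff_diff_eq_0 norm_le_zero_iff)
  then show ?thesis by blast
qed

section \<open>Recovering W from a given branch\<close>

lemma ansatz_root_lower:
  assumes z: "z \<noteq> 0" and \<sigma>: "0 \<le> \<sigma>" and nd: "\<sigma> = 0 \<Longrightarrow> ansatz z \<sigma> 0 0 \<notin> {0, 1}"
  obtains N c where "N \<le> 0" "c > 0"
    "\<And>s. Re s < N \<Longrightarrow> c * exp (-\<sigma> * Re s) \<le> norm (ansatz_root z \<sigma> s 0)"
proof (cases "\<sigma> = 0")
  case True
  \<comment> \<open>For \<sigma> = 0 the unperturbed root is constant, and its square u (u - 1) is
    nonzero because u avoids 0 and 1.\<close>
  have "(ansatz_root z \<sigma> 0 0)^2 = ansatz z \<sigma> 0 0 * (ansatz z \<sigma> 0 0 - 1)"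
    unfolding ansatz_root_square[OF z] by (simp add: power2_eq_square algebra_simps)
  then have "ansatz_root z \<sigma> 0 0 \<noteq> 0" using nd[OF True] by auto
  moreover have "ansatz_root z \<sigma> s 0 = ansatz_root z \<sigma> 0 0" for s
    by (simp add: True ansatz_root_def ansatz_exp_def)
  ultimately have "ansatz_root z \<sigma> 0 0 \<noteq> 0 \<and> (\<forall>s. ansatz_root z \<sigma> s 0 = ansatz_root z \<sigma> 0 0)"
    by blast
  then obtain q where "q \<noteq> 0" "\<And>s. ansatz_root z \<sigma> s 0 = q" by blast
  then show ?thesis by (intro that[of 0 "norm q"]) (simp_all add: True)
next
  case False
  then have "\<sigma> > 0" using \<sigma> by simp
  then obtain N where N: "N \<le> 0" "norm (1/z) * exp (\<sigma> * N) \<le> norm z / 2"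
    using exp_small[of \<sigma> "norm z / 2" 0 "norm (1/z)"] z by (metis half_gt_zero zero_less_norm_iff)
  show ?thesis
  \<comment> \<open>|z| / 8 is a quarter of |z| - |z| / 2: to the left of \<open>N\<close> the
    second exponential is at most half of the first.\<close>
  proof (rule that[OF N(1), of "norm z / 8"])
    fix s assume s: "Re s < N"
    have 1: "norm (ansatz_exp z \<sigma> s 0) = norm z * exp (-\<sigma> * Re s)"
      by (simp add: ansatz_exp_def norm_mult)
    have "norm (ansatz_exp (1/z) (-\<sigma>) s (-0)) = norm (1/z) * exp (\<sigma> * Re s)"
      by (simp add: ansatz_exp_def norm_mult norm_divide)
    also have "\<dots> \<le> norm (1/z) * exp (\<sigma> * N)"
      using s \<open>\<sigma> > 0\<close> by (intro mult_left_mono) auto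
    also have "\<dots> \<le> norm z / 2 * 1" using N(2) by simp
    also have "\<dots> \<le> norm z / 2 * exp (-\<sigma> * Re s)"
      using s N(1) \<open>\<sigma> > 0\<close> by (intro mult_left_mono) (auto simp: mult_le_0_iff)
    finally have 2: "norm (ansatz_exp (1/z) (-\<sigma>) s (-0)) \<le> norm z / 2 * exp (-\<sigma> * Re s)" .
    have "norm (ansatz_root z \<sigma> s 0) = norm (ansatz_exp z \<sigma> s 0 - ansatz_exp (1/z) (-\<sigma>) s (-0)) / 4"
      by (simp add: ansatz_root_def norm_divide)
    then show "norm z / 8 * exp (-\<sigma> * Re s) \<le> norm (ansatz_root z \<sigma> s 0)"
      using 1 2 norm_triangle_ineq2[of "ansatz_exp z \<sigma> s 0" "ansatz_exp (1/z) (-\<sigma>) s (-0)"] by simp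
  qed (use z in simp)
qed

lemma Re_pos_near_1: "norm (\<rho> - 1) < 1 \<Longrightarrow> Re \<rho> > 0" for \<rho> :: complex
  using abs_Re_le_cmod[of "\<rho> - 1"] by simp

text \<open>(csqrt \<rho> - 1) (csqrt \<rho> + 1) = \<rho> - 1, and since the principal root has
  nonnegative real part the second factor has modulus at least 1.\<close>

lemma csqrt_near_1: "norm (csqrt \<rho> - 1) \<le> norm (\<rho> - 1)"
proof -
  have "1 \<le> Re (csqrt \<rho> + 1)" using csqrt_principal[of \<rho>] by auto
  also have "\<dots> \<le> norm (csqrt \<rho> + 1)" by (rule complex_Re_le_cmod)
  finally have "norm (csqrt \<rho> - 1) * 1 \<le> norm (csqrt \<rho> - 1) * norm (csqrt \<rho> + 1)"
    by (intro mult_left_mono) auto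
  also have "\<dots> = norm ((csqrt \<rho>)^2 - 1)" by (simp add: power2_eq_square algebra_simps flip: norm_mult)
  finally show ?thesis by simp
qed

text \<open>For cosh^2 w = u and cosh w sinh w = S one must have exp (2 w) = 2 u - 1 + 2 S, whose
  inverse is 2 u - 1 - 2 S because S^2 = u^2 - u.\<close>

lemma ansatz_inverse:
  assumes z: "z \<noteq> 0" and S: "S^2 = u^2 - u"
    and \<tau>: "ansatz_exp z \<sigma> s 0 * \<tau> = 2 * u - 1 + 2 * S" and W: "exp (2 * W) = \<tau>"
  shows "ansatz z \<sigma> s W = u" "ansatz_root z \<sigma> s W = S"
proof -
  define p where "p = 2 * u - 1 + 2 * S"
  have p: "p * (2 * u - 1 - 2 * S) = 1" unfolding p_def using S by algebra
  have 1: "ansatz_exp z \<sigma> s W = p" using \<tau> W by (simp add: ansatz_exp_def p_def)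
  then have "p * ansatz_exp (1/z) (-\<sigma>) s (-W) = 1" using ansatz_exp_inverse[OF z, of \<sigma> s W] by simp
  then have 2: "ansatz_exp (1/z) (-\<sigma>) s (-W) = 2 * u - 1 - 2 * S"
    using p by (metis mult_cancel_left mult_zero_left zero_neq_one)
  show "ansatz z \<sigma> s W = u" "ansatz_root z \<sigma> s W = S"
    unfolding ansatz_def ansatz_root_def 1 2 by (simp_all add: p_def)
qed

text \<open>The inversion of u = cosh^2 w takes two explicit steps. The ratio \<rho> of u^2 - u to
  its unperturbed value tends to 1, so \<open>csqrt\<close> selects the root \<open>S\<close> that
  continues the one at W = 0; then \<tau> = exp (2 W) tends to 1 and \<open>W\<close> is half its
  principal logarithm. Both choices are holomorphic because \<rho> and \<tau> stay in the right
  half-plane. The condition for \<sigma> = 0 keeps the unperturbed root, by which \<rho> divides,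
  away from 0.\<close>

lemma log_ansatz:
  assumes z: "z \<noteq> 0" and \<sigma>: "0 \<le> \<sigma>" "\<sigma> < 1" and nd: "\<sigma> = 0 \<Longrightarrow> ansatz z \<sigma> 0 0 \<notin> {0, 1}"
    and \<epsilon>: "\<epsilon>0 > 0" "\<epsilon> > 0" and C: "C0 \<ge> 0" "C \<ge> 0"
    and as0: "\<And>s. Re s < 0 \<Longrightarrow> norm (ansatz z \<sigma> s 0 - a * exp (of_real (-\<sigma>) * s)) \<le> C0 * exp ((\<epsilon>0 - \<sigma>) * Re s)"
    and u: "u holomorphic_on strip \<phi> N1"
    and as: "\<And>s. s \<in> strip \<phi> N1 \<Longrightarrow> norm (u s - a * exp (of_real (-\<sigma>) * s)) \<le> C * exp ((\<epsilon> - \<sigma>) * Re s)"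
  obtains N \<delta> L W where "N \<le> N1" "N \<le> M" "\<delta> > 0" "W holomorphic_on strip \<phi> N"
    "\<And>s. s \<in> strip \<phi> N \<Longrightarrow> ansatz z \<sigma> s (W s) = u s"
    "\<And>s. s \<in> strip \<phi> N \<Longrightarrow> ansatz_root z \<sigma> s (W s) \<noteq> 0"
    "\<And>s. s \<in> strip \<phi> N \<Longrightarrow> norm (W s) \<le> L * exp (\<delta> * Re s)"
    "\<And>s. s \<in> strip \<phi> N \<Longrightarrow> norm (W s) \<le> 1"
proof -
  obtain N2 c where N2: "N2 \<le> 0" "c > 0" and
    low: "\<And>s. Re s < N2 \<Longrightarrow> c * exp (-\<sigma> * Re s) \<le> norm (ansatz_root z \<sigma> s 0)"
    using ansatz_root_lower[OF z \<sigma>(1) nd] by metis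
  obtain N3 K where N3: "N3 \<le> 0" "K \<ge> 0" and
    T: "tame_on N3 K (-\<sigma>) (\<lambda>s W V. ansatz z \<sigma> s W)" "tame_on N3 K (-\<sigma>) (\<lambda>s W V. ansatz_root z \<sigma> s W)"
    using tame_ansatz[OF \<sigma>(1), of z] by (rule tameE2)
  define \<delta> where "\<delta> = min \<epsilon> \<epsilon>0"
  have \<delta>: "\<delta> > 0" using \<epsilon> by (simp add: \<delta>_def)
  \<comment> \<open>With \<open>A\<close> and \<open>m\<close> the unperturbed ansatz and root:
    \<open>C1\<close> controls u - A relative to exp (-\<sigma> Re s), \<open>C2\<close> controls
    \<rho> - 1 = (u - A) (u + A - 1) / m^2, and \<open>C3\<close> controls \<tau> - 1, all with
    decay exp (\<delta> Re s). The threshold 1/4 then gives positive real parts and the estimate of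
    \<open>Ln\<close> near 1.\<close>
  define C1 where "C1 = C + C0"
  define C2 where "C2 = C1 * (C1 + 2 * K + 1) / c^2"
  define C3 where "C3 = (2 * C1 + 2 * K * C2) / norm z"
  have C0: "C1 \<ge> 0" "C2 \<ge> 0" "C3 \<ge> 0" using C N2 N3 by (auto simp: C1_def C2_def C3_def)
  obtain N where N: "N \<le> min M (min N1 (min N2 N3))" "(C2 + C3) * exp (\<delta> * N) \<le> 1/4"
    using exp_small[OF \<delta>, of "1/4"] by (metis zero_less_divide_1_iff zero_less_numeral)
  define \<rho> where "\<rho> s = ((u s)^2 - u s) / (ansatz_root z \<sigma> s 0)^2" for s
  define S where "S s = ansatz_root z \<sigma> s 0 * csqrt (\<rho> s)" for s
  define \<tau> where "\<tau> s = (2 * u s - 1 + 2 * S s) / ansatz_exp z \<sigma> s 0" for s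
  define W where "W s = Ln (\<tau> s) / 2" for s
  have A0: "ansatz_exp z \<sigma> s 0 \<noteq> 0" for s using z by (simp add: ansatz_exp_def)
  have *: "norm (\<rho> s - 1) \<le> C2 * exp (\<delta> * Re s) \<and> norm (\<tau> s - 1) \<le> C3 * exp (\<delta> * Re s)
    \<and> norm (\<rho> s - 1) \<le> 1/4 \<and> norm (\<tau> s - 1) \<le> 1/4 \<and> ansatz_root z \<sigma> s 0 \<noteq> 0"
    if s: "s \<in> strip \<phi> N" for s
  proof -
    define e where "e = exp (-\<sigma> * Re s)"
    define h where "h = exp (\<delta> * Re s)"
    have t: "Re s < 0" "Re s < N2" "Re s < N3" "s \<in> strip \<phi> N1" "Re s < N"
      using s N N2 by (auto simp: strip_def)
    have eh: "exp ((\<delta> - \<sigma>) * Re s) = e * h" by (simp add: e_def h_def algebra_simps flip: exp_add)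
    have e1: "e \<ge> 1" "h > 0" "h \<le> 1"
      using t \<sigma> \<delta> by (auto simp: e_def h_def mult_le_0_iff)
    define A where "A = ansatz z \<sigma> s 0"
    define m where "m = ansatz_root z \<sigma> s 0"
    have "norm (u s - A) \<le> norm (u s - a * exp (of_real (-\<sigma>) * s)) + norm (A - a * exp (of_real (-\<sigma>) * s))"
      by (rule norm_diff_triangle_le[OF order_refl]) (simp add: norm_minus_commute)
    also have "\<dots> \<le> C * exp ((\<epsilon> - \<sigma>) * Re s) + C0 * exp ((\<epsilon>0 - \<sigma>) * Re s)"
      unfolding A_def by (intro add_mono as as0 t)
    also have "\<dots> \<le> C * (e * h) + C0 * (e * h)"
      unfolding eh[symmetric] using t C by (intro add_mono mult_left_mono) (auto simp: \<delta>_def intro: mult_right_mono_neg)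
    finally have uA: "norm (u s - A) \<le> C1 * e * h" by (simp add: C1_def algebra_simps)
    have Ab: "norm A \<le> K * e" using tame_onD(1)[OF T(1) t(3), of 0 0] by (simp add: A_def e_def)
    have mb: "norm m \<le> K * e" using tame_onD(1)[OF T(2) t(3), of 0 0] by (simp add: m_def e_def)
    have ml: "c * e \<le> norm m" using low[OF t(2)] by (simp add: m_def e_def)
    have m0: "m \<noteq> 0" using ml N2 e1 by (auto simp: mult_le_0_iff)
    have "norm (u s + A - 1) \<le> norm (u s - A) + 2 * norm A + 1"
      using norm_triangle_ineq4[of "(u s - A) + 2 * A" 1] norm_triangle_ineq[of "u s - A" "2 * A"]
      by (simp add: norm_mult add.commute)
    also have "\<dots> \<le> C1 * e * 1 + 2 * (K * e) + 1 * e"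
      using e1 C0 Ab by (intro add_mono order_trans[OF uA] mult_left_mono) auto
    finally have uA2: "norm (u s + A - 1) \<le> (C1 + 2 * K + 1) * e" by (simp add: algebra_simps)
    have m2: "m^2 = A^2 - A" unfolding m_def A_def by (rule ansatz_root_square[OF z])
    have "\<rho> s - 1 = (u s - A) * (u s + A - 1) / m^2"
    proof -
      have "\<rho> s - 1 = ((u s)^2 - u s - m^2) / m^2"
        using m0 by (simp add: \<rho>_def diff_divide_distrib flip: m_def)
      also have "(u s)^2 - u s - m^2 = (u s - A) * (u s + A - 1)" unfolding m2 by algebra
      finally show ?thesis .
    qed
    then have "norm (\<rho> s - 1) = norm (u s - A) * norm (u s + A - 1) / (norm m)^2"
      by (simp add: norm_divide norm_mult norm_power)
    also have "\<dots> \<le> (C1 * e * h) * ((C1 + 2 * K + 1) * e) / (c * e)^2"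
      using uA uA2 ml N2 N3 e1 C0 by (intro frac_le mult_mono power_mono) auto
    also have "\<dots> = C2 * h" using e1 N2 by (simp add: C2_def power2_eq_square)
    finally have r: "norm (\<rho> s - 1) \<le> C2 * h" .
    have AE: "ansatz_exp z \<sigma> s 0 = 2 * A - 1 + 2 * m"
      unfolding A_def m_def ansatz_def ansatz_root_def by (simp add: algebra_simps add_divide_distrib diff_divide_distrib)
    have "\<tau> s - 1 = (2 * (u s - A) + 2 * m * (csqrt (\<rho> s) - 1)) / ansatz_exp z \<sigma> s 0"
      using A0[of s] by (simp add: \<tau>_def S_def divide_simps flip: m_def) (simp add: AE algebra_simps)
    then have "norm (\<tau> s - 1) = norm (2 * (u s - A) + 2 * m * (csqrt (\<rho> s) - 1)) / (norm z * e)"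
      by (simp add: norm_divide ansatz_exp_def norm_mult e_def)
    also have "\<dots> \<le> (2 * (C1 * e * h) + 2 * (K * e) * (C2 * h)) / (norm z * e)"
    proof (intro divide_right_mono order_trans[OF norm_triangle_ineq] add_mono)
      show "norm (2 * (u s - A)) \<le> 2 * (C1 * e * h)" unfolding norm_mult using uA by simp
      show "norm (2 * m * (csqrt (\<rho> s) - 1)) \<le> 2 * (K * e) * (C2 * h)"
        unfolding norm_mult using mb order_trans[OF csqrt_near_1 r] N3 e1
        by (intro mult_mono) auto
    qed (use e1 in auto)
    also have "\<dots> = C3 * h" using e1 z by (simp add: C3_def field_simps)
    finally have tau: "norm (\<tau> s - 1) \<le> C3 * h" .
    have "(C2 + C3) * h \<le> (C2 + C3) * exp (\<delta> * N)"
      unfolding h_def using t \<delta> C0 by (intro mult_left_mono) auto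
    then have "C2 * h + C3 * h \<le> 1/4" using N(2) by (simp add: distrib_right)
    moreover have "0 \<le> C2 * h" "0 \<le> C3 * h" using C0 e1 by auto
    ultimately show ?thesis using r tau m0 unfolding h_def m_def by linarith
  qed
  have Re\<rho>: "Re (\<rho> s) > 0" "Re (\<tau> s) > 0" if "s \<in> strip \<phi> N" for s
    using *[OF that] by (auto intro!: Re_pos_near_1)
  have sub: "strip \<phi> N \<subseteq> strip \<phi> N1" using N by (auto simp: strip_def)
  have uh: "u holomorphic_on strip \<phi> N" using u sub by (rule holomorphic_on_subset)
  have nn: "x \<notin> \<real>\<^sub>\<le>\<^sub>0" if "Re x > 0" for x :: complex using that by (auto simp: complex_nonpos_Reals_iff)
  have Rh: "(\<lambda>s. ansatz_root z \<sigma> s 0) holomorphic_on X" "(\<lambda>s. ansatz_exp z \<sigma> s 0) holomorphic_on X" for X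
    unfolding ansatz_root_def ansatz_exp_def by (auto intro!: holomorphic_intros)
  have \<rho>h: "\<rho> holomorphic_on strip \<phi> N"
    unfolding \<rho>_def using * by (intro holomorphic_intros uh Rh) auto
  have Sh: "S holomorphic_on strip \<phi> N"
    unfolding S_def by (intro holomorphic_on_mult Rh holomorphic_on_csqrt' \<rho>h nn Re\<rho>)
  have \<tau>h: "\<tau> holomorphic_on strip \<phi> N"
    unfolding \<tau>_def using A0 by (intro holomorphic_intros uh Rh Sh) auto
  have Wh: "W holomorphic_on strip \<phi> N"
    unfolding W_def by (intro holomorphic_on_divide holomorphic_on_Ln' \<tau>h nn Re\<rho>) auto
  have W: "ansatz z \<sigma> s (W s) = u s \<and> ansatz_root z \<sigma> s (W s) \<noteq> 0
      \<and> norm (W s) \<le> C3 * exp (\<delta> * Re s) \<and> norm (W s) \<le> 1"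
    if s: "s \<in> strip \<phi> N" for s
  proof (intro conjI)
    note b = *[OF s]
    have "\<tau> s \<noteq> 0" "\<rho> s \<noteq> 0" using Re\<rho>[OF s] by auto
    have "exp (2 * W s) = \<tau> s" using \<open>\<tau> s \<noteq> 0\<close> by (simp add: W_def)
    moreover have "ansatz_exp z \<sigma> s 0 * \<tau> s = 2 * u s - 1 + 2 * S s" using A0[of s] by (simp add: \<tau>_def)
    moreover have "(S s)^2 = (u s)^2 - u s" using b by (simp add: S_def \<rho>_def power_mult_distrib)
    ultimately have "ansatz z \<sigma> s (W s) = u s" "ansatz_root z \<sigma> s (W s) = S s"
      using ansatz_inverse[OF z] by blast+
    moreover have "S s \<noteq> 0" using b \<open>\<rho> s \<noteq> 0\<close> by (simp add: S_def)
    ultimately show "ansatz z \<sigma> s (W s) = u s" "ansatz_root z \<sigma> s (W s) \<noteq> 0" by auto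
    have "norm (Ln (1 + (\<tau> s - 1))) \<le> 2 * norm (\<tau> s - 1)" using b by (intro norm_Ln_le) simp
    then have "norm (W s) \<le> norm (\<tau> s - 1)" by (simp add: W_def norm_divide)
    with b show "norm (W s) \<le> C3 * exp (\<delta> * Re s)" "norm (W s) \<le> 1" by linarith+
  qed
  show ?thesis
    by (rule that[of N \<delta> W C3]) (use N W Wh \<delta> in auto)
qed

text \<open>As the root does not vanish at \<open>s\<close>, the factor m^3 behind
  \<open>PVI_cleared_force\<close> cancels, and the equation for \<open>u\<close> becomes the
  equation for \<open>W\<close>.\<close>

lemma log_ansatz_ode:
  assumes z: "z \<noteq> 0" and W: "W holomorphic_on strip \<phi> N" and "N \<le> 0"
    and s: "s \<in> strip \<phi> N"
    and eq: "\<And>s. s \<in> strip \<phi> N \<Longrightarrow> ansatz z \<sigma> s (W s) = u s"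
    and nz: "ansatz_root z \<sigma> s (W s) \<noteq> 0" "exp s * ansatz z \<sigma> s (W s) \<noteq> 1"
    and PVI: "PVI_cleared \<mu> (exp s) (exp s * u s) (u s + deriv u s) ((deriv u s + deriv (deriv u) s) / exp s)"
  shows "(deriv W has_field_derivative ansatz_force \<mu> z \<sigma> s (W s) (deriv W s)) (at s)"
proof -
  have W': "(W has_field_derivative deriv W s) (at s)" if "s \<in> strip \<phi> N" for s
    using W open_strip that by (rule holomorphic_derivI)
  have W'': "(deriv W has_field_derivative deriv (deriv W) s) (at s)"
    using holomorphic_deriv[OF W open_strip] open_strip s by (rule holomorphic_derivI)
  define \<omega> where "\<omega> s = deriv W s - of_real (\<sigma>/2)" for s
  have "(u has_field_derivative 2 * ansatz_root z \<sigma> s (W s) * \<omega> s) (at s)" if "s \<in> strip \<phi> N" for s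
    unfolding \<omega>_def by (rule has_field_derivative_transform_within_open[OF ansatz_deriv(1)[OF W'[OF that]] open_strip that eq])
  then have u': "deriv u s = 2 * ansatz_root z \<sigma> s (W s) * \<omega> s" if "s \<in> strip \<phi> N" for s
    using DERIV_imp_deriv that by blast
  have "(deriv u has_field_derivative 2 * ansatz_root z \<sigma> s (W s) * deriv (deriv W) s
      + 2 * (2 * ansatz z \<sigma> s (W s) - 1) * (\<omega> s)^2) (at s)"
    unfolding \<omega>_def
    by (rule has_field_derivative_transform_within_open[OF ansatz_derivs[OF open_strip s W' W''] open_strip s])
      (simp_all add: u' \<omega>_def)
  then have u'': "deriv (deriv u) s = 2 * ansatz_root z \<sigma> s (W s) * deriv (deriv W) s
      + 2 * (2 * u s - 1) * (\<omega> s)^2" by (simp add: DERIV_imp_deriv eq[OF s])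
  have "exp s \<noteq> 1" using s assms(3) by (metis (no_types, lifting) exp_eq_1 mem_Collect_eq not_less order.strict_trans2 strip_def)
  then have "deriv (deriv W) s = PVI_force \<mu> (exp s) (u s) (ansatz_root z \<sigma> s (W s)) (\<omega> s)"
    using PVI nz ansatz_root_square[OF z, of \<sigma> s "W s"]
    unfolding u'[OF s] u'' eq[OF s] by (subst (asm) PVI_cleared_force) auto
  then show ?thesis using W'' by (simp add: ansatz_force_def \<omega>_def eq[OF s])
qed

text \<open>Both solutions are inverted with the same z, so their corrections \<open>W\<close> solve
  the same equation and tend to 0; on the middle line so do the derivatives. The index type
  \<open>bool\<close> treats the two solutions at once.\<close>

lemma strip_unique:
  assumes a: "a \<noteq> 0" and \<sigma>: "0 \<le> \<sigma>" "\<sigma> < 1" and nd: "\<not> (\<sigma> = 0 \<and> a = 1)"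
    and \<epsilon>: "\<And>i::bool. \<epsilon> i > 0" and C: "\<And>i. C i \<ge> 0"
    and u: "\<And>i. u i holomorphic_on strip \<phi> (N i)"
    and as: "\<And>i s. s \<in> strip \<phi> (N i) \<Longrightarrow> norm (u i s - a * exp (of_real (-\<sigma>) * s)) \<le> C i * exp ((\<epsilon> i - \<sigma>) * Re s)"
    and PVI: "\<And>i s. s \<in> strip \<phi> (N i) \<Longrightarrow> PVI_cleared \<mu> (exp s) (exp s * u i s)
      (u i s + deriv (u i) s) ((deriv (u i) s + deriv (deriv (u i)) s) / exp s)"
  shows "\<exists>N. \<forall>t<N. u True (Complex t (\<phi> + pi)) = u False (Complex t (\<phi> + pi))"
proof -
  let ?l = "\<lambda>t. Complex t (\<phi> + pi)"
  obtain z \<epsilon>0 C0 where z: "z \<noteq> 0" and e0: "0 < \<epsilon>0" "C0 \<ge> 0" and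
    as0: "\<And>s. Re s < 0 \<Longrightarrow> norm (ansatz z \<sigma> s 0 - a * exp (of_real (-\<sigma>) * s)) \<le> C0 * exp ((\<epsilon>0 - \<sigma>) * Re s)"
    and az: "\<And>s. \<sigma> = 0 \<Longrightarrow> ansatz z \<sigma> s 0 = a"
    using ansatz_asymptotic[OF a \<sigma>] by metis
  have nd': "ansatz z \<sigma> 0 0 \<notin> {0, 1}" if "\<sigma> = 0" using az[OF that] nd a that by auto
  obtain M where M: "M \<le> 0" "\<And>s W. Re s < M \<Longrightarrow> norm W \<le> 1 \<Longrightarrow> exp s * ansatz z \<sigma> s W \<noteq> 1"
    using ansatz_bounds[OF \<sigma>] by metis
  have "\<exists>N' \<delta> L W. N' \<le> N i \<and> N' \<le> M \<and> \<delta> > 0 \<and> W holomorphic_on strip \<phi> N' \<and>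
      (\<forall>s\<in>strip \<phi> N'. ansatz z \<sigma> s (W s) = u i s \<and> ansatz_root z \<sigma> s (W s) \<noteq> 0 \<and>
         norm (W s) \<le> L * exp (\<delta> * Re s) \<and> norm (W s) \<le> 1)" for i
    by (rule log_ansatz[OF z \<sigma> nd' e0(1) \<epsilon>[of i] e0(2) C[of i] as0 u as, where M = M])
      (assumption | blast)+
  then obtain N' \<delta> L W where
    N': "\<And>i. N' i \<le> N i" "\<And>i. N' i \<le> M" and d: "\<And>i. \<delta> i > 0" and W: "\<And>i. W i holomorphic_on strip \<phi> (N' i)"
    and Wp: "\<And>i s. s \<in> strip \<phi> (N' i) \<Longrightarrow> ansatz z \<sigma> s (W i s) = u i s \<and> ansatz_root z \<sigma> s (W i s) \<noteq> 0 \<and>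
         norm (W i s) \<le> L i * exp (\<delta> i * Re s) \<and> norm (W i s) \<le> 1"
    by metis
  have W': "(W i has_field_derivative deriv (W i) s) (at s)" if "s \<in> strip \<phi> (N' i)" for s i
    using W open_strip that by (rule holomorphic_derivI)
  have W'': "(deriv (W i) has_field_derivative ansatz_force \<mu> z \<sigma> s (W i s) (deriv (W i) s)) (at s)"
    if "s \<in> strip \<phi> (N' i)" for s i
  proof (rule log_ansatz_ode[OF z W _ that, where u = "u i"])
    show "N' i \<le> 0" using N'(2)[of i] M(1) by simp
    show "exp s * ansatz z \<sigma> s (W i s) \<noteq> 1" using M(2)[of s "W i s"] Wp[OF that] that N'(2)[of i] by (simp add: strip_def)
    have "s \<in> strip \<phi> (N i)" using that N'(1)[of i] by (simp add: strip_def)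
    then show "PVI_cleared \<mu> (exp s) (exp s * u i s) (u i s + deriv (u i) s) ((deriv (u i) s + deriv (deriv (u i)) s) / exp s)"
      by (rule PVI)
  qed (use Wp that in auto)
  have lim: "((\<lambda>t. W i (?l t)) \<longlongrightarrow> 0) at_bot" "((\<lambda>t. deriv (W i) (?l t)) \<longlongrightarrow> 0) at_bot" for i
  proof -
    have b: "norm ((deriv ^^ n) (W i) (?l t)) \<le> fact n * L i * exp (\<delta> i) * exp (\<delta> i * t)" if "t < N' i - 1" for t n
      using Wp by (intro strip_Cauchy[OF W d _ that]) auto
    show "((\<lambda>t. W i (?l t)) \<longlongrightarrow> 0) at_bot" "((\<lambda>t. deriv (W i) (?l t)) \<longlongrightarrow> 0) at_bot"
      using tendsto_exp_bound[OF d b[where n = 0]] tendsto_exp_bound[OF d b[where n = 1]] by simp_all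
  qed
  have "\<exists>N. \<forall>t<N. W True (?l t) = W False (?l t)"
    by (rule tame_line_unique[OF tame_ansatz_force[OF \<sigma>, of \<mu> z], where ?N0.0 = "min (N' True) (N' False)"
        and ?V1.0 = "deriv (W True)" and ?V2.0 = "deriv (W False)"])
      (use \<sigma> lim W' W'' in \<open>simp_all add: strip_line\<close>)
  then obtain N0 where "\<And>t. t < N0 \<Longrightarrow> W True (?l t) = W False (?l t)" by blast
  then have "u True (?l t) = u False (?l t)" if "t < min N0 (min (N' True) (N' False))" for t
    using that Wp[of "?l t" True] Wp[of "?l t" False] by (auto simp: strip_line)
  then show ?thesis by blast
qed

section \<open>The degenerate case sigma = 0, a = 1\<close>

text \<open>For \<open>\<sigma> = 0\<close>, \<open>a = 1\<close> the square root \<open>m\<close> of \<open>u (u - 1)\<close> tends to \<open>0\<close> and may branch.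
  The energy \<open>E = v\<^sup>2 / (u (u - 1)) = 4 w'\<^sup>2\<close> avoids it: the equation itself exhibits \<open>E\<close> as a function
  that stays regular at the zeros of \<open>u - 1\<close>, and \<open>(u - 1, v, E)\<close> solves a regular first-order system.\<close>

lemma degenerate_estimates:
  fixes x u v E \<mu> :: complex
  assumes "norm x \<le> 1/4" "norm (u - 1) \<le> 1/4" "norm v \<le> 1"
  defines "X \<equiv> 1 / (1 - x)" and "Y \<equiv> 1 / (1 - x * u)" and "\<nu> \<equiv> (2 * \<mu> - 1)^2"
  defines "\<alpha> \<equiv> - (X * Y) / 2 - \<nu> * (1 - x * u) * X^2 / 2" and "\<beta> \<equiv> X - (2 * u + v) * Y / 2"
  defines "K \<equiv> 8 + 8 * norm \<nu>"
  shows "norm (u * (u - 1) * \<alpha> + v * \<beta>) \<le> K * (norm (u - 1) + norm v)"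
    and "norm (v * \<alpha> + E * \<beta>) \<le> K * (norm v + norm E)"
    and "1 - x \<noteq> 0" "1 - x * u \<noteq> 0" "norm (2 * u - 1) \<ge> 1/2" "norm (2 * u - 1) \<le> 3/2" "u \<noteq> 0"
proof -
  have u: "norm u \<le> 5/4" using assms(2) norm_triangle_ineq[of "u - 1" 1] by simp
  show "u \<noteq> 0" using assms(2) by auto
  have "norm (x * u) \<le> 1/4 * (5/4)" unfolding norm_mult using u assms(1) by (intro mult_mono) auto
  then have xu: "norm (x * u) \<le> 1/2" by simp
  have 1: "norm (1 - x) \<ge> 1/2" "norm (1 - x * u) \<ge> 1/2" "norm (1 - x * u) \<le> 3/2"
    using norm_triangle_ineq2[of 1 x] norm_triangle_ineq2[of 1 "x * u"] norm_triangle_ineq4[of 1 "x * u"] xu assms(1)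
    by auto
  then show "1 - x \<noteq> 0" "1 - x * u \<noteq> 0" by fastforce+
  have XY: "norm X \<le> 2" "norm Y \<le> 2" using 1(1,2) by (simp_all add: X_def Y_def norm_divide divide_simps)
  have "norm (2 * u - 1) = norm (1 + 2 * (u - 1))" by simp
  moreover have "norm (2 * (u - 1)) = 2 * norm (u - 1)" unfolding norm_mult by simp
  ultimately show "norm (2 * u - 1) \<ge> 1/2" "norm (2 * u - 1) \<le> 3/2"
    using assms(2) norm_triangle_ineq[of 1 "2 * (u - 1)"] norm_diff_ineq[of 1 "2 * (u - 1)"]
    unfolding norm_one by linarith+
  have "norm \<alpha> \<le> norm (X * Y) / 2 + norm (\<nu> * (1 - x * u) * X^2) / 2"
    unfolding \<alpha>_def by (rule order_trans[OF norm_triangle_ineq4]) (simp add: norm_divide)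
  also have "\<dots> \<le> (2 * 2) / 2 + (norm \<nu> * (3/2) * 2^2) / 2"
    unfolding norm_mult norm_power using XY 1
    by (intro add_mono divide_right_mono mult_mono power_mono) auto
  finally have a: "norm \<alpha> \<le> 2 + 3 * norm \<nu>" by simp
  have "norm \<beta> \<le> norm X + norm ((2 * u + v) * Y) / 2"
    unfolding \<beta>_def by (rule order_trans[OF norm_triangle_ineq4]) (simp add: norm_divide)
  also have "norm (2 * u + v) \<le> 2 * (5/4) + 1"
    using norm_triangle_ineq[of "2 * u" v] u assms(3) by (simp add: norm_mult)
  then have "norm X + norm ((2 * u + v) * Y) / 2 \<le> 2 + ((2 * (5/4) + 1) * 2) / 2"
    unfolding norm_mult[of "2 * u + v"] using XY
    by (intro add_mono divide_right_mono mult_mono) auto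
  finally have b: "norm \<beta> \<le> 6" by simp
  have ua: "norm (u * \<alpha>) \<le> K"
  proof -
    have "norm (u * \<alpha>) \<le> 5/4 * (2 + 3 * norm \<nu>)" unfolding norm_mult using u a by (intro mult_mono) auto
    also have "\<dots> = 5/2 + 15/4 * norm \<nu>" by (simp add: algebra_simps)
    also have "\<dots> \<le> K" unfolding K_def using norm_ge_zero[of \<nu>] by linarith
    finally show ?thesis .
  qed
  have aK: "norm \<alpha> \<le> K" "norm \<beta> \<le> K" using a b norm_ge_zero[of \<nu>] unfolding K_def by linarith+
  have "norm (u * (u - 1) * \<alpha> + v * \<beta>) \<le> norm (u * \<alpha>) * norm (u - 1) + norm \<beta> * norm v"
    by (rule order_trans[OF norm_triangle_ineq]) (simp add: norm_mult mult_ac)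
  also have "\<dots> \<le> K * norm (u - 1) + K * norm v" using ua aK by (intro add_mono mult_right_mono) auto
  finally show "norm (u * (u - 1) * \<alpha> + v * \<beta>) \<le> K * (norm (u - 1) + norm v)" by (simp add: distrib_left)
  have "norm (v * \<alpha> + E * \<beta>) \<le> norm \<alpha> * norm v + norm \<beta> * norm E"
    by (rule order_trans[OF norm_triangle_ineq]) (simp add: norm_mult mult_ac)
  also have "\<dots> \<le> K * norm v + K * norm E" using aK by (intro add_mono mult_right_mono) auto
  finally show "norm (v * \<alpha> + E * \<beta>) \<le> K * (norm v + norm E)" by (simp add: distrib_left)
qed

text \<open>R = u (u - 1) \<alpha> + v \<beta> is the bracket multiplied by u (u - 1) x in
  \<open>PVI_cleared_log\<close>, divided by 2 (x - 1)^2 (x u - 1). So the equation reads 2 u (u -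
  1) (v' - x R) = (2 u - 1) v^2. Dividing by 2 u - 1, close to 1 in the application, instead of u (u
  - 1), close to 0, yields an expression for E that is regular at u = 1.\<close>

lemma degenerate_first_integral:
  fixes x u v v' \<mu> :: complex
  assumes "x \<noteq> 0" "1 - x \<noteq> 0" "1 - x * u \<noteq> 0" "2 * u - 1 \<noteq> 0"
    and PVI: "PVI_cleared \<mu> x (x * u) (u + v) ((v + v') / x)"
  defines "X \<equiv> 1 / (1 - x)" and "Y \<equiv> 1 / (1 - x * u)" and "\<nu> \<equiv> (2 * \<mu> - 1)^2"
  defines "\<alpha> \<equiv> - (X * Y) / 2 - \<nu> * (1 - x * u) * X^2 / 2" and "\<beta> \<equiv> X - (2 * u + v) * Y / 2"
  shows "u * (u - 1) * (2 * (v' - x * (u * (u - 1) * \<alpha> + v * \<beta>)) / (2 * u - 1)) = v^2"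
proof -
  define R where "R = u * (u - 1) * \<alpha> + v * \<beta>"
  define Q where "Q = (x - 1)^2 * (x * u - 1)"
  have X: "X * (x - 1) = -1" and Y: "Y * (x * u - 1) = -1"
    using assms(2,3) by (auto simp: X_def Y_def divide_simps)
  have Q: "Q \<noteq> 0" using assms(2,3) by (auto simp: Q_def)
  have QR: "2 * (Q * R) = (x - 1)^2 * (2 * u * v + v^2) - 2 * (x - 1) * (x * u - 1) * v
          + u * (u - 1) * (\<nu> * (x * u - 1)^2 - (x - 1))"
  proof -
    have "2 * R = u * (u - 1) * (- (X * Y) - \<nu> * (1 - x * u) * X^2) + v * (2 * X - (2 * u + v) * Y)"
      unfolding R_def \<alpha>_def \<beta>_def by (simp add: field_simps)
    then show ?thesis unfolding Q_def using X Y by algebra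
  qed
  have "2 * u * (u - 1) * Q * v' = (2 * u - 1) * Q * v^2 + u * (u - 1) * x * (2 * (Q * R))"
    using PVI unfolding PVI_cleared_log[OF assms(1)] QR unfolding Q_def \<nu>_def .
  then have "Q * (u * (u - 1) * (2 * (v' - x * R))) = Q * ((2 * u - 1) * v^2)" by algebra
  then have "u * (u - 1) * (2 * (v' - x * R)) = (2 * u - 1) * v^2" using Q by simp
  then show ?thesis using assms(4) unfolding R_def[symmetric] by (simp add: field_simps)
qed

text \<open>At leading order the chain from \<open>E\<close> to \<open>v\<close> to \<open>g\<close>
  is nilpotent, so smallness is passed along it: first \<open>E\<close> gains a factor exp M, then
  \<open>v\<close> by using the improved \<open>E\<close>, then \<open>g\<close>. The weight exp
  (\<epsilon> t) makes every integration from -infinity converge at the cost 1 / \<epsilon>. In this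
  way \<open>D\<close> improves to D / 2.\<close>

lemma strip_line_contraction:
  fixes g v v' E E' :: "complex \<Rightarrow> complex"
  assumes "\<epsilon> > 0" "K \<ge> 0"
    and g: "\<And>t. t < N \<Longrightarrow> (g has_field_derivative v (Complex t b)) (at (Complex t b))"
    and v: "\<And>t. t < N \<Longrightarrow> (v has_field_derivative v' (Complex t b)) (at (Complex t b))"
    and E: "\<And>t. t < N \<Longrightarrow> (E has_field_derivative E' (Complex t b)) (at (Complex t b))"
    and v'b: "\<And>t. t < N \<Longrightarrow> norm (v' (Complex t b)) \<le>
      norm (E (Complex t b)) + K * exp t * (norm (g (Complex t b)) + norm (v (Complex t b)))"
    and E'b: "\<And>t. t < N \<Longrightarrow> norm (E' (Complex t b)) \<le>
      K * exp t * (norm (v (Complex t b)) + norm (E (Complex t b)))"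
    and b: "\<And>t. t < N \<Longrightarrow> norm (g (Complex t b)) \<le> D * exp (\<epsilon> * t) \<and>
      norm (v (Complex t b)) \<le> D * exp (\<epsilon> * t) \<and> norm (E (Complex t b)) \<le> D * exp (\<epsilon> * t)"
  shows "\<exists>N. \<forall>t<N. g (Complex t b) = 0"
proof -
  let ?l = "\<lambda>t. Complex t b"
  \<comment> \<open>With q = K exp M and p = 2 q (1 / \<epsilon> + 1), the new constants for
    \<open>E\<close>, \<open>v\<close>, \<open>g\<close> are 2 q / \<epsilon>, p / \<epsilon> and p
    / \<epsilon>^2 times \<open>D\<close>; each of these factors is at most \<kappa> exp M.\<close>
  define \<kappa> where "\<kappa> = 2 * K * (1 / \<epsilon> + 1) * (1 + 1 / \<epsilon> + 1 / \<epsilon>^2)"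
  obtain M where M: "M \<le> N" "\<kappa> * exp M \<le> 1/2"
    using exp_small[of 1 "1/2" N \<kappa>] by (metis half_gt_zero_iff mult_1 zero_less_one)
  have lim: "((\<lambda>t. g (?l t)) \<longlongrightarrow> 0) at_bot" "((\<lambda>t. v (?l t)) \<longlongrightarrow> 0) at_bot" "((\<lambda>t. E (?l t)) \<longlongrightarrow> 0) at_bot"
    using b by (intro tendsto_exp_bound[OF \<open>\<epsilon> > 0\<close>, of N _ D]; simp)+
  have step: "norm (g (?l t)) \<le> D / 2 * exp (\<epsilon> * t) \<and> norm (v (?l t)) \<le> D / 2 * exp (\<epsilon> * t) \<and>
      norm (E (?l t)) \<le> D / 2 * exp (\<epsilon> * t)"
    if D: "\<forall>t<M. norm (g (?l t)) \<le> D * exp (\<epsilon> * t) \<and> norm (v (?l t)) \<le> D * exp (\<epsilon> * t) \<and> norm (E (?l t)) \<le> D * exp (\<epsilon> * t)"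
      and t: "t < M" for t D
  proof -
    define q where "q = K * exp M"
    have q0: "q \<ge> 0" using assms(2) by (simp add: q_def)
    have D0: "D \<ge> 0" using order_trans[OF norm_ge_zero, of "g (?l t)" "D * exp (\<epsilon> * t)"] D t
      by (simp add: zero_le_mult_iff)
    have Kq: "K * exp t * y \<le> q * z" if "t < M" "y \<le> z" "0 \<le> y" for t y z
      unfolding q_def using that assms(2) by (intro mult_mono) auto
    have E1: "norm (E (?l t)) \<le> 2 * q * D / \<epsilon> * exp (\<epsilon> * t)" if "t < M" for t
    proof (rule decay_bound_line[OF \<open>\<epsilon> > 0\<close> E _ lim(3) that])
      fix t assume t: "t < M"
      have "norm (E' (?l t)) \<le> q * (D * exp (\<epsilon> * t) + D * exp (\<epsilon> * t))"
        using t M D by (intro order_trans[OF E'b Kq] add_mono) auto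
      then show "norm (E' (?l t)) \<le> 2 * q * D * exp (\<epsilon> * t)" by (simp add: algebra_simps)
    qed (use M in auto)
    have v1: "norm (v (?l t)) \<le> 2 * q * D * (1 / \<epsilon> + 1) / \<epsilon> * exp (\<epsilon> * t)" if "t < M" for t
    proof (rule decay_bound_line[OF \<open>\<epsilon> > 0\<close> v _ lim(2) that])
      fix t assume t: "t < M"
      have "norm (v' (?l t)) \<le> 2 * q * D / \<epsilon> * exp (\<epsilon> * t) + q * (D * exp (\<epsilon> * t) + D * exp (\<epsilon> * t))"
        using t M D by (intro order_trans[OF v'b add_mono] E1 Kq add_mono) auto
      then show "norm (v' (?l t)) \<le> 2 * q * D * (1 / \<epsilon> + 1) * exp (\<epsilon> * t)" by (simp add: algebra_simps)
    qed (use M in auto)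
    have g1: "norm (g (?l t)) \<le> 2 * q * D * (1 / \<epsilon> + 1) / \<epsilon> / \<epsilon> * exp (\<epsilon> * t)"
      using M by (intro decay_bound_line[OF \<open>\<epsilon> > 0\<close> g v1 lim(1) t]) auto
    define p where "p = 2 * q * (1 / \<epsilon> + 1)"
    have p: "p * (1 + 1 / \<epsilon> + 1 / \<epsilon>^2) \<le> 1/2"
      using M(2) by (simp add: p_def q_def \<kappa>_def mult_ac)
    have p0: "p \<ge> 0" "p / \<epsilon> \<ge> 0" "p / \<epsilon>^2 \<ge> 0" using q0 assms(1) by (auto simp: p_def)
    have "p + p / \<epsilon> + p / \<epsilon>^2 \<le> 1/2" using p by (simp add: distrib_left)
    moreover have "2 * q / \<epsilon> \<le> p" using q0 by (simp add: p_def distrib_left)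
    ultimately have s: "2 * q / \<epsilon> \<le> 1/2" "p / \<epsilon> \<le> 1/2" "p / \<epsilon>^2 \<le> 1/2" using p0 by linarith+
    have c: "c * D * exp (\<epsilon> * t) \<le> D / 2 * exp (\<epsilon> * t)" if "c \<le> 1/2" for c
      using mult_right_mono[OF that D0] by (intro mult_right_mono) auto
    have "2 * q * D / \<epsilon> = 2 * q / \<epsilon> * D" "2 * q * D * (1 / \<epsilon> + 1) / \<epsilon> = p / \<epsilon> * D"
      "2 * q * D * (1 / \<epsilon> + 1) / \<epsilon> / \<epsilon> = p / \<epsilon>^2 * D" by (simp_all add: p_def power2_eq_square)
    then show ?thesis
      using g1 v1[OF t] E1[OF t] c[OF s(1)] c[OF s(2)] c[OF s(3)] by (metis order_trans)
  qed
  have iter: "\<forall>t<M. norm (g (?l t)) \<le> D / 2 ^ n * exp (\<epsilon> * t) \<and> norm (v (?l t)) \<le> D / 2 ^ n * exp (\<epsilon> * t) \<and>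
      norm (E (?l t)) \<le> D / 2 ^ n * exp (\<epsilon> * t)" for n
  proof (induction n)
    case (Suc n)
    then show ?case using step[of "D / 2 ^ n"] by (simp add: mult.commute)
  qed (use b M in simp)
  have "norm (g (?l t)) / exp (\<epsilon> * t) \<le> 0" if "t < M" for t
  proof (rule halving_zero[where P = "\<lambda>D. norm (g (?l t)) \<le> D * exp (\<epsilon> * t)" and D = D])
    show "norm (g (?l t)) \<le> D / 2 ^ n * exp (\<epsilon> * t)" for n using iter that by blast
  qed (simp add: divide_simps)
  then have "g (?l t) = 0" if "t < M" for t using that by (simp add: divide_le_0_iff)
  then show ?thesis by blast
qed

text \<open>In terms of y the claim is y = x. Differentiating the energy identity yields the
  equation for E' only after cancelling u - 1. This is possible off the zeros of u - 1 and extends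
  over them by the identity theorem, unless u is identically 1 and the claim is immediate.\<close>

lemma degenerate_unique:
  assumes \<epsilon>: "\<epsilon> > 0" and u: "u holomorphic_on strip \<phi> N0"
    and as: "\<And>s. s \<in> strip \<phi> N0 \<Longrightarrow> norm (u s - 1) \<le> C * exp (\<epsilon> * Re s)"
    and PVI: "\<And>s. s \<in> strip \<phi> N0 \<Longrightarrow> PVI_cleared \<mu> (exp s) (exp s * u s)
      (u s + deriv u s) ((deriv u s + deriv (deriv u) s) / exp s)"
  shows "\<exists>N. \<forall>t<N. u (Complex t (\<phi> + pi)) = 1"
proof -
  let ?l = "\<lambda>t. Complex t (\<phi> + pi)"
  \<comment> \<open>N1 \<le> -2 gives |x| \<le> 1/4 and the second inequality gives |u - 1| \<le>
    1/4, as \<open>degenerate_estimates\<close> requires.\<close>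
  obtain N1 where N1: "N1 \<le> min N0 (- 2)" "\<bar>C\<bar> * exp (\<epsilon> * N1) \<le> 1/4"
    using exp_small[OF \<epsilon>, of "1/4"] by (metis zero_less_divide_1_iff zero_less_numeral)
  have exp2: "exp (-2) \<le> (1/4 :: real)"
  proof -
    have "(2::real) * 2 \<le> exp 1 * exp 1" using exp_ge_add_one_self[of 1] by (intro mult_mono) auto
    also have "\<dots> = exp 2" by (simp flip: exp_add)
    finally show ?thesis by (simp add: exp_minus divide_simps)
  qed
  have sub: "strip \<phi> N1 \<subseteq> strip \<phi> N0" using N1 by (auto simp: strip_def)
  have uh: "u holomorphic_on strip \<phi> N1" using u sub by (rule holomorphic_on_subset)
  have xb: "norm (exp s) \<le> 1/4" if "s \<in> strip \<phi> N1" for s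
  proof -
    have "exp (Re s) \<le> exp (-2)" using that N1(1) by (simp add: strip_def)
    then show ?thesis unfolding norm_exp_eq_Re using exp2 by (rule order_trans)
  qed
  have ub: "norm (u s - 1) \<le> 1/4" if s: "s \<in> strip \<phi> N1" for s
  proof -
    have "norm (u s - 1) \<le> C * exp (\<epsilon> * Re s)" using as s sub by blast
    also have "\<dots> \<le> \<bar>C\<bar> * exp (\<epsilon> * N1)" using s \<epsilon> by (intro mult_mono) (auto simp: strip_def)
    finally show ?thesis using N1(2) by linarith
  qed
  define v where "v = deriv u"
  define X where "X s = 1 / (1 - exp s)" for s :: complex
  define Y where "Y s = 1 / (1 - exp s * u s)" for s
  define \<alpha> where "\<alpha> s = - (X s * Y s) / 2 - (2 * \<mu> - 1)^2 * (1 - exp s * u s) * (X s)^2 / 2" for s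
  define \<beta> where "\<beta> s = X s - (2 * u s + v s) * Y s / 2" for s
  define R where "R s = u s * (u s - 1) * \<alpha> s + v s * \<beta> s" for s
  define E where "E s = 2 * (deriv v s - exp s * R s) / (2 * u s - 1)" for s
  define K where "K = 8 + 8 * norm ((2 * \<mu> - 1)^2)"
  \<comment> \<open>These four facts do not involve \<open>v\<close>, for which 0 is
    inserted.\<close>
  have nz: "1 - exp s \<noteq> 0" "1 - exp s * u s \<noteq> 0" "2 * u s - 1 \<noteq> 0" "u s \<noteq> 0" if "s \<in> strip \<phi> N1" for s
    using degenerate_estimates(3-5,7)[OF xb[OF that] ub[OF that], of 0] by auto
  have vh: "v holomorphic_on strip \<phi> N1" "deriv v holomorphic_on strip \<phi> N1"
    unfolding v_def by (intro holomorphic_deriv open_strip uh)+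
  have Xh: "X holomorphic_on strip \<phi> N1" "Y holomorphic_on strip \<phi> N1"
    unfolding X_def Y_def using nz by (auto intro!: holomorphic_intros uh)
  have \<alpha>h: "\<alpha> holomorphic_on strip \<phi> N1" "\<beta> holomorphic_on strip \<phi> N1"
    unfolding \<alpha>_def \<beta>_def by (auto intro!: holomorphic_intros uh vh Xh)
  have Rh: "R holomorphic_on strip \<phi> N1"
    unfolding R_def by (auto intro!: holomorphic_intros uh vh \<alpha>h)
  have Eh: "E holomorphic_on strip \<phi> N1"
    unfolding E_def using nz by (auto intro!: holomorphic_intros uh vh Rh)
  have u': "(u has_field_derivative v s) (at s)" "(v has_field_derivative deriv v s) (at s)"
    "(E has_field_derivative deriv E s) (at s)" if "s \<in> strip \<phi> N1" for s
    unfolding v_def using that holomorphic_derivI[OF uh open_strip] holomorphic_derivI[OF vh(1) open_strip]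
      holomorphic_derivI[OF Eh open_strip] by (auto simp: v_def)
  have int: "u s * (u s - 1) * E s = (v s)^2" if "s \<in> strip \<phi> N1" for s
    using degenerate_first_integral[OF exp_not_eq_zero nz(1-3)[OF that] PVI[OF subsetD[OF sub that]]]
    by (simp add: E_def R_def \<alpha>_def \<beta>_def X_def Y_def v_def)
  \<comment> \<open>\<open>h\<close> is the defect in the equation for E', multiplied by
    \<open>u\<close> so that (u - 1) h = 0 is the differentiated identity u (u - 1) E = v^2.\<close>
  define h where "h s = u s * (deriv E s - 2 * exp s * (v s * \<alpha> s + E s * \<beta> s))" for s
  have hh: "h holomorphic_on strip \<phi> N1"
    unfolding h_def by (intro holomorphic_intros uh vh Eh \<alpha>h holomorphic_deriv open_strip)
  have gh: "(u s - 1) * h s = 0" if s: "s \<in> strip \<phi> N1" for s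
  proof -
    have "((\<lambda>s. u s * (u s - 1) * E s) has_field_derivative
      (2 * u s - 1) * v s * E s + u s * (u s - 1) * deriv E s) (at s)"
      by (rule derivative_eq_intros u'[OF s] refl)+ (simp add: algebra_simps)
    moreover have "((\<lambda>s. u s * (u s - 1) * E s) has_field_derivative 2 * v s * deriv v s) (at s)"
      by (rule has_field_derivative_transform_within_open[OF _ open_strip s, of "\<lambda>s. (v s)^2"])
        (use int u'[OF s] in \<open>auto intro!: derivative_eq_intros\<close>)
    ultimately have "(2 * u s - 1) * v s * E s + u s * (u s - 1) * deriv E s = 2 * v s * deriv v s"
      by (rule DERIV_unique)
    moreover have "(2 * u s - 1) * E s = 2 * (deriv v s - exp s * R s)" using nz(3)[OF s] by (simp add: E_def)
    ultimately have "u s * (u s - 1) * deriv E s = 2 * exp s * v s * R s" by algebra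
    also have "\<dots> = 2 * exp s * (u s * (u s - 1)) * (v s * \<alpha> s + E s * \<beta> s)"
      using int[OF s] unfolding R_def by algebra
    finally show ?thesis unfolding h_def by algebra
  qed
  show ?thesis
  proof (cases "\<forall>s\<in>strip \<phi> N1. u s = 1")
    case True
    then show ?thesis by (intro exI[of _ N1]) (simp add: strip_line)
  next
    case False
    then obtain s0 where s0: "s0 \<in> strip \<phi> N1" "u s0 \<noteq> 1" by blast
    have op: "open {s \<in> strip \<phi> N1. u s \<in> - {1}}"
      by (rule continuous_open_preimage[OF holomorphic_on_imp_continuous_on[OF uh] open_strip, unfolded vimage_def Int_def, simplified])
        auto
    have off: "h s = 0" if "s \<in> strip \<phi> N1" "u s \<noteq> 1" for s using gh that by force
    have h0: "h s = 0" if "s \<in> strip \<phi> N1" for s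
      by (rule analytic_continuation_open[where s = "{s \<in> strip \<phi> N1. u s \<in> - {1}}"
          and s' = "strip \<phi> N1" and f = h and g = "\<lambda>_. 0"])
        (use op off open_strip s0 convex_connected[OF convex_strip] hh that in auto)
    have E': "deriv E s = 2 * exp s * (v s * \<alpha> s + E s * \<beta> s)" if "s \<in> strip \<phi> N1" for s
      using h0[OF that] nz(4)[OF that] by (simp add: h_def)
    have v': "deriv v s = (2 * u s - 1) / 2 * E s + exp s * R s" if "s \<in> strip \<phi> N1" for s
    proof -
      have "(2 * u s - 1) * E s = 2 * (deriv v s - exp s * R s)" using nz(3)[OF that] by (simp add: E_def)
      then have "(2 * u s - 1) / 2 * E s = deriv v s - exp s * R s" by (metis mult.commute
          nonzero_mult_div_cancel_left times_divide_eq_left zero_neq_numeral)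
      then show ?thesis by (simp only: diff_add_cancel)
    qed
    \<comment> \<open>Orders 0, 1 and 2 bound u - 1, v and v'; the bound on v' gives the initial
      decay of \<open>E\<close>.\<close>
    have gb: "norm ((deriv ^^ n) (\<lambda>s. u s - 1) (?l t)) \<le> fact n * C * exp \<epsilon> * exp (\<epsilon> * t)" if "t < N1 - 1" for n t
      by (rule strip_Cauchy[OF _ \<epsilon> _ that]) (use uh as sub in \<open>auto intro!: holomorphic_intros\<close>)
    have dg: "deriv (\<lambda>s. u s - 1) s = v s" if "s \<in> strip \<phi> N1" for s
      using u'(1)[OF that] by (auto intro!: DERIV_imp_deriv derivative_eq_intros)
    have ddg: "deriv (deriv (\<lambda>s. u s - 1)) s = deriv v s" if "s \<in> strip \<phi> N1" for s
      by (rule DERIV_imp_deriv, rule has_field_derivative_transform_within_open[OF u'(2)[OF that] open_strip that])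
        (simp add: dg)
    define B where "B = \<bar>C\<bar> * exp \<epsilon>"
    have B0: "B \<ge> 0" by (simp add: B_def)
    have b: "norm (u (?l t) - 1) \<le> B * exp (\<epsilon> * t)" "norm (v (?l t)) \<le> B * exp (\<epsilon> * t)"
      "norm (deriv v (?l t)) \<le> 2 * B * exp (\<epsilon> * t)" if "t < N1 - 1" for t
    proof -
      have l: "?l t \<in> strip \<phi> N1" using that by (simp add: strip_line)
      have "C * exp \<epsilon> * exp (\<epsilon> * t) \<le> B * exp (\<epsilon> * t)" unfolding B_def by (intro mult_right_mono) auto
      moreover have "norm (u (?l t) - 1) \<le> C * exp \<epsilon> * exp (\<epsilon> * t)" "norm (v (?l t)) \<le> C * exp \<epsilon> * exp (\<epsilon> * t)"
        "norm (deriv v (?l t)) \<le> 2 * (C * exp \<epsilon> * exp (\<epsilon> * t))"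
        using gb[OF that, of 0] gb[OF that, of 1] gb[OF that, of 2] dg[OF l] ddg[OF l]
        by (simp_all add: numeral_2_eq_2)
      ultimately show "norm (u (?l t) - 1) \<le> B * exp (\<epsilon> * t)" "norm (v (?l t)) \<le> B * exp (\<epsilon> * t)"
        "norm (deriv v (?l t)) \<le> 2 * B * exp (\<epsilon> * t)" by linarith+
    qed
    obtain N where N: "N \<le> N1 - 1" "B * exp (\<epsilon> * N) \<le> 1" using exp_small[OF \<epsilon> zero_less_one] by metis
    have K: "K \<ge> 1" by (simp add: K_def)
    have line: "?l t \<in> strip \<phi> N1" "norm (v (?l t)) \<le> 1" "norm (exp (?l t)) = exp t" if "t < N" for t
    proof -
      show "?l t \<in> strip \<phi> N1" "norm (exp (?l t)) = exp t" using that N by (simp_all add: strip_line)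
      have "norm (v (?l t)) \<le> B * exp (\<epsilon> * t)" using b(2) that N by simp
      also have "\<dots> \<le> B * exp (\<epsilon> * N)" using that \<epsilon> B0 by (intro mult_left_mono) auto
      finally show "norm (v (?l t)) \<le> 1" using N by simp
    qed
    have est: "norm (R (?l t)) \<le> K * (norm (u (?l t) - 1) + norm (v (?l t)))"
      "norm (v (?l t) * \<alpha> (?l t) + E (?l t) * \<beta> (?l t)) \<le> K * (norm (v (?l t)) + norm (E (?l t)))"
      "norm (2 * u (?l t) - 1) \<ge> 1/2" "norm (2 * u (?l t) - 1) \<le> 3/2" if "t < N" for t
    proof -
      note d = xb[OF line(1)[OF that]] ub[OF line(1)[OF that]] line(2)[OF that]
      show "norm (R (?l t)) \<le> K * (norm (u (?l t) - 1) + norm (v (?l t)))"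
        unfolding R_def \<alpha>_def \<beta>_def X_def Y_def K_def by (rule degenerate_estimates(1)[OF d])
      show "norm (v (?l t) * \<alpha> (?l t) + E (?l t) * \<beta> (?l t)) \<le> K * (norm (v (?l t)) + norm (E (?l t)))"
        unfolding \<alpha>_def \<beta>_def X_def Y_def K_def by (rule degenerate_estimates(2)[OF d])
      show "norm (2 * u (?l t) - 1) \<ge> 1/2" "norm (2 * u (?l t) - 1) \<le> 3/2"
        using degenerate_estimates(5,6)[OF d] by blast+
    qed
    have Eb: "norm (E (?l t)) \<le> (4 * B * (2 + 2 * K)) * exp (\<epsilon> * t)" if t: "t < N" for t
    proof -
      have e1: "exp t \<le> 1" using t N N1 by simp
      have "norm (E (?l t)) = 2 * norm (deriv v (?l t) - exp (?l t) * R (?l t)) / norm (2 * u (?l t) - 1)"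
        unfolding E_def norm_divide norm_mult[of 2] by simp
      also have "\<dots> \<le> 2 * (2 * B * exp (\<epsilon> * t) + 1 * (K * (B * exp (\<epsilon> * t) + B * exp (\<epsilon> * t)))) / (1/2)"
      proof (intro frac_le mult_left_mono)
        show "norm (deriv v (?l t) - exp (?l t) * R (?l t)) \<le> 2 * B * exp (\<epsilon> * t) + 1 * (K * (B * exp (\<epsilon> * t) + B * exp (\<epsilon> * t)))"
        proof (rule order_trans[OF norm_triangle_ineq4], rule add_mono)
          have "norm (R (?l t)) \<le> K * (B * exp (\<epsilon> * t) + B * exp (\<epsilon> * t))"
            using t N K by (intro order_trans[OF est(1)[OF t]] mult_left_mono add_mono b) auto
          then show "norm (exp (?l t) * R (?l t)) \<le> 1 * (K * (B * exp (\<epsilon> * t) + B * exp (\<epsilon> * t)))"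
            unfolding norm_mult line(3)[OF t] using e1 by (intro mult_mono) auto
        qed (use b(3) t N in simp)
      qed (use est(3)[OF t] B0 K in auto)
      also have "\<dots> = (4 * B * (2 + 2 * K)) * exp (\<epsilon> * t)" by (simp add: algebra_simps)
      finally show ?thesis .
    qed
    \<comment> \<open>The constant found for \<open>E\<close>, namely 2 (2 B + 2 K B) / (1/2); it
      dominates the constant \<open>B\<close> of the other two functions.\<close>
    define D where "D = 4 * B * (2 + 2 * K)"
    have BD: "B \<le> D" unfolding D_def using B0 K mult_left_mono[of 1 "4 * (2 + 2 * K)" B] by (simp add: algebra_simps)
    have "\<exists>N. \<forall>t<N. (\<lambda>s. u s - 1) (?l t) = 0"
    proof (rule strip_line_contraction[where N = N and v = v and v' = "deriv v" and E = E and E' = "deriv E"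
          and K = "2 * K" and D = D, OF \<epsilon>])
      fix t assume t: "t < N"
      note l = line[OF t]
      show "((\<lambda>s. u s - 1) has_field_derivative v (?l t)) (at (?l t))"
        using u'(1)[OF l(1)] by (auto intro!: derivative_eq_intros)
      show "(v has_field_derivative deriv v (?l t)) (at (?l t))" "(E has_field_derivative deriv E (?l t)) (at (?l t))"
        using u'(2,3)[OF l(1)] by auto
      have "norm (deriv v (?l t)) \<le> norm (2 * u (?l t) - 1) / 2 * norm (E (?l t)) + exp t * norm (R (?l t))"
        unfolding v'[OF l(1)] by (rule order_trans[OF norm_triangle_ineq]) (simp add: norm_mult norm_divide)
      also have "\<dots> \<le> 1 * norm (E (?l t)) + exp t * (K * (norm (u (?l t) - 1) + norm (v (?l t))))"
        using est(4)[OF t] est(1)[OF t] by (intro add_mono mult_right_mono mult_left_mono) auto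
      also have "\<dots> \<le> norm (E (?l t)) + 2 * K * exp t * (norm (u (?l t) - 1) + norm (v (?l t)))"
        using K by (simp add: mult_ac)
      finally show "norm (deriv v (?l t)) \<le> norm (E (?l t)) + 2 * K * exp t * (norm (u (?l t) - 1) + norm (v (?l t)))" .
      have "norm (deriv E (?l t)) = 2 * exp t * norm (v (?l t) * \<alpha> (?l t) + E (?l t) * \<beta> (?l t))"
        unfolding E'[OF l(1)] by (simp add: norm_mult)
      also have "\<dots> \<le> 2 * exp t * (K * (norm (v (?l t)) + norm (E (?l t))))"
        using est(2)[OF t] by (intro mult_left_mono) auto
      finally show "norm (deriv E (?l t)) \<le> 2 * K * exp t * (norm (v (?l t)) + norm (E (?l t)))"
        by (simp add: mult_ac)
      have "B * exp (\<epsilon> * t) \<le> D * exp (\<epsilon> * t)" using BD by (intro mult_right_mono) auto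
      then show "norm (u (?l t) - 1) \<le> D * exp (\<epsilon> * t) \<and> norm (v (?l t)) \<le> D * exp (\<epsilon> * t) \<and>
          norm (E (?l t)) \<le> D * exp (\<epsilon> * t)"
        using b(1,2)[of t] Eb[OF t] t N unfolding D_def by (auto intro: order_trans)
    qed (use K in auto)
    then show ?thesis by simp
  qed
qed

section \<open>Comparison of two arbitrary branches and the conclusion\<close>

lemma PVI_branch_unique:
  assumes a: "a \<noteq> 0" and \<sigma>: "0 \<le> \<sigma>" "\<sigma> < 1"
    and y: "\<And>i::bool. PVI_branch \<mu> \<phi> (r i) (y i)" "\<And>i. PVI_asymptotics \<phi> a \<sigma> (r i) (y i)"
    and x: "x \<in> cut_disc \<phi> (min (r True) (r False))"
  shows "y True x = y False x"
proof -
  define u where "u i s = y i (exp s) / exp s" for i s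
  have "\<exists>N \<epsilon> C. N \<le> ln (r i) \<and> \<epsilon> > 0 \<and> C \<ge> 0 \<and> (\<forall>s\<in>strip \<phi> N.
      norm (u i s - a * exp (of_real (-\<sigma>) * s)) \<le> C * exp ((\<epsilon> - \<sigma>) * Re s))" for i
  proof -
    have "r i > 0" using y(1)[of i] by (simp add: PVI_branch_def)
    from asymptotics_to_log[OF y(2) this] show ?thesis unfolding u_def by metis
  qed
  then obtain N \<epsilon> C where N: "\<And>i. N i \<le> ln (r i)" and \<epsilon>: "\<And>i. \<epsilon> i > 0" and C: "\<And>i. C i \<ge> 0" and
    as: "\<And>i s. s \<in> strip \<phi> (N i) \<Longrightarrow> norm (u i s - a * exp (of_real (-\<sigma>) * s)) \<le> C i * exp ((\<epsilon> i - \<sigma>) * Re s)"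
    by metis
  have sub: "strip \<phi> (N i) \<subseteq> strip \<phi> (ln (r i))" for i using N[of i] by (auto simp: strip_def)
  have u: "u i holomorphic_on strip \<phi> (N i)" for i
    unfolding u_def using branch_to_log(1)[OF y(1)] sub by (rule holomorphic_on_subset)
  have PVI: "PVI_cleared \<mu> (exp s) (exp s * u i s) (u i s + deriv (u i) s) ((deriv (u i) s + deriv (deriv (u i)) s) / exp s)"
    if "s \<in> strip \<phi> (N i)" for i s
    using branch_to_log(2)[OF y(1) subsetD[OF sub that]] by (simp add: u_def[abs_def])
  have "\<exists>N. \<forall>t<N. u True (Complex t (\<phi> + pi)) = u False (Complex t (\<phi> + pi))"
  proof (cases "\<sigma> = 0 \<and> a = 1")
    case False
    show ?thesis by (rule strip_unique[OF a \<sigma> False \<epsilon> C u as PVI])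
  next
    case True
    have "\<exists>N. \<forall>t<N. u i (Complex t (\<phi> + pi)) = 1" for i
      by (rule degenerate_unique[OF \<epsilon>[of i] u _ PVI]) (use as True in auto)
    then obtain M where "\<And>i t. t < M i \<Longrightarrow> u i (Complex t (\<phi> + pi)) = 1" by metis
    then show ?thesis by (intro exI[of _ "min (M True) (M False)"]) simp
  qed
  then obtain M where M: "\<And>t. t < M \<Longrightarrow> u True (Complex t (\<phi> + pi)) = u False (Complex t (\<phi> + pi))" by blast
  show ?thesis
    by (rule branch_eqI[OF y(1) y(1) _ x, of M]) (use M in \<open>simp add: u_def\<close>)
qed

theorem theorem2p2:
  fixes \<mu> a\<^sub>0 :: complex and \<sigma>\<^sub>0 \<phi> :: real
  assumes "2 * \<mu> \<notin> \<int>"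
    and "a\<^sub>0 \<noteq> 0"
    and "0 \<le> \<sigma>\<^sub>0" and "\<sigma>\<^sub>0 < 1"
  shows "\<exists>r y. PVI_branch \<mu> \<phi> r y \<and> PVI_asymptotics \<phi> a\<^sub>0 \<sigma>\<^sub>0 r y \<and>
           (\<forall>r' y'. PVI_branch \<mu> \<phi> r' y' \<and> PVI_asymptotics \<phi> a\<^sub>0 \<sigma>\<^sub>0 r' y' \<longrightarrow>
              (\<forall>x\<in>cut_disc \<phi> (min r r'). y' x = y x))"
proof -
  obtain r y where y: "PVI_branch \<mu> \<phi> r y" "PVI_asymptotics \<phi> a\<^sub>0 \<sigma>\<^sub>0 r y"
    using PVI_branch_exists[OF assms(2-4)] by blast
  moreover have "y' x = y x" if "PVI_branch \<mu> \<phi> r' y'" "PVI_asymptotics \<phi> a\<^sub>0 \<sigma>\<^sub>0 r' y'"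
    "x \<in> cut_disc \<phi> (min r r')" for r' y' x
    using PVI_branch_unique[OF assms(2-4), of \<mu> \<phi> "\<lambda>i. if i then r' else r" "\<lambda>i. if i then y' else y" x]
      y that by (simp add: min.commute split: if_splits)
  ultimately show ?thesis by blast
qed

end
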